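(* Consider the stochastic occupancy-ADMM described in the context, under the sampling, regularity and parameter conditions stated there. If $\sum_k m_k^{-1}<\infty$, then almost surely $\Psi_k$ converges, $$\sum_k\big(\|\Delta\theta_{k+1}\|^2+\|\Delta x_{k+1}\|^2+\|\Delta x_k\|^2\big)<\infty,$$ $\delta_k\to0$, and $G_k^{\mathrm{true}}\to0$.
   Context: Norms are Euclidean/spectral. $(\mathcal S,\mathcal A,P,r,\rho,\gamma)$ is a finite discounted MDP, $0<\gamma<1$, with known bounded rewards. $\Theta\subset\mathbb R^p$ is closed and convex, $\theta\mapsto\pi_\theta$ is a smooth policy map on a neighborhood of $\Theta$. $\psi_\Theta=\phi+\delta_\Theta$ ($\delta_\Theta$ the indicator) is proper, lower semicontinuous, bounded below; $\partial\psi_\Theta$ is the limiting subdifferential. $x=(q,d)$ with $q\in\mathbb R^{|\mathcal S||\mathcal A|}$, $d\in\mathbb R^{|\mathcal S|}$; $(P^{\mathsf T}q)(s')=\sum_{s,a}P(s'|s,a)q(s,a)$; $(\Pi_\theta d)(s,a)=\pi_\theta(a|s)d(s)$; $$K_\theta=\begin{bmatrix}-\gamma P^{\mathsf T} & I \\ I & -\Pi_\theta\end{bmatrix},\quad b=\begin{bmatrix}(1-\gamma)\rho \\ 0\end{bmatrix},\quad c_x=\begin{bmatrix}-r/(1-\gamma) \\ 0\end{bmatrix},\quad F(\theta,x)=K_\theta x-b.$$ True augmented Lagrangian: $\mathcal L^C_\beta(\theta,x,y)=\phi(\theta)+c_x^{\mathsf T}x+\langle y,F(\theta,x)\rangle+\frac\beta2\|F(\theta,x)\|^2$.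 $B_C(\theta)=\phi(\theta)+c_x^{\mathsf T}K_\theta^{-1}b$ is assumed bounded below on $\Theta$, with infimum $B_C^{\inf}$. Sampling: the reset distribution satisfies $\rho(s)\ge\rho_{\min}>0$, the sampling policies satisfy $\pi_\theta(a|s)\ge\pi_{\min}>0$, and $m_k\ge2$. At iteration $k$ a length-$m_k$ trajectory is run with frozen policy $\pi_{\theta^k}$: each step resets the state to a draw from $\rho$ with probability $1-\gamma$ and otherwise makes an environment transition $A\sim\pi_{\theta^k}(\cdot|S)$, $S'\sim P(\cdot|S,A)$; all reset coins, reset states, actions and transitions use fresh randomness. Split it into $L_k=\lfloor m_k/2\rfloor$ disjoint two-step blocks; a block is an anchor if its first step is a reset and its second step is an environment transition $(S,A,S')$. With $p_0=\gamma(1-\gamma)$, $Y_j(s,a,s')=\mathbf 1\{\text{block }j\text{ is an anchor with }S=s,A=a,S'=s'\}/(p_0\rho(s)\pi_{\theta^k}(a|s))$, $\bar P_k=L_k^{-1}\sum_jY_j$, and $\widehat P_k$ is obtained by Euclidean projection of each row $\bar P_k(\cdot|s,a)$ onto the probability simplex. $\widehat K_k(\theta)$ is $K_\theta$ with $P$ replaced by $\widehat P_k$; $\widehat F_k(\theta,x)=\widehat K_k(\theta)x-b$; $\delta_k=\sup_\theta\|\widehat K_k(\theta)-K_\theta\|$, $\delta_{-1}=0$. Algorithm: from deterministic $\theta^0\in\operatorname{dom}\psi_\Theta$, $x^0,y^0$, for $k\ge0$, with $\widehat h_k(\theta)=\langle y^k,\widehat F_k(\theta,x^k)\rangle+\frac\beta2\|\widehat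 F_k(\theta,x^k)\|^2$: $\theta^{k+1}\in\arg\min_{\theta\in\Theta}\{\phi(\theta)+\langle\nabla\widehat h_k(\theta^k),\theta-\theta^k\rangle+\frac1{2\eta_{\theta,k}}\|\theta-\theta^k\|^2\}$; $x^{k+1}=\arg\min_x\{c_x^{\mathsf T}x+\langle y^k,\widehat F_k(\theta^{k+1},x)\rangle+\frac\beta2\|\widehat F_k(\theta^{k+1},x)\|^2+\frac1{2\eta_x}\|x-x^k\|^2\}$; $y^{k+1}=y^k+\beta\widehat F_k(\theta^{k+1},x^{k+1})$. $\Delta\theta_k=\theta^k-\theta^{k-1}$, $\Delta x_k=x^k-x^{k-1}$, $\Delta x_0=0$. Regularity and parameters: $\bar\kappa_K<\infty$ bounds $\|K_\theta^{-1}\|$ and $\|\widehat K_k(\theta)^{-1}\|$ for all $\theta,k$ and all realizations (such a bound exists by row stochasticity); $\|K_\theta-K_{\theta'}\|\le L_K\|\theta-\theta'\|$; $D_\theta K_\theta$ is bounded; the gradients of the smooth augmented policy terms ($\theta\mapsto\langle y^k,F(\theta,x^k)\rangle+\frac\beta2\|F(\theta,x^k)\|^2$ and its empirical version $\widehat h_k$) have a common Lipschitz constant $\overline L$ on all policy comparison segments $[\theta^k,\theta^{k+1}]$; $\beta>36\bar\kappa_K^2/\eta_x$; $\tau=1/(8\eta_x)$; $0<\underline\eta\le\eta_{\theta,k}$; and $\frac1{2\eta_{\theta,k}}-\frac{\overline L}2-\frac{3A_C}{2\beta}\ge a_\theta>0$ with $A_C=9\bar\kappa_K^4L_K^2\|c_x\|^2$.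 Potential: $\Phi_k=\mathcal L^C_\beta(\theta^k,x^k,y^k)+\tau\|\Delta x_k\|^2$ and $\Psi_k=\Phi_k-B_C^{\inf}+1+C_0\delta_{k-1}^2$, where $C_0<\infty$ is a fixed constant (it exists, depending only on problem and algorithm parameters) such that for some $q_x>0$, $\Phi_k\ge B_C^{\inf}+\frac\beta4\|F(\theta^k,x^k)\|^2+q_x\|\Delta x_k\|^2-C_0\delta_{k-1}^2$ for all $k\ge1$. True squared KKT residual: $G_k^{\mathrm{true}}=\operatorname{dist}^2(0,\partial\psi_\Theta(\theta^k)+D_\theta F(\theta^k,x^k)^{\mathsf T}y^k)+\|c_x+K_{\theta^k}^{\mathsf T}y^k\|^2+\|F(\theta^k,x^k)\|^2$. *)

theory Defs
  imports "HOL-Probability.Probability"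
begin

section \<open>Variational notions\<close>

definition proper_fun :: "('v \<Rightarrow> ereal) \<Rightarrow> bool" where
  "proper_fun f \<longleftrightarrow> (\<forall>u. f u \<noteq> -\<infinity>) \<and> (\<exists>u. f u \<noteq> \<infinity>)"

definition lsc_fun :: "('v::topological_space \<Rightarrow> ereal) \<Rightarrow> bool" where
  "lsc_fun f \<longleftrightarrow> (\<forall>u. f u \<le> Liminf (at u) f)"

definition regular_subdiff :: "('v::real_inner \<Rightarrow> ereal) \<Rightarrow> 'v \<Rightarrow> 'v set" where
  "regular_subdiff f u =
     {v. \<bar>f u\<bar> \<noteq> \<infinity> \<and>
         0 \<le> Liminf (at u) (\<lambda>w. (f w - f u - ereal (inner v (w - u))) / ereal (norm (w - u)))}"

definition limiting_subdiff :: "('v::real_inner \<Rightarrow> ereal) \<Rightarrow> 'v \<Rightarrow> 'v set" where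
  "limiting_subdiff f u =
     {v. \<bar>f u\<bar> \<noteq> \<infinity> \<and>
         (\<exists>us vs. us \<longlonglongrightarrow> u \<and> (\<lambda>n. f (us n)) \<longlonglongrightarrow> f u \<and>
                  (\<forall>n. vs n \<in> regular_subdiff f (us n)) \<and> vs \<longlonglongrightarrow> v)}"

text \<open>Extended-valued, because the distance to the empty set has to be \<open>\<infinity>\<close> (\<^const>\<open>infdist\<close> gives
  \<open>0\<close> there).\<close>

definition edist_set :: "'v::metric_space \<Rightarrow> 'v set \<Rightarrow> ereal" where
  "edist_set u S = (INF v\<in>S. ereal (dist u v))"

definition grad :: "('v::real_inner \<Rightarrow> real) \<Rightarrow> 'v \<Rightarrow> 'v" where
  "grad f u = (THE g. GDERIV f u :> g)"

definition cont_diff_on :: "'v::real_inner set \<Rightarrow> ('v \<Rightarrow> real) \<Rightarrow> bool" where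
  "cont_diff_on U f \<longleftrightarrow> (\<exists>g. (\<forall>u\<in>U. GDERIV f u :> g u) \<and> continuous_on U g)"


section \<open>The occupancy formulation of a discounted MDP\<close>

text \<open>\<open>disc\<close> is $\gamma$, \<open>kern s a\<close> is $P(\cdot|s,a)$, \<open>init\<close> is the reset distribution $\rho$,
  \<open>policy \<theta> s\<close> is $\pi_\theta(\cdot|s)$; the penalty $\phi$ is extended-valued. Values of the policy
  map outside the neighbourhood on which it is assumed smooth are irrelevant.\<close>

record ('s, 'a, 'p) occ_problem =
  disc :: real
  kern :: "'s \<Rightarrow> 'a \<Rightarrow> 's pmf"
  reward :: "'s \<Rightarrow> 'a \<Rightarrow> real"
  init :: "'s pmf"
  policy :: "'p \<Rightarrow> 's \<Rightarrow> 'a pmf"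
  penalty :: "'p \<Rightarrow> ereal"
  feasible :: "'p set"

text \<open>Primal vectors are $x=(q,d)$; the residual $F(\theta,x)$ and the multiplier $y$ have the two
  blocks in the opposite order. The norm and inner product of the product type are the Euclidean
  ones.\<close>

type_synonym ('s, 'a) primal = "(real ^ ('s \<times> 'a)) \<times> (real ^ 's)"
type_synonym ('s, 'a) dual = "(real ^ 's) \<times> (real ^ ('s \<times> 'a))"

text \<open>A (true or estimated) transition kernel as the family of its rows.\<close>

type_synonym ('s, 'a) rows = "'s \<Rightarrow> 'a \<Rightarrow> real ^ 's"

definition true_rows :: "('s::finite, 'a::finite, 'p) occ_problem \<Rightarrow> ('s, 'a) rows" where
  "true_rows D s a = (\<chi> s'. pmf (kern D s a) s')"

definition kern_transpose :: "('s::finite, 'a::finite) rows \<Rightarrow> real ^ ('s \<times> 'a) \<Rightarrow> real ^ 's" where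
  "kern_transpose P q = (\<chi> s'. \<Sum>s\<in>UNIV. \<Sum>a\<in>UNIV. P s a $ s' * q $ (s, a))"

definition policy_op :: "('s::finite \<Rightarrow> 'a::finite pmf) \<Rightarrow> real ^ 's \<Rightarrow> real ^ ('s \<times> 'a)" where
  "policy_op \<pi> d = (\<chi> i. pmf (\<pi> (fst i)) (snd i) * d $ fst i)"

definition Kop :: "('s::finite, 'a::finite, 'p) occ_problem \<Rightarrow> ('s, 'a) rows \<Rightarrow> 'p \<Rightarrow>
    ('s, 'a) primal \<Rightarrow>\<^sub>L ('s, 'a) dual" where
  "Kop D P \<theta> = Blinfun (\<lambda>(q, d).
     (- disc D *\<^sub>R kern_transpose P q + d, q - policy_op (policy D \<theta>) d))"

lemma Kop_apply:
  "blinfun_apply (Kop D P \<theta>) (q, d) =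
     (- disc D *\<^sub>R kern_transpose P q + d, q - policy_op (policy D \<theta>) d)"
proof -
  have k: "linear (kern_transpose P)"
    by (rule linearI)
       (simp_all add: kern_transpose_def vec_eq_iff distrib_left sum.distrib sum_distrib_left mult.left_commute)
  have p: "linear (policy_op (policy D \<theta>))"
    by (rule linearI) (simp_all add: policy_op_def vec_eq_iff distrib_left mult.left_commute)
  have "linear (\<lambda>(q, d). (- disc D *\<^sub>R kern_transpose P q + d, q - policy_op (policy D \<theta>) d))"
    by (rule linearI)
       (auto simp: linear_add[OF k] linear_add[OF p] linear_cmul[OF k] linear_cmul[OF p] algebra_simps)
  then have "bounded_linear (\<lambda>(q, d). (- disc D *\<^sub>R kern_transpose P q + d, q - policy_op (policy D \<theta>) d))"
    by (rule linear_conv_bounded_linear[THEN iffD1])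
  then show ?thesis
    by (simp add: Kop_def bounded_linear_Blinfun_apply)
qed

definition bvec :: "('s::finite, 'a::finite, 'p) occ_problem \<Rightarrow> ('s, 'a) dual" where
  "bvec D = ((\<chi> s. (1 - disc D) * pmf (init D) s), 0)"

definition cvec :: "('s::finite, 'a::finite, 'p) occ_problem \<Rightarrow> ('s, 'a) primal" where
  "cvec D = ((\<chi> i. - reward D (fst i) (snd i) / (1 - disc D)), 0)"

definition Fres :: "('s::finite, 'a::finite, 'p) occ_problem \<Rightarrow> ('s, 'a) rows \<Rightarrow> 'p \<Rightarrow>
    ('s, 'a) primal \<Rightarrow> ('s, 'a) dual" where
  "Fres D P \<theta> x = blinfun_apply (Kop D P \<theta>) x - bvec D"

definition aug :: "('s::finite, 'a::finite, 'p) occ_problem \<Rightarrow> real \<Rightarrow> ('s, 'a) rows \<Rightarrow>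
    ('s, 'a) primal \<Rightarrow> ('s, 'a) dual \<Rightarrow> 'p \<Rightarrow> real" where
  "aug D \<beta> P x y \<theta> = inner y (Fres D P \<theta> x) + \<beta> / 2 * (norm (Fres D P \<theta> x))\<^sup>2"

definition aug_lagrangian :: "('s::finite, 'a::finite, 'p) occ_problem \<Rightarrow> real \<Rightarrow> 'p \<Rightarrow>
    ('s, 'a) primal \<Rightarrow> ('s, 'a) dual \<Rightarrow> ereal" where
  "aug_lagrangian D \<beta> \<theta> x y =
     penalty D \<theta> + ereal (inner (cvec D) x + aug D \<beta> (true_rows D) x y \<theta>)"

definition reduced_obj :: "('s::finite, 'a::finite, 'p) occ_problem \<Rightarrow> 'p \<Rightarrow> ereal" where
  "reduced_obj D \<theta> =
     penalty D \<theta> + ereal (inner (cvec D) (inv (blinfun_apply (Kop D (true_rows D) \<theta>)) (bvec D)))"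

definition psi :: "('s, 'a, 'p) occ_problem \<Rightarrow> 'p \<Rightarrow> ereal" where
  "psi D \<theta> = (if \<theta> \<in> feasible D then penalty D \<theta> else \<infinity>)"


section \<open>Sampling and estimation\<close>

text \<open>\<open>Rst s\<close> is a reset to the state \<open>s\<close>; \<open>Env s a s'\<close> is an environment transition.\<close>

datatype ('s, 'a) step = is_rst: Rst 's | Env 's 'a 's

fun end_state :: "('s, 'a) step \<Rightarrow> 's" where
  "end_state (Rst s) = s"
| "end_state (Env s a s') = s'"

definition step_pmf :: "('s, 'a, 'p) occ_problem \<Rightarrow> 'p \<Rightarrow> 's \<Rightarrow> ('s, 'a) step pmf" where
  "step_pmf D \<theta> s =
     bind_pmf (bernoulli_pmf (1 - disc D)) (\<lambda>coin.
       if coin then map_pmf Rst (init D)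
       else bind_pmf (policy D \<theta> s) (\<lambda>a. map_pmf (Env s a) (kern D s a)))"

primrec traj_pmf :: "('s, 'a, 'p) occ_problem \<Rightarrow> 'p \<Rightarrow> nat \<Rightarrow> 's \<Rightarrow> ('s, 'a) step list pmf" where
  "traj_pmf D \<theta> 0 s = return_pmf []"
| "traj_pmf D \<theta> (Suc n) s =
     bind_pmf (step_pmf D \<theta> s) (\<lambda>u. map_pmf (Cons u) (traj_pmf D \<theta> n (end_state u)))"

text \<open>In a trajectory the transition following a reset to \<open>s\<close> starts from \<open>s\<close>, so the state \<open>S\<close> of an
  anchor is read off from its second step.\<close>

definition anchor_weight :: "('s, 'a, 'p) occ_problem \<Rightarrow> 'p \<Rightarrow> ('s, 'a) step \<Rightarrow> ('s, 'a) step \<Rightarrow>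
    's \<Rightarrow> 'a \<Rightarrow> 's \<Rightarrow> real" where
  "anchor_weight D \<theta> u v s a s' =
     (if is_rst u \<and> v = Env s a s'
      then 1 / (disc D * (1 - disc D) * pmf (init D) s * pmf (policy D \<theta> s) a) else 0)"

definition raw_rows :: "('s::finite, 'a, 'p) occ_problem \<Rightarrow> 'p \<Rightarrow> ('s, 'a) step list \<Rightarrow>
    ('s, 'a) rows" where
  "raw_rows D \<theta> z s a = (\<chi> s'.
     (\<Sum>j<length z div 2. anchor_weight D \<theta> (z ! (2 * j)) (z ! (2 * j + 1)) s a s')
       / real (length z div 2))"

definition prob_simplex :: "(real ^ 's::finite) set" where
  "prob_simplex = {v. (\<forall>i. 0 \<le> v $ i) \<and> (\<Sum>i\<in>UNIV. v $ i) = 1}"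

definition est_rows :: "('s::finite, 'a, 'p) occ_problem \<Rightarrow> 'p \<Rightarrow> ('s, 'a) step list \<Rightarrow>
    ('s, 'a) rows" where
  "est_rows D \<theta> z s a = closest_point prob_simplex (raw_rows D \<theta> z s a)"


section \<open>The algorithm along one realization\<close>

text \<open>From here on \<open>th\<close>, \<open>x\<close>, \<open>y\<close> and \<open>z\<close> are the sequences of policy parameters, primal iterates,
  multipliers and trajectories of a single realization.\<close>

definition P_hat :: "('s::finite, 'a, 'p) occ_problem \<Rightarrow> (nat \<Rightarrow> 'p) \<Rightarrow>
    (nat \<Rightarrow> ('s, 'a) step list) \<Rightarrow> nat \<Rightarrow> ('s, 'a) rows" where
  "P_hat D th z k = est_rows D (th k) (z k)"

definition kern_err :: "('s::finite, 'a::finite, 'p) occ_problem \<Rightarrow> (nat \<Rightarrow> 'p) \<Rightarrow>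
    (nat \<Rightarrow> ('s, 'a) step list) \<Rightarrow> nat \<Rightarrow> real" where
  "kern_err D th z k =
     (SUP \<theta>\<in>feasible D. norm (Kop D (P_hat D th z k) \<theta> - Kop D (true_rows D) \<theta>))"

text \<open>$\delta_{k-1}$, with $\delta_{-1}=0$.\<close>

definition prev_err :: "('s::finite, 'a::finite, 'p) occ_problem \<Rightarrow> (nat \<Rightarrow> 'p) \<Rightarrow>
    (nat \<Rightarrow> ('s, 'a) step list) \<Rightarrow> nat \<Rightarrow> real" where
  "prev_err D th z k = (case k of 0 \<Rightarrow> 0 | Suc j \<Rightarrow> kern_err D th z j)"

definition incr :: "(nat \<Rightarrow> 'v::real_vector) \<Rightarrow> nat \<Rightarrow> 'v" where
  "incr u k = (case k of 0 \<Rightarrow> 0 | Suc j \<Rightarrow> u (Suc j) - u j)"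

definition admm_run :: "('s::finite, 'a::finite, 'p::euclidean_space) occ_problem \<Rightarrow> real \<Rightarrow> real \<Rightarrow>
    (nat \<Rightarrow> real) \<Rightarrow> (nat \<Rightarrow> 'p) \<Rightarrow> (nat \<Rightarrow> ('s, 'a) primal) \<Rightarrow> (nat \<Rightarrow> ('s, 'a) dual) \<Rightarrow>
    (nat \<Rightarrow> ('s, 'a) step list) \<Rightarrow> bool" where
  "admm_run D \<beta> \<eta>x \<eta>\<theta> th x y z \<longleftrightarrow> (\<forall>k.
     is_arg_min
       (\<lambda>\<theta>. penalty D \<theta> +
          ereal (inner (grad (aug D \<beta> (P_hat D th z k) (x k) (y k)) (th k)) (\<theta> - th k)
                 + 1 / (2 * \<eta>\<theta> k) * (norm (\<theta> - th k))\<^sup>2))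
       (\<lambda>\<theta>. \<theta> \<in> feasible D) (th (Suc k)) \<and>
     is_arg_min
       (\<lambda>w. inner (cvec D) w + aug D \<beta> (P_hat D th z k) w (y k) (th (Suc k))
            + 1 / (2 * \<eta>x) * (norm (w - x k))\<^sup>2)
       (\<lambda>w. True) (x (Suc k)) \<and>
     y (Suc k) = y k + \<beta> *\<^sub>R Fres D (P_hat D th z k) (th (Suc k)) (x (Suc k)))"

definition Phi :: "('s::finite, 'a::finite, 'p) occ_problem \<Rightarrow> real \<Rightarrow> real \<Rightarrow>
    (nat \<Rightarrow> 'p) \<Rightarrow> (nat \<Rightarrow> ('s, 'a) primal) \<Rightarrow> (nat \<Rightarrow> ('s, 'a) dual) \<Rightarrow> nat \<Rightarrow> ereal" where
  "Phi D \<beta> \<tau> th x y k =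
     aug_lagrangian D \<beta> (th k) (x k) (y k) + ereal (\<tau> * (norm (incr x k))\<^sup>2)"

definition Psi :: "('s::finite, 'a::finite, 'p) occ_problem \<Rightarrow> real \<Rightarrow> real \<Rightarrow> real \<Rightarrow> real \<Rightarrow>
    (nat \<Rightarrow> 'p) \<Rightarrow> (nat \<Rightarrow> ('s, 'a) primal) \<Rightarrow> (nat \<Rightarrow> ('s, 'a) dual) \<Rightarrow>
    (nat \<Rightarrow> ('s, 'a) step list) \<Rightarrow> nat \<Rightarrow> ereal" where
  "Psi D \<beta> \<tau> Binf C0 th x y z k =
     Phi D \<beta> \<tau> th x y k - ereal Binf + 1 + ereal (C0 * (prev_err D th z k)\<^sup>2)"

definition Phi_lower_bound :: "('s::finite, 'a::finite, 'p) occ_problem \<Rightarrow> real \<Rightarrow> real \<Rightarrow> real \<Rightarrow>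
    real \<Rightarrow> real \<Rightarrow> (nat \<Rightarrow> 'p) \<Rightarrow> (nat \<Rightarrow> ('s, 'a) primal) \<Rightarrow> (nat \<Rightarrow> ('s, 'a) dual) \<Rightarrow>
    (nat \<Rightarrow> ('s, 'a) step list) \<Rightarrow> bool" where
  "Phi_lower_bound D \<beta> \<tau> Binf C0 qx th x y z \<longleftrightarrow> (\<forall>k\<ge>1.
     ereal (Binf + \<beta> / 4 * (norm (Fres D (true_rows D) (th k) (x k)))\<^sup>2
            + qx * (norm (incr x k))\<^sup>2 - C0 * (prev_err D th z k)\<^sup>2)
       \<le> Phi D \<beta> \<tau> th x y k)"

definition kkt_residual :: "('s::finite, 'a::finite, 'p::euclidean_space) occ_problem \<Rightarrow>
    'p \<Rightarrow> ('s, 'a) primal \<Rightarrow> ('s, 'a) dual \<Rightarrow> ereal" where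
  "kkt_residual D \<theta> x y =
     (edist_set 0 ((\<lambda>v. v + adjoint (frechet_derivative (\<lambda>\<theta>'. Fres D (true_rows D) \<theta>' x) (at \<theta>)) y)
                     ` limiting_subdiff (psi D) \<theta>))\<^sup>2
     + ereal ((norm (cvec D + adjoint (blinfun_apply (Kop D (true_rows D) \<theta>)) y))\<^sup>2)
     + ereal ((norm (Fres D (true_rows D) \<theta> x))\<^sup>2)"

end

theory Submission
  imports Defs
begin

text \<open>Once $\sum_k\delta_k^2<\infty$ is known, everything is a statement about a single realization.
  Optimality of the primal step gives
  $y^{k+1} = -\widehat K_k(\theta^{k+1})^{-\mathsf T}(c_x + \Delta x_{k+1}/\eta_x)$, and the dual step then bounds
  $\|x^{k+1}\|$ by a constant plus $\frac1{36}(\|\Delta x_{k+1}\| + \|\Delta x_k\|)$, so the iterates are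
  bounded. Hence replacing the true by the estimated Lagrangian costs $O(\delta_k)$ times the length
  of the step, which Young's inequality turns into a small multiple of the squared increments plus
  $O(\delta_k^2 + \delta_{k-1}^2)$: the potential decreases up to a summable error. Finally
  $E\,\delta_k^2 = O(1/m_k)$, because by the resets the two-step blocks give uncorrelated unbiased
  estimates of the kernel whatever the state at the start of the block.\<close>

section \<open>Auxiliary inequalities\<close>

text \<open>Only the squares of the estimation errors are summable, so a cost of first order in
  \<open>\<delta>\<close> per iteration would destroy the descent. It is avoided because all updates
  of an iteration use the same estimated kernel and because the error operator does not depend on
  the policy parameter: the passage between the estimated and the true Lagrangian is made at both
  ends of the step with one and the same error, and only the difference of the two corrections
  counts. For the same reason the true and the estimated operators have the same derivative in
  \<open>\<theta>\<close>, so stationarity carries no term for an error in the derivative. The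
  weight \<open>1 / (8 * \<eta>)\<close> splits the proximal gain \<open>1 / (2 * \<eta>)\<close>.
  The dual step costs \<open>1 / (12 * \<eta>)\<close> on the squares of both the new and the old
  increment of \<open>x\<close>; in units of \<open>1 / \<eta>\<close> this leaves
  \<open>1/2 - 1/8 - 1/12 = 7/24\<close> on the new one and \<open>1/8 - 1/12 = 1/24\<close> on the
  old one. The initial multiplier is arbitrary and obeys no optimality formula, so the descent
  starts at index 1.\<close>

text \<open>Subtracting the accumulated errors turns \<open>u\<close> into a decreasing sequence
  that is bounded below; telescoping the same inequality bounds the partial sums of
  \<open>g\<close>. It is the pathwise counterpart of a supermartingale convergence theorem.\<close>

lemma descent_convergent_summable:
  fixes u g e :: "nat \<Rightarrow> real"
  assumes step: "\<And>k. u (Suc k) + g k \<le> u k + e k"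
    and g: "\<And>k. 0 \<le> g k" and e: "\<And>k. 0 \<le> e k" and sum_e: "summable e" and low: "\<And>k. l \<le> u k"
  shows "convergent u" and "summable g"
proof -
  define v where "v k = u k - (\<Sum>i<k. e i)" for k
  have e_le: "(\<Sum>i<k. e i) \<le> suminf e" for k
    by (rule sum_le_suminf[OF sum_e]) (auto simp: e)
  have dec: "decseq v"
    unfolding decseq_Suc_iff v_def
  proof
    fix k show "u (Suc k) - (\<Sum>i<Suc k. e i) \<le> u k - (\<Sum>i<k. e i)"
      using step[of k] g[of k] by simp
  qed
  have low_v: "l - suminf e \<le> v k" for k
    using low[of k] e_le[of k] by (simp add: v_def)
  have "convergent v"
    using decseq_convergent[OF dec, of "l - suminf e"] low_v by (metis convergentI)
  moreover have "convergent (\<lambda>k. \<Sum>i<k. e i)"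
    using sum_e summable_iff_convergent by blast
  ultimately have "convergent (\<lambda>k. v k + (\<Sum>i<k. e i))"
    by (rule convergent_add)
  then show "convergent u"
    by (simp add: v_def)
  have "(\<Sum>i<k. g i) \<le> u 0 - v k" for k
  proof (induction k)
    case (Suc k)
    then show ?case using step[of k] by (simp add: v_def)
  qed (simp add: v_def)
  then have "(\<Sum>i<k. g i) \<le> u 0 - (l - suminf e)" for k
    using low_v[of k] by (meson diff_left_mono order_trans)
  then show "summable g"
    by (intro bounded_imp_summable[where B = "u 0 - (l - suminf e)"] g)
       (metis lessThan_Suc_atMost)
qed

lemma tendsto_zero_of_square_summable:
  fixes u :: "nat \<Rightarrow> real"
  assumes "summable (\<lambda>k. (u k)\<^sup>2)"
  shows "u \<longlonglongrightarrow> 0"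
proof -
  have "(\<lambda>k. sqrt ((u k)\<^sup>2)) \<longlonglongrightarrow> sqrt 0"
    by (intro tendsto_real_sqrt summable_LIMSEQ_zero assms)
  then show ?thesis by (simp add: tendsto_rabs_zero_iff)
qed

text \<open>The first-order condition of a quadratic without derivatives: at
  \<open>t = - a / p\<close> with \<open>p > \<bar>q\<bar>\<close> the linear term outweighs the
  quadratic one.\<close>

lemma quadratic_nonneg_linear_part:
  fixes a q :: real
  assumes "\<And>t. 0 \<le> t * a + t\<^sup>2 * q"
  shows "a = 0"
proof (rule ccontr)
  assume a: "a \<noteq> 0"
  define p where "p = \<bar>q\<bar> + 1"
  have p: "p > 0" "q < p" by (auto simp: p_def)
  have "0 \<le> (- a / p) * a + (- a / p)\<^sup>2 * q" by (rule assms)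
  also have "\<dots> = (a\<^sup>2 / p) * (q / p - 1)"
    using p by (simp add: field_simps power2_eq_square)
  also have "\<dots> < 0"
    using p a by (intro mult_pos_neg) auto
  finally show False by simp
qed

lemma young_mult:
  fixes a s \<epsilon> :: real
  assumes "0 < \<epsilon>"
  shows "a * s \<le> \<epsilon> * s\<^sup>2 + a\<^sup>2 / (4 * \<epsilon>)"
proof -
  have "0 \<le> (2 * \<epsilon> * s - a)\<^sup>2 / (4 * \<epsilon>)"
    using assms by simp
  then show ?thesis
    using assms by (simp add: field_simps power2_eq_square)
qed

lemma sum3_squares: "(a + b + c)\<^sup>2 \<le> 3 * a\<^sup>2 + 3 * b\<^sup>2 + 3 * c\<^sup>2" for a b c :: real
proof -
  have "3 * a\<^sup>2 + 3 * b\<^sup>2 + 3 * c\<^sup>2 - (a + b + c)\<^sup>2 = (a - b)\<^sup>2 + (b - c)\<^sup>2 + (a - c)\<^sup>2"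
    by (simp add: power2_eq_square algebra_simps)
  then show ?thesis by (smt (verit) zero_le_power2)
qed

lemma neg_inner_le:
  fixes u v :: "'v::real_inner"
  shows "- (u \<bullet> v) \<le> norm u * norm v"
  using Cauchy_Schwarz_ineq2[of u v] by linarith

lemma norm_add_scaleR_square:
  fixes u h :: "'v::real_inner"
  shows "(norm (u + t *\<^sub>R h))\<^sup>2 = (norm u)\<^sup>2 + 2 * t * (u \<bullet> h) + t\<^sup>2 * (h \<bullet> h)"
  unfolding power2_norm_eq_inner
  by (simp add: inner_add_left inner_add_right inner_commute power2_eq_square algebra_simps)

text \<open>The inverse is the plain function inverse \<open>inv\<close>; its linearity is what
  makes the assumed bounds on \<open>onorm\<close> usable pointwise.\<close>

lemma bounded_linear_inv_blinfun:
  fixes A :: "'x::euclidean_space \<Rightarrow>\<^sub>L 'y::euclidean_space"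
  assumes "bij (blinfun_apply A)"
  shows "bounded_linear (inv (blinfun_apply A))"
proof -
  note [simp] = bij_is_surj[OF assms, THEN surj_f_inv_f] bij_is_inj[OF assms, THEN inv_f_f]
  have "linear (inv (blinfun_apply A))"
  proof (rule linearI)
    fix u v
    have "inv (blinfun_apply A) (u + v) = inv (blinfun_apply A)
        (blinfun_apply A (inv (blinfun_apply A) u + inv (blinfun_apply A) v))"
      by (simp add: blinfun.add_right)
    then show "inv (blinfun_apply A) (u + v) = inv (blinfun_apply A) u + inv (blinfun_apply A) v"
      by simp
  next
    fix t u
    have "inv (blinfun_apply A) (t *\<^sub>R u) = inv (blinfun_apply A)
        (blinfun_apply A (t *\<^sub>R inv (blinfun_apply A) u))"
      by (simp add: blinfun.scaleR_right)
    then show "inv (blinfun_apply A) (t *\<^sub>R u) = t *\<^sub>R inv (blinfun_apply A) u"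
      by simp
  qed
  then show ?thesis by (rule linear_conv_bounded_linear[THEN iffD1])
qed

lemma norm_inv_blinfun_le:
  fixes A :: "'x::euclidean_space \<Rightarrow>\<^sub>L 'y::euclidean_space"
  assumes "bij (blinfun_apply A)" "onorm (inv (blinfun_apply A)) \<le> \<kappa>"
  shows "norm (inv (blinfun_apply A) u) \<le> \<kappa> * norm u"
  using onorm[OF bounded_linear_inv_blinfun[OF assms(1)], of u] assms(2)
  by (meson mult_right_mono norm_ge_zero order_trans)

text \<open>The resolvent identity: the inverse of \<open>A\<close> minus that of \<open>B\<close>
  is the inverse of \<open>A\<close> times \<open>B - A\<close> times the inverse of
  \<open>B\<close>.\<close>

lemma norm_inv_blinfun_diff_le:
  fixes A B :: "'x::euclidean_space \<Rightarrow>\<^sub>L 'y::euclidean_space"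
  assumes A: "bij (blinfun_apply A)" "onorm (inv (blinfun_apply A)) \<le> \<kappa>"
    and B: "bij (blinfun_apply B)" "onorm (inv (blinfun_apply B)) \<le> \<kappa>"
    and "0 \<le> \<kappa>"
  shows "norm (inv (blinfun_apply A) u - inv (blinfun_apply B) u) \<le> \<kappa>\<^sup>2 * norm (A - B) * norm u"
proof -
  interpret iA: bounded_linear "inv (blinfun_apply A)"
    by (rule bounded_linear_inv_blinfun[OF A(1)])
  define w where "w = inv (blinfun_apply B) u"
  have "inv (blinfun_apply A) u - w = inv (blinfun_apply A) (blinfun_apply (B - A) w)"
    using A(1) B(1)
    by (simp add: blinfun.diff_left iA.diff w_def bij_is_surj surj_f_inv_f bij_is_inj)
  also have "norm \<dots> \<le> \<kappa> * norm (blinfun_apply (B - A) w)"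
    by (rule norm_inv_blinfun_le[OF A])
  also have "\<dots> \<le> \<kappa> * (norm (B - A) * (\<kappa> * norm u))"
    using norm_inv_blinfun_le[OF B, of u] \<open>0 \<le> \<kappa>\<close>
    by (intro mult_left_mono order_trans[OF norm_blinfun] mult_left_mono) (auto simp: w_def)
  finally show ?thesis
    by (simp add: w_def power2_eq_square algebra_simps norm_minus_commute)
qed

text \<open>Testing with \<open>u = v\<close>. Multipliers are estimated in this way, through their
  pairings, so that the inverse transpose is never formed as an operator.\<close>

lemma norm_le_of_inner_le:
  fixes v :: "'v::real_inner"
  assumes "\<And>u. v \<bullet> u \<le> C * norm u" "0 \<le> C"
  shows "norm v \<le> C"
proof (cases "v = 0")
  case False
  have "norm v * norm v \<le> C * norm v"
    using assms(1)[of v] by (simp add: norm_eq_sqrt_inner)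
  then show ?thesis using False by simp
qed (use assms in simp)

section \<open>ADMM with a perturbed linear constraint\<close>

definition aug_term :: "real \<Rightarrow> 'y::real_inner \<Rightarrow> ('x::real_normed_vector \<Rightarrow>\<^sub>L 'y) \<Rightarrow> 'x \<Rightarrow> 'y \<Rightarrow> real" where
  "aug_term \<beta> b A w v = v \<bullet> (blinfun_apply A w - b) + \<beta> / 2 * (norm (blinfun_apply A w - b))\<^sup>2"

text \<open>Exact expansion of the square. Every term on the right contains \<open>E w\<close>, and
  the unperturbed residual is the only other quantity that has to be controlled.\<close>

lemma aug_term_perturb:
  "aug_term \<beta> b A w v - aug_term \<beta> b (A + E) w v =
     - (v \<bullet> blinfun_apply E w) - \<beta> * ((blinfun_apply A w - b) \<bullet> blinfun_apply E w)
     - \<beta> / 2 * (norm (blinfun_apply E w))\<^sup>2"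
proof -
  have "blinfun_apply (A + E) w - b = (blinfun_apply A w - b) + blinfun_apply E w"
    by (simp add: blinfun.add_left)
  then show ?thesis
    unfolding aug_term_def
    by (simp add: power2_norm_eq_inner inner_add inner_commute algebra_simps add_divide_distrib)
qed

text \<open>\<open>K k\<close> stands for the true operator at the \<open>k\<close>-th policy parameter, \<open>E k\<close> for the estimation
  error of iteration \<open>k\<close> (which does not depend on the parameter), \<open>r k\<close> for the penalty value and
  \<open>T k\<close> for the length of the \<open>k\<close>-th policy step.\<close>

locale perturbed_admm =
  fixes K E :: "nat \<Rightarrow> 'x::euclidean_space \<Rightarrow>\<^sub>L 'y::euclidean_space"
    and b :: 'y and c :: 'x and x :: "nat \<Rightarrow> 'x" and y :: "nat \<Rightarrow> 'y"
    and r T \<eta>\<theta> :: "nat \<Rightarrow> real" and \<beta> \<eta> \<kappa> LK L A\<^sub>C a\<^sub>\<theta> Binf B :: real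
  assumes K_bij: "\<And>k. bij (blinfun_apply (K k))"
    and K_inv: "\<And>k. onorm (inv (blinfun_apply (K k))) \<le> \<kappa>"
    and H_bij: "\<And>k. bij (blinfun_apply (K (Suc k) + E k))"
    and H_inv: "\<And>k. onorm (inv (blinfun_apply (K (Suc k) + E k))) \<le> \<kappa>"
    and K_lip: "\<And>k. norm (K (Suc k) - K k) \<le> LK * T k"
    and K_bound: "\<And>k. norm (K k) \<le> B"
    and T_nonneg: "\<And>k. 0 \<le> T k"
    and policy_step: "\<And>k. r (Suc k) + aug_term \<beta> b (K (Suc k) + E k) (x k) (y k)
           + (1 / (2 * \<eta>\<theta> k) - L / 2) * (T k)\<^sup>2 \<le> r k + aug_term \<beta> b (K k + E k) (x k) (y k)"
    and primal_step: "\<And>k. is_arg_min (\<lambda>w. c \<bullet> w + aug_term \<beta> b (K (Suc k) + E k) w (y k)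
           + 1 / (2 * \<eta>) * (norm (w - x k))\<^sup>2) (\<lambda>w. True) (x (Suc k))"
    and dual_step: "\<And>k. y (Suc k) = y k + \<beta> *\<^sub>R (blinfun_apply (K (Suc k) + E k) (x (Suc k)) - b)"
    and reduced_bound: "\<And>k. Binf \<le> r k + c \<bullet> inv (blinfun_apply (K k)) b"
    and \<eta>_pos: "0 < \<eta>" and \<beta>_gt: "36 * \<kappa>\<^sup>2 / \<eta> < \<beta>"
    and A_C: "A\<^sub>C = 9 * \<kappa> ^ 4 * LK\<^sup>2 * (norm c)\<^sup>2"
    and a_pos: "0 < a\<^sub>\<theta>"
    and a_le: "\<And>k. a\<^sub>\<theta> \<le> 1 / (2 * \<eta>\<theta> k) - L / 2 - 3 * A\<^sub>C / (2 * \<beta>)"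
begin

abbreviation "dx k \<equiv> x (Suc k) - x k"
abbreviation "dy k \<equiv> y (Suc k) - y k"
abbreviation "H k \<equiv> K (Suc k) + E k"

lemma \<kappa>_nonneg: "0 \<le> \<kappa>"
  using onorm_pos_le[OF bounded_linear_inv_blinfun[OF K_bij[of 0]]] K_inv[of 0] by linarith

lemma \<beta>_pos: "0 < \<beta>"
proof -
  have "0 \<le> 36 * \<kappa>\<^sup>2 / \<eta>" using \<eta>_pos by simp
  then show ?thesis using \<beta>_gt by linarith
qed

text \<open>The form in which the largeness of \<open>\<beta>\<close> enters: it bounds the
  iterates, the dual increments and the potential from below.\<close>

lemma \<kappa>_\<beta>: "\<kappa>\<^sup>2 / (\<beta> * \<eta>) \<le> 1 / 36"
  using \<beta>_gt \<beta>_pos \<eta>_pos by (simp add: field_simps)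

lemma B_nonneg: "0 \<le> B"
  using K_bound[of 0] norm_ge_zero order_trans by blast

lemma A_C_nonneg: "0 \<le> A\<^sub>C"
  unfolding A_C by (intro mult_nonneg_nonneg) auto

section \<open>The primal optimality condition and the size of the multipliers and their
  increments\<close>

text \<open>Stationarity along the direction \<open>h\<close>. The new multiplier appears because
  the derivative of the augmented term at \<open>x (Suc k)\<close> pairs \<open>H k h\<close> with
  \<open>y k\<close> plus \<open>\<beta>\<close> times the residual, which is exactly the dual
  update.\<close>

lemma primal_optimality:
  "c \<bullet> h + y (Suc k) \<bullet> blinfun_apply (H k) h + (dx k \<bullet> h) / \<eta> = 0"
proof (rule quadratic_nonneg_linear_part)
  fix t :: real
  let ?F = "blinfun_apply (H k) (x (Suc k)) - b"
  let ?obj = "\<lambda>w. c \<bullet> w + aug_term \<beta> b (H k) w (y k) + 1 / (2 * \<eta>) * (norm (w - x k))\<^sup>2"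
  let ?h = "blinfun_apply (H k) h"
  have le: "?obj (x (Suc k)) \<le> ?obj (x (Suc k) + t *\<^sub>R h)"
    using primal_step[of k] unfolding is_arg_min_def by (metis (no_types, lifting) not_le)
  have 1: "blinfun_apply (H k) (x (Suc k) + t *\<^sub>R h) - b = ?F + t *\<^sub>R ?h"
    by (simp add: blinfun.add_right blinfun.scaleR_right)
  have 2: "x (Suc k) + t *\<^sub>R h - x k = dx k + t *\<^sub>R h" by simp
  have y: "y (Suc k) = y k + \<beta> *\<^sub>R ?F" by (rule dual_step)
  have "?obj (x (Suc k) + t *\<^sub>R h) - ?obj (x (Suc k)) =
      t * (c \<bullet> h + y (Suc k) \<bullet> ?h + (dx k \<bullet> h) / \<eta>)
      + t\<^sup>2 * (\<beta> / 2 * (?h \<bullet> ?h) + 1 / (2 * \<eta>) * (h \<bullet> h))"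
    unfolding aug_term_def 1 2 y norm_add_scaleR_square
    by (simp add: inner_add_left inner_add_right algebra_simps add_divide_distrib diff_divide_distrib)
  then show "0 \<le> t * (c \<bullet> h + y (Suc k) \<bullet> ?h + (dx k \<bullet> h) / \<eta>)
      + t\<^sup>2 * (\<beta> / 2 * (?h \<bullet> ?h) + 1 / (2 * \<eta>) * (h \<bullet> h))"
    using le by linarith
qed

text \<open>The optimality condition tested with the preimage of \<open>u\<close> under
  \<open>H k\<close>: the weak form of the formula with the inverse transpose.\<close>

lemma dual_repr:
  "y (Suc k) \<bullet> u = - (c \<bullet> inv (blinfun_apply (H k)) u) - (dx k \<bullet> inv (blinfun_apply (H k)) u) / \<eta>"
  using primal_optimality[of "inv (blinfun_apply (H k)) u" k] H_bij[of k]
  by (simp add: bij_is_surj surj_f_inv_f)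

lemma norm_inv_H: "norm (inv (blinfun_apply (H k)) u) \<le> \<kappa> * norm u"
  by (rule norm_inv_blinfun_le[OF H_bij H_inv])

lemma dual_bound: "norm (y (Suc k)) \<le> \<kappa> * (norm c + norm (dx k) / \<eta>)"
proof (rule norm_le_of_inner_le)
  fix u
  let ?u = "inv (blinfun_apply (H k)) u"
  have "y (Suc k) \<bullet> u = - (c \<bullet> ?u) - (dx k \<bullet> ?u) / \<eta>" by (rule dual_repr)
  also have "\<dots> \<le> norm c * norm ?u + norm (dx k) * norm ?u / \<eta>"
  proof -
    have "- (c \<bullet> ?u) \<le> norm c * norm ?u" "- (dx k \<bullet> ?u) \<le> norm (dx k) * norm ?u"
      by (rule neg_inner_le)+
    then have "- (dx k \<bullet> ?u) / \<eta> \<le> norm (dx k) * norm ?u / \<eta>"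
      using \<eta>_pos by (intro divide_right_mono) auto
    with \<open>- (c \<bullet> ?u) \<le> norm c * norm ?u\<close> show ?thesis by simp
  qed
  also have "\<dots> = (norm c + norm (dx k) / \<eta>) * norm ?u"
    by (simp add: algebra_simps)
  also have "\<dots> \<le> (norm c + norm (dx k) / \<eta>) * (\<kappa> * norm u)"
    using \<eta>_pos by (intro mult_left_mono norm_inv_H) auto
  finally show "y (Suc k) \<bullet> u \<le> \<kappa> * (norm c + norm (dx k) / \<eta>) * norm u"
    by (simp add: mult_ac)
qed (use \<kappa>_nonneg \<eta>_pos in auto)

lemma H_diff: "norm (H (Suc k) - H k) \<le> LK * T (Suc k) + norm (E (Suc k)) + norm (E k)"
proof -
  have "H (Suc k) - H k = (K (Suc (Suc k)) - K (Suc k)) + (E (Suc k) - E k)" by simp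
  then have "norm (H (Suc k) - H k) \<le> norm (K (Suc (Suc k)) - K (Suc k)) + norm (E (Suc k) - E k)"
    by (simp only: norm_triangle_ineq)
  also have "\<dots> \<le> LK * T (Suc k) + (norm (E (Suc k)) + norm (E k))"
    by (intro add_mono K_lip norm_triangle_ineq4)
  finally show ?thesis by simp
qed

text \<open>Two consecutive instances of \<open>dual_repr\<close> are subtracted, which is why the
  increment from \<open>y 0\<close> is not covered. The change of the inverse is of the size of the
  policy step plus the errors of both iterations, since \<open>H k\<close> and
  \<open>H (Suc k)\<close> contain different estimates.\<close>

lemma dual_step_bound:
  "norm (dy (Suc k)) \<le> \<kappa>\<^sup>2 * norm c * (LK * T (Suc k) + norm (E (Suc k)) + norm (E k))
     + \<kappa> / \<eta> * norm (dx (Suc k)) + \<kappa> / \<eta> * norm (dx k)"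
    (is "_ \<le> \<kappa>\<^sup>2 * norm c * ?h + _ + _")
proof (rule norm_le_of_inner_le)
  have h: "0 \<le> ?h" using H_diff[of k] norm_ge_zero order_trans by blast
  then show "0 \<le> \<kappa>\<^sup>2 * norm c * ?h + \<kappa> / \<eta> * norm (dx (Suc k)) + \<kappa> / \<eta> * norm (dx k)"
    using \<kappa>_nonneg \<eta>_pos
    by (intro add_nonneg_nonneg mult_nonneg_nonneg[OF _ h]) auto
  fix u
  let ?u = "inv (blinfun_apply (H k)) u" and ?v = "inv (blinfun_apply (H (Suc k))) u"
  have "dy (Suc k) \<bullet> u = - (c \<bullet> (?v - ?u)) - (dx (Suc k) \<bullet> ?v) / \<eta> + (dx k \<bullet> ?u) / \<eta>"
    by (simp only: inner_diff_left[of "y (Suc (Suc k))"] dual_repr) (simp add: inner_diff_right)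
  also have "\<dots> \<le> norm c * (\<kappa>\<^sup>2 * ?h * norm u) + norm (dx (Suc k)) * (\<kappa> * norm u) / \<eta>
      + norm (dx k) * (\<kappa> * norm u) / \<eta>"
  proof -
    have "norm (?v - ?u) \<le> \<kappa>\<^sup>2 * norm (H (Suc k) - H k) * norm u"
      by (rule norm_inv_blinfun_diff_le[OF H_bij H_inv H_bij H_inv \<kappa>_nonneg])
    also have "\<dots> \<le> \<kappa>\<^sup>2 * ?h * norm u"
      by (intro mult_right_mono mult_left_mono H_diff) auto
    finally have "- (c \<bullet> (?v - ?u)) \<le> norm c * (\<kappa>\<^sup>2 * ?h * norm u)"
      by (intro order_trans[OF neg_inner_le] mult_left_mono) auto
    moreover have "- (dx (Suc k) \<bullet> ?v) \<le> norm (dx (Suc k)) * (\<kappa> * norm u)"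
      by (intro order_trans[OF neg_inner_le] mult_left_mono norm_inv_H) auto
    moreover have "dx k \<bullet> ?u \<le> norm (dx k) * (\<kappa> * norm u)"
      using norm_cauchy_schwarz[of "dx k" ?u] mult_left_mono[OF norm_inv_H[of "k" u], of "norm (dx k)"]
      by simp
    ultimately show ?thesis
      using \<eta>_pos divide_right_mono[of "- (dx (Suc k) \<bullet> ?v)" "norm (dx (Suc k)) * (\<kappa> * norm u)" \<eta>]
        divide_right_mono[of "dx k \<bullet> ?u" "norm (dx k) * (\<kappa> * norm u)" \<eta>]
      by simp
  qed
  also have "\<dots> = (\<kappa>\<^sup>2 * norm c * ?h + \<kappa> / \<eta> * norm (dx (Suc k)) + \<kappa> / \<eta> * norm (dx k)) * norm u"
    by (simp add: algebra_simps)
  finally show "dy (Suc k) \<bullet> u \<le> \<dots>" .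
qed

text \<open>\<open>sum3_squares\<close> is used twice, for the three contributions to the dual step
  and for the three parts of the operator change; this is the origin of the factor 9 in
  \<open>A\<^sub>C\<close>. The factor 1/36 from \<open>\<kappa>_\<beta>\<close> turns
  \<open>3 * \<kappa>\<^sup>2 / (\<beta> * \<eta>\<^sup>2)\<close> into
  \<open>1 / (12 * \<eta>)\<close>.\<close>

lemma dual_step_square:
  "(norm (dy (Suc k)))\<^sup>2 / \<beta> \<le> A\<^sub>C / \<beta> * (T (Suc k))\<^sup>2
     + 9 * \<kappa> ^ 4 * (norm c)\<^sup>2 / \<beta> * ((norm (E (Suc k)))\<^sup>2 + (norm (E k))\<^sup>2)
     + 1 / (12 * \<eta>) * ((norm (dx (Suc k)))\<^sup>2 + (norm (dx k))\<^sup>2)"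
proof -
  let ?h = "LK * T (Suc k) + norm (E (Suc k)) + norm (E k)"
  have "(norm (dy (Suc k)))\<^sup>2 \<le> (\<kappa>\<^sup>2 * norm c * ?h + \<kappa> / \<eta> * norm (dx (Suc k)) + \<kappa> / \<eta> * norm (dx k))\<^sup>2"
    by (intro power_mono dual_step_bound) auto
  also have "\<dots> \<le> 3 * (\<kappa>\<^sup>2 * norm c * ?h)\<^sup>2 + 3 * (\<kappa> / \<eta> * norm (dx (Suc k)))\<^sup>2 + 3 * (\<kappa> / \<eta> * norm (dx k))\<^sup>2"
    by (rule sum3_squares)
  also have "\<dots> = 3 * \<kappa> ^ 4 * (norm c)\<^sup>2 * ?h\<^sup>2 + 3 * \<kappa>\<^sup>2 / \<eta>\<^sup>2 * ((norm (dx (Suc k)))\<^sup>2 + (norm (dx k))\<^sup>2)"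
    by (simp only: power_mult_distrib power_divide) (simp add: distrib_left)
  also have "\<dots> \<le> 3 * \<kappa> ^ 4 * (norm c)\<^sup>2 * (3 * (LK * T (Suc k))\<^sup>2 + 3 * (norm (E (Suc k)))\<^sup>2 + 3 * (norm (E k))\<^sup>2)
      + 3 * \<kappa>\<^sup>2 / \<eta>\<^sup>2 * ((norm (dx (Suc k)))\<^sup>2 + (norm (dx k))\<^sup>2)"
    by (intro add_right_mono mult_left_mono sum3_squares) (auto intro!: mult_nonneg_nonneg)
  also have "\<dots> = A\<^sub>C * (T (Suc k))\<^sup>2 + 9 * \<kappa> ^ 4 * (norm c)\<^sup>2 * ((norm (E (Suc k)))\<^sup>2 + (norm (E k))\<^sup>2)
      + 3 * \<kappa>\<^sup>2 / \<eta>\<^sup>2 * ((norm (dx (Suc k)))\<^sup>2 + (norm (dx k))\<^sup>2)"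
    unfolding A_C by (simp add: power_mult_distrib algebra_simps)
  finally have "(norm (dy (Suc k)))\<^sup>2 / \<beta> \<le> (A\<^sub>C * (T (Suc k))\<^sup>2
      + 9 * \<kappa> ^ 4 * (norm c)\<^sup>2 * ((norm (E (Suc k)))\<^sup>2 + (norm (E k))\<^sup>2)
      + 3 * \<kappa>\<^sup>2 / \<eta>\<^sup>2 * ((norm (dx (Suc k)))\<^sup>2 + (norm (dx k))\<^sup>2)) / \<beta>"
    using \<beta>_pos by (intro divide_right_mono) auto
  also have "\<dots> = A\<^sub>C / \<beta> * (T (Suc k))\<^sup>2
     + 9 * \<kappa> ^ 4 * (norm c)\<^sup>2 / \<beta> * ((norm (E (Suc k)))\<^sup>2 + (norm (E k))\<^sup>2)
     + 3 / \<eta> * (\<kappa>\<^sup>2 / (\<beta> * \<eta>)) * ((norm (dx (Suc k)))\<^sup>2 + (norm (dx k))\<^sup>2)"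
    by (simp add: add_divide_distrib power2_eq_square mult_ac)
  also have "\<dots> \<le> A\<^sub>C / \<beta> * (T (Suc k))\<^sup>2
     + 9 * \<kappa> ^ 4 * (norm c)\<^sup>2 / \<beta> * ((norm (E (Suc k)))\<^sup>2 + (norm (E k))\<^sup>2)
     + 3 / \<eta> * (1 / 36) * ((norm (dx (Suc k)))\<^sup>2 + (norm (dx k))\<^sup>2)"
    using \<eta>_pos by (intro add_left_mono mult_right_mono mult_left_mono \<kappa>_\<beta>) auto
  finally show ?thesis using \<eta>_pos by (simp add: field_simps)
qed

text \<open>By \<open>\<beta> > 36 \<kappa>\<^sup>2 / \<eta>\<close> the norms satisfy a contractive two-step recursion.\<close>

lemma primal_bounded: "\<exists>R. \<forall>k. norm (x k) \<le> R"
proof -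
  define C where "C = \<kappa> * norm b + 2 * \<kappa>\<^sup>2 * norm c / \<beta>"
  have rec: "35 * norm (x (Suc (Suc k))) \<le> 36 * C + 2 * norm (x (Suc k)) + norm (x k)" for k
  proof -
    \<comment> \<open>The dual update is read backwards as a linear equation for the new primal
      iterate.\<close>
    have F: "blinfun_apply (H (Suc k)) (x (Suc (Suc k))) = b + (1 / \<beta>) *\<^sub>R dy (Suc k)"
      using dual_step[of "Suc k"] \<beta>_pos by simp
    have "x (Suc (Suc k)) = inv (blinfun_apply (H (Suc k))) (b + (1 / \<beta>) *\<^sub>R dy (Suc k))"
      unfolding F[symmetric] using H_bij[of "Suc k"] by (simp add: bij_is_inj)
    then have "norm (x (Suc (Suc k))) \<le> \<kappa> * norm (b + (1 / \<beta>) *\<^sub>R dy (Suc k))"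
      using norm_inv_H by metis
    also have "\<dots> \<le> \<kappa> * (norm b + (1 / \<beta>) * (norm (y (Suc (Suc k))) + norm (y (Suc k))))"
      using \<beta>_pos \<kappa>_nonneg
      by (intro mult_left_mono order_trans[OF norm_triangle_ineq] add_left_mono)
         (auto intro!: divide_right_mono norm_triangle_ineq4)
    also have "\<dots> \<le> \<kappa> * (norm b + (1 / \<beta>) * (\<kappa> * (norm c + norm (dx (Suc k)) / \<eta>) + \<kappa> * (norm c + norm (dx k) / \<eta>)))"
      using \<beta>_pos \<kappa>_nonneg by (intro mult_left_mono add_left_mono add_mono dual_bound) auto
    also have "\<dots> = C + \<kappa>\<^sup>2 / (\<beta> * \<eta>) * (norm (dx (Suc k)) + norm (dx k))"
      by (simp add: C_def power2_eq_square algebra_simps add_divide_distrib)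
    also have "\<dots> \<le> C + 1 / 36 * (norm (dx (Suc k)) + norm (dx k))"
      by (intro add_left_mono mult_right_mono \<kappa>_\<beta>) auto
    finally show ?thesis
      using norm_triangle_ineq4[of "x (Suc (Suc k))" "x (Suc k)"] norm_triangle_ineq4[of "x (Suc k)" "x k"]
      by argo
  qed
  \<comment> \<open>The bound \<open>R\<close> reproduces itself in the recursion:
    \<open>36 * C + 3 * R \<le> 35 * R\<close> holds exactly if
    \<open>36 * C \<le> 32 * R\<close>.\<close>
  define R where "R = Max {norm (x 0), norm (x 1), 36 / 32 * C}"
  have R: "norm (x 0) \<le> R" "norm (x 1) \<le> R" "36 * C \<le> 32 * R"
    by (auto simp: R_def)
  have "norm (x k) \<le> R \<and> norm (x (Suc k)) \<le> R" for k
  proof (induction k)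
    case (Suc k)
    then show ?case using rec[of k] R(3) by simp
  qed (use R in simp)
  then show ?thesis by blast
qed

lemma dual_bounded: "\<exists>R. \<forall>k. norm (y k) \<le> R"
proof -
  obtain R where R: "\<And>k. norm (x k) \<le> R" using primal_bounded by blast
  have "norm (y k) \<le> max (norm (y 0)) (\<kappa> * (norm c + 2 * R / \<eta>))" for k
  proof (cases k)
    case (Suc j)
    have "norm (dx j) \<le> 2 * R"
      using norm_triangle_ineq4[of "x (Suc j)" "x j"] R[of j] R[of "Suc j"] by simp
    then have "\<kappa> * (norm c + norm (dx j) / \<eta>) \<le> \<kappa> * (norm c + 2 * R / \<eta>)"
      using \<kappa>_nonneg \<eta>_pos by (intro mult_left_mono add_left_mono divide_right_mono) auto
    then show ?thesis using dual_bound[of j] Suc by simp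
  qed simp
  then show ?thesis by blast
qed

section \<open>Change of the true augmented Lagrangian in one iteration\<close>

definition "LC k = r k + c \<bullet> x k + aug_term \<beta> b (K k) (x k) (y k)"

text \<open>Two indices, because iteration \<open>k\<close> makes the comparison at both of its
  ends, \<open>j = k\<close> and \<open>j = Suc k\<close>, with the same error
  \<open>E k\<close>.\<close>

definition "gap k j = aug_term \<beta> b (K j) (x j) (y j) - aug_term \<beta> b (K j + E k) (x j) (y j)"

text \<open>The policy and primal steps decrease the estimated Lagrangian, and the dual step raises
  it by the square of its length over \<open>\<beta>\<close>. Passing to the true Lagrangian at both
  ends leaves the difference of the gaps.\<close>

lemma lagrangian_step:
  "LC (Suc k) \<le> LC k - (1 / (2 * \<eta>\<theta> k) - L / 2) * (T k)\<^sup>2 - 1 / (2 * \<eta>) * (norm (dx k))\<^sup>2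
     + (norm (dy k))\<^sup>2 / \<beta> + (gap k (Suc k) - gap k k)"
proof -
  let ?F = "blinfun_apply (H k) (x (Suc k)) - b"
  have "c \<bullet> x (Suc k) + aug_term \<beta> b (H k) (x (Suc k)) (y k) + 1 / (2 * \<eta>) * (norm (dx k))\<^sup>2
      \<le> c \<bullet> x k + aug_term \<beta> b (H k) (x k) (y k)"
  proof -
    let ?obj = "\<lambda>w. c \<bullet> w + aug_term \<beta> b (H k) w (y k) + 1 / (2 * \<eta>) * (norm (w - x k))\<^sup>2"
    have "?obj (x (Suc k)) \<le> ?obj (x k)"
      using primal_step[of k] unfolding is_arg_min_def by (metis (no_types, lifting) not_le)
    then show ?thesis by simp
  qed
  moreover have "aug_term \<beta> b (H k) (x (Suc k)) (y (Suc k))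
      = aug_term \<beta> b (H k) (x (Suc k)) (y k) + (norm (dy k))\<^sup>2 / \<beta>"
  proof -
    have "dy k = \<beta> *\<^sub>R ?F" using dual_step[of k] by simp
    then have "(norm (dy k))\<^sup>2 / \<beta> = \<beta> * (?F \<bullet> ?F)"
      using \<beta>_pos by (simp only: norm_scaleR power_mult_distrib) (simp add: power2_norm_eq_inner[symmetric] power2_eq_square)
    moreover have "y (Suc k) = y k + \<beta> *\<^sub>R ?F" by (rule dual_step)
    ultimately show ?thesis
      unfolding aug_term_def by (simp add: inner_add_left)
  qed
  ultimately show ?thesis
    using policy_step[of k] unfolding LC_def gap_def by linarith
qed

text \<open>A single gap is of first order in \<open>E k\<close>, which would not be summable. In
  the difference each inner product is split like a product rule, so that every first-order term
  also contains an increment of \<open>x\<close>, \<open>y\<close> or the policy parameter. The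
  quadratic part is already of second order in \<open>E k\<close> and is estimated without
  cancellation.\<close>

lemma gap_difference_bound:
  "\<exists>C\<ge>0. \<forall>k. gap k (Suc k) - gap k k
     \<le> C * norm (E k) * (norm (dy k) + norm (dx k) + T k) + C * (norm (E k))\<^sup>2"
proof -
  obtain R0 Y where R0: "\<And>k. norm (x k) \<le> R0" and Y: "\<And>k. norm (y k) \<le> Y"
    using primal_bounded dual_bounded by blast
  define R where "R = R0"
  have R: "norm (x k) \<le> R" for k using R0 by (simp add: R_def)
  have R_nonneg: "0 \<le> R" using R[of 0] norm_ge_zero order_trans by blast
  have Y_nonneg: "0 \<le> Y" using Y[of 0] norm_ge_zero order_trans by blast
  define f where "f k = blinfun_apply (K k) (x k) - b" for k
  define Fm where "Fm = B * R + norm b"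
  have Fm_nonneg: "0 \<le> Fm" using B_nonneg R_nonneg by (simp add: Fm_def)
  have f: "norm (f k) \<le> Fm" for k
  proof -
    have "norm (blinfun_apply (K k) (x k)) \<le> B * R"
      by (intro order_trans[OF norm_blinfun] mult_mono K_bound R B_nonneg) auto
    then show ?thesis
      unfolding f_def Fm_def using norm_triangle_ineq4 by (smt (verit))
  qed
  have f_diff: "norm (f (Suc k) - f k) \<le> B * norm (dx k) + \<bar>LK\<bar> * T k * R" for k
  proof -
    have "f (Suc k) - f k = blinfun_apply (K (Suc k)) (dx k) + blinfun_apply (K (Suc k) - K k) (x k)"
      by (simp add: f_def blinfun.diff_left blinfun.diff_right)
    also have "norm \<dots> \<le> B * norm (dx k) + \<bar>LK\<bar> * T k * R"
    proof (rule order_trans[OF norm_triangle_ineq add_mono])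
      show "norm (blinfun_apply (K (Suc k)) (dx k)) \<le> B * norm (dx k)"
        by (intro order_trans[OF norm_blinfun] mult_right_mono K_bound) auto
      have "norm (K (Suc k) - K k) \<le> \<bar>LK\<bar> * T k"
        using K_lip[of k] T_nonneg[of k] by (smt (verit) mult_right_mono)
      then show "norm (blinfun_apply (K (Suc k) - K k) (x k)) \<le> \<bar>LK\<bar> * T k * R"
        by (intro order_trans[OF norm_blinfun] mult_mono R) (auto simp: T_nonneg)
    qed
    finally show ?thesis .
  qed
  define C where "C = max (R + \<beta> * \<bar>LK\<bar> * R * R) (max (Y + \<beta> * (B * R + Fm)) (\<beta> / 2 * R\<^sup>2))"
  have C: "R + \<beta> * \<bar>LK\<bar> * R * R \<le> C" "Y + \<beta> * (B * R + Fm) \<le> C" "\<beta> / 2 * R\<^sup>2 \<le> C"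
    unfolding C_def by linarith+
  have C_nonneg: "0 \<le> C"
    using C(3) \<beta>_pos by (smt (verit) zero_le_mult_iff zero_le_power2 divide_nonneg_nonneg)
  have RC: "R \<le> C" "\<beta> * \<bar>LK\<bar> * R * R \<le> C"
  proof -
    have "0 \<le> \<beta> * \<bar>LK\<bar> * R * R" using \<beta>_pos R_nonneg by simp
    then show "R \<le> C" "\<beta> * \<bar>LK\<bar> * R * R \<le> C" using C(1) R_nonneg by linarith+
  qed
  show ?thesis
  proof (intro exI conjI allI)
    show "0 \<le> C" by (rule C_nonneg)
    fix k
    let ?d = "norm (E k)"
    define e where "e j = blinfun_apply (E k) (x j)" for j
    have e: "norm (e j) \<le> ?d * R" for j
      unfolding e_def by (intro order_trans[OF norm_blinfun] mult_left_mono R) auto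
    have e_diff: "norm (e (Suc k) - e k) \<le> ?d * norm (dx k)"
      unfolding e_def by (simp add: norm_blinfun flip: blinfun.diff_right)
    have gap: "gap k j = - (y j \<bullet> e j) - \<beta> * (f j \<bullet> e j) - \<beta> / 2 * (norm (e j))\<^sup>2" for j
      unfolding gap_def aug_term_perturb e_def f_def ..
    have dual_part: "- (y (Suc k) \<bullet> e (Suc k)) + y k \<bullet> e k \<le> norm (dy k) * (?d * R) + Y * (?d * norm (dx k))"
    proof -
      have "- (y (Suc k) \<bullet> e (Suc k)) + y k \<bullet> e k = - (dy k \<bullet> e (Suc k)) + - (y k \<bullet> (e (Suc k) - e k))"
        by (simp add: inner_diff_left inner_diff_right)
      also have "\<dots> \<le> norm (dy k) * norm (e (Suc k)) + norm (y k) * norm (e (Suc k) - e k)"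
        by (intro add_mono neg_inner_le)
      also have "\<dots> \<le> norm (dy k) * (?d * R) + Y * (?d * norm (dx k))"
        using Y_nonneg by (intro add_mono mult_mono e e_diff Y) auto
      finally show ?thesis .
    qed
    have residual_part: "- (f (Suc k) \<bullet> e (Suc k)) + f k \<bullet> e k
        \<le> (B * norm (dx k) + \<bar>LK\<bar> * T k * R) * (?d * R) + Fm * (?d * norm (dx k))"
    proof -
      have "- (f (Suc k) \<bullet> e (Suc k)) + f k \<bullet> e k
          = - ((f (Suc k) - f k) \<bullet> e (Suc k)) + - (f k \<bullet> (e (Suc k) - e k))"
        by (simp add: inner_diff_left inner_diff_right)
      also have "\<dots> \<le> norm (f (Suc k) - f k) * norm (e (Suc k)) + norm (f k) * norm (e (Suc k) - e k)"
        by (intro add_mono neg_inner_le)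
      also have "\<dots> \<le> (B * norm (dx k) + \<bar>LK\<bar> * T k * R) * (?d * R) + Fm * (?d * norm (dx k))"
        using B_nonneg R_nonneg Fm_nonneg T_nonneg
        by (intro add_mono mult_mono e e_diff f f_diff) auto
      finally show ?thesis .
    qed
    have "(norm (e k))\<^sup>2 \<le> (?d * R)\<^sup>2"
      by (intro power_mono e) auto
    then have square_part: "\<beta> / 2 * (norm (e k))\<^sup>2 - \<beta> / 2 * (norm (e (Suc k)))\<^sup>2 \<le> \<beta> / 2 * (?d * R)\<^sup>2"
      using \<beta>_pos by (smt (verit) mult_left_mono divide_nonneg_nonneg zero_le_power2 mult_nonneg_nonneg)
    have "gap k (Suc k) - gap k k = (- (y (Suc k) \<bullet> e (Suc k)) + y k \<bullet> e k)
        + \<beta> * (- (f (Suc k) \<bullet> e (Suc k)) + f k \<bullet> e k)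
        + (\<beta> / 2 * (norm (e k))\<^sup>2 - \<beta> / 2 * (norm (e (Suc k)))\<^sup>2)"
      unfolding gap by (simp add: algebra_simps)
    also have "\<dots> \<le> (norm (dy k) * (?d * R) + Y * (?d * norm (dx k)))
        + \<beta> * ((B * norm (dx k) + \<bar>LK\<bar> * T k * R) * (?d * R) + Fm * (?d * norm (dx k)))
        + \<beta> / 2 * (?d * R)\<^sup>2"
      using \<beta>_pos by (intro add_mono dual_part residual_part square_part mult_left_mono) auto
    also have "\<dots> = ?d * (R * norm (dy k) + (Y + \<beta> * (B * R + Fm)) * norm (dx k)
        + \<beta> * \<bar>LK\<bar> * R * R * T k) + (\<beta> / 2 * R\<^sup>2) * ?d\<^sup>2"
      by (simp add: algebra_simps power_mult_distrib)
    also have "\<dots> \<le> ?d * (C * norm (dy k) + C * norm (dx k) + C * T k) + C * ?d\<^sup>2"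
      using RC C T_nonneg by (intro add_mono mult_left_mono mult_right_mono) auto
    finally show "gap k (Suc k) - gap k k
      \<le> C * ?d * (norm (dy k) + norm (dx k) + T k) + C * ?d\<^sup>2"
      by (simp add: algebra_simps)
  qed
qed

section \<open>The potential: lower bound and descent\<close>

definition "potential k = LC k + 1 / (8 * \<eta>) * (case k of 0 \<Rightarrow> 0 | Suc j \<Rightarrow> (norm (dx j))\<^sup>2)"

text \<open>With \<open>f\<close> the true residual, \<open>x (Suc k)\<close> is the true solution
  plus the inverse of \<open>K\<close> applied to \<open>f\<close>. The resulting term in
  \<open>c\<close> is almost cancelled by the pairing of the multiplier with \<open>f\<close>, by
  \<open>dual_repr\<close>; what remains is due to the difference of the inverses of
  \<open>K\<close> and \<open>H\<close> and to the last increment of \<open>x\<close>. Young's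
  inequality charges each remainder \<open>\<beta> / 8\<close> times the squared residual, which
  leaves \<open>\<beta> / 4\<close> of the available \<open>\<beta> / 2\<close>.\<close>

lemma potential_lower_bound:
  "Binf + \<beta> / 4 * (norm (blinfun_apply (K (Suc k)) (x (Suc k)) - b))\<^sup>2
     + (1 / (8 * \<eta>) - 1 / (18 * \<eta>)) * (norm (dx k))\<^sup>2
     - 2 * \<kappa> ^ 4 * (norm c)\<^sup>2 / \<beta> * (norm (E k))\<^sup>2 \<le> potential (Suc k)"
proof -
  let ?f = "blinfun_apply (K (Suc k)) (x (Suc k)) - b"
  let ?iK = "inv (blinfun_apply (K (Suc k)))" and ?iH = "inv (blinfun_apply (H k))"
  interpret iK: bounded_linear ?iK by (rule bounded_linear_inv_blinfun[OF K_bij])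
  have "?iK ?f = x (Suc k) - ?iK b"
    using K_bij[of "Suc k"] by (simp add: iK.diff bij_is_inj)
  then have x: "x (Suc k) = ?iK b + ?iK ?f" by simp
  have "c \<bullet> x (Suc k) + y (Suc k) \<bullet> ?f = c \<bullet> ?iK b + c \<bullet> (?iK ?f - ?iH ?f) - (dx k \<bullet> ?iH ?f) / \<eta>"
    unfolding dual_repr by (subst x) (simp add: inner_add_right inner_diff_right)
  moreover have "- (c \<bullet> (?iK ?f - ?iH ?f)) \<le> (\<kappa>\<^sup>2 * norm c * norm (E k)) * norm ?f"
  proof -
    have "norm (?iK ?f - ?iH ?f) \<le> \<kappa>\<^sup>2 * norm (K (Suc k) - H k) * norm ?f"
      by (rule norm_inv_blinfun_diff_le[OF K_bij K_inv H_bij H_inv \<kappa>_nonneg])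
    then have "- (c \<bullet> (?iK ?f - ?iH ?f)) \<le> norm c * (\<kappa>\<^sup>2 * norm (E k) * norm ?f)"
      by (intro order_trans[OF neg_inner_le] mult_left_mono) auto
    then show ?thesis by (simp add: mult_ac)
  qed
  moreover have "(dx k \<bullet> ?iH ?f) / \<eta> \<le> (\<kappa> / \<eta> * norm (dx k)) * norm ?f"
  proof -
    have "dx k \<bullet> ?iH ?f \<le> norm (dx k) * (\<kappa> * norm ?f)"
      by (intro order_trans[OF norm_cauchy_schwarz] mult_left_mono norm_inv_H) auto
    then show ?thesis using \<eta>_pos by (simp add: field_simps)
  qed
  moreover have "(\<kappa>\<^sup>2 * norm c * norm (E k)) * norm ?f
      \<le> \<beta> / 8 * (norm ?f)\<^sup>2 + 2 * \<kappa> ^ 4 * (norm c)\<^sup>2 / \<beta> * (norm (E k))\<^sup>2"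
    using young_mult[of "\<beta> / 8" "\<kappa>\<^sup>2 * norm c * norm (E k)" "norm ?f"] \<beta>_pos
    by (simp add: power_mult_distrib field_simps)
  moreover have "(\<kappa> / \<eta> * norm (dx k)) * norm ?f \<le> \<beta> / 8 * (norm ?f)\<^sup>2 + 1 / (18 * \<eta>) * (norm (dx k))\<^sup>2"
  proof -
    have "(\<kappa> / \<eta> * norm (dx k)) * norm ?f \<le> \<beta> / 8 * (norm ?f)\<^sup>2 + 2 / \<eta> * (\<kappa>\<^sup>2 / (\<beta> * \<eta>)) * (norm (dx k))\<^sup>2"
      using young_mult[of "\<beta> / 8" "\<kappa> / \<eta> * norm (dx k)" "norm ?f"] \<beta>_pos
      by (simp add: power_mult_distrib power_divide power2_eq_square[of \<eta>] field_simps)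
    also have "\<dots> \<le> \<beta> / 8 * (norm ?f)\<^sup>2 + 2 / \<eta> * (1 / 36) * (norm (dx k))\<^sup>2"
      using \<eta>_pos by (intro add_left_mono mult_right_mono mult_left_mono \<kappa>_\<beta>) auto
    finally show ?thesis using \<eta>_pos by (simp add: field_simps)
  qed
  ultimately have "r (Suc k) + c \<bullet> ?iK b - (\<beta> / 4 * (norm ?f)\<^sup>2 + 2 * \<kappa> ^ 4 * (norm c)\<^sup>2 / \<beta> * (norm (E k))\<^sup>2
      + 1 / (18 * \<eta>) * (norm (dx k))\<^sup>2) \<le> r (Suc k) + c \<bullet> x (Suc k) + y (Suc k) \<bullet> ?f"
    by argo
  then show ?thesis
    unfolding potential_def LC_def aug_term_def
    using reduced_bound[of "Suc k"] by (simp add: left_diff_distrib)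
qed

text \<open>Combines \<open>lagrangian_step\<close>, \<open>dual_step_square\<close> and the gap
  bound. The dual increment inside the gap bound is itself replaced by the policy step, the errors
  and the two increments of \<open>x\<close>, so all first-order terms have the form
  \<open>N * d'\<close> times a length that the descent controls.\<close>

lemma potential_descent:
  "\<exists>\<epsilon>>0. \<exists>C\<ge>0. \<forall>k. potential (Suc (Suc k))
      + \<epsilon> * ((T (Suc k))\<^sup>2 + (norm (dx (Suc k)))\<^sup>2 + (norm (dx k))\<^sup>2)
    \<le> potential (Suc k) + C * ((norm (E (Suc k)))\<^sup>2 + (norm (E k))\<^sup>2)"
proof -
  obtain C where C: "0 \<le> C" "\<And>k. gap k (Suc k) - gap k k
     \<le> C * norm (E k) * (norm (dy k) + norm (dx k) + T k) + C * (norm (E k))\<^sup>2"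
    using gap_difference_bound by blast
  define M where "M = max (\<kappa>\<^sup>2 * norm c * \<bar>LK\<bar>) (max (\<kappa>\<^sup>2 * norm c) (\<kappa> / \<eta>))"
  have M: "\<kappa>\<^sup>2 * norm c * \<bar>LK\<bar> \<le> M" "\<kappa>\<^sup>2 * norm c \<le> M" "\<kappa> / \<eta> \<le> M"
    unfolding M_def by linarith+
  have M_nonneg: "0 \<le> M"
    using M(3) \<kappa>_nonneg \<eta>_pos by (meson divide_nonneg_pos order_trans)
  define N where "N = C * (M + 1)"
  have N_nonneg: "0 \<le> N" using C(1) M_nonneg by (simp add: N_def)
  \<comment> \<open>Half of the smaller margin: one \<open>\<epsilon>\<close> pays for the Young
    terms below, the other one remains as the descent. The margin \<open>1 / (24 * \<eta>)\<close>
    is the one left on the old increment of \<open>x\<close>.\<close>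
  define \<epsilon> where "\<epsilon> = min a\<^sub>\<theta> (1 / (24 * \<eta>)) / 2"
  have \<epsilon>: "0 < \<epsilon>" "2 * \<epsilon> \<le> a\<^sub>\<theta>" "2 * \<epsilon> \<le> 1 / (24 * \<eta>)"
    using a_pos \<eta>_pos by (auto simp: \<epsilon>_def)
  define C' where "C' = 9 * \<kappa> ^ 4 * (norm c)\<^sup>2 / \<beta> + 3 * N\<^sup>2 / (4 * \<epsilon>) + 2 * N + C"
  have C': "0 \<le> C'"
    unfolding C'_def using \<beta>_pos \<epsilon>(1) N_nonneg C(1) by (intro add_nonneg_nonneg) auto
  have "potential (Suc (Suc k)) + \<epsilon> * ((T (Suc k))\<^sup>2 + (norm (dx (Suc k)))\<^sup>2 + (norm (dx k))\<^sup>2)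
    \<le> potential (Suc k) + C' * ((norm (E (Suc k)))\<^sup>2 + (norm (E k))\<^sup>2)" for k
  proof -
    define t X X' d d' where defs: "t = T (Suc k)" "X = norm (dx k)" "X' = norm (dx (Suc k))"
      "d = norm (E k)" "d' = norm (E (Suc k))"
    have pos: "0 \<le> t" "0 \<le> X" "0 \<le> X'" "0 \<le> d" "0 \<le> d'"
      by (auto simp: defs T_nonneg)
    have dy: "norm (dy (Suc k)) \<le> M * (t + d' + d + X' + X)"
    proof -
      have "norm (dy (Suc k)) \<le> \<kappa>\<^sup>2 * norm c * LK * t + \<kappa>\<^sup>2 * norm c * (d' + d) + \<kappa> / \<eta> * (X' + X)"
        using dual_step_bound[of k] by (simp add: defs algebra_simps)
      also have "\<dots> \<le> M * t + M * (d' + d) + M * (X' + X)"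
      proof (intro add_mono mult_right_mono M)
        have "\<kappa>\<^sup>2 * norm c * LK \<le> \<kappa>\<^sup>2 * norm c * \<bar>LK\<bar>"
          by (intro mult_left_mono) auto
        then show "\<kappa>\<^sup>2 * norm c * LK \<le> M" using M(1) by linarith
      qed (use pos in auto)
      finally show ?thesis by (simp add: algebra_simps)
    qed
    have "gap (Suc k) (Suc (Suc k)) - gap (Suc k) (Suc k)
        \<le> C * d' * (norm (dy (Suc k)) + X' + t) + C * d'\<^sup>2"
      using C(2)[of "Suc k"] by (simp add: defs)
    also have "\<dots> \<le> C * d' * ((M + 1) * (t + d' + d + X' + X)) + C * d'\<^sup>2"
      using dy pos C(1) M_nonneg
      by (intro add_right_mono mult_left_mono) (auto simp: algebra_simps)
    also have "\<dots> = (N * d') * t + (N * d') * X' + (N * d') * X + N * (d' * d' + d' * d) + C * d'\<^sup>2"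
      by (simp add: N_def algebra_simps)
    also have "\<dots> \<le> (\<epsilon> * t\<^sup>2 + (N * d')\<^sup>2 / (4 * \<epsilon>)) + (\<epsilon> * X'\<^sup>2 + (N * d')\<^sup>2 / (4 * \<epsilon>))
        + (\<epsilon> * X\<^sup>2 + (N * d')\<^sup>2 / (4 * \<epsilon>)) + N * (2 * d'\<^sup>2 + 2 * d\<^sup>2) + C * d'\<^sup>2"
    proof -
      have "0 \<le> (d' - d)\<^sup>2" by simp
      then have "2 * (d' * d) \<le> d'\<^sup>2 + d\<^sup>2"
        by (simp add: power2_eq_square algebra_simps)
      then have "d' * d' + d' * d \<le> 2 * d'\<^sup>2 + 2 * d\<^sup>2"
        using zero_le_power2[of d] zero_le_power2[of d'] unfolding power2_eq_square by linarith
      then have "N * (d' * d' + d' * d) \<le> N * (2 * d'\<^sup>2 + 2 * d\<^sup>2)"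
        using N_nonneg by (rule mult_left_mono)
      then show ?thesis
        using young_mult[OF \<epsilon>(1), of "N * d'" t] young_mult[OF \<epsilon>(1), of "N * d'" X']
          young_mult[OF \<epsilon>(1), of "N * d'" X] by linarith
    qed
    also have "\<dots> = \<epsilon> * t\<^sup>2 + \<epsilon> * X'\<^sup>2 + \<epsilon> * X\<^sup>2 + 3 * N\<^sup>2 / (4 * \<epsilon>) * d'\<^sup>2 + 2 * N * (d'\<^sup>2 + d\<^sup>2) + C * d'\<^sup>2"
      by (simp add: power_mult_distrib algebra_simps)
    also have "\<dots> \<le> \<epsilon> * t\<^sup>2 + \<epsilon> * X'\<^sup>2 + \<epsilon> * X\<^sup>2 + 3 * N\<^sup>2 / (4 * \<epsilon>) * (d'\<^sup>2 + d\<^sup>2) + 2 * N * (d'\<^sup>2 + d\<^sup>2)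
        + C * (d'\<^sup>2 + d\<^sup>2)"
      using \<epsilon>(1) C(1) by (intro add_mono mult_left_mono order_refl) auto
    also have "\<dots> = \<epsilon> * t\<^sup>2 + \<epsilon> * X'\<^sup>2 + \<epsilon> * X\<^sup>2 + (C' - 9 * \<kappa> ^ 4 * (norm c)\<^sup>2 / \<beta>) * (d'\<^sup>2 + d\<^sup>2)"
      by (simp add: C'_def algebra_simps)
    finally have gap: "gap (Suc k) (Suc (Suc k)) - gap (Suc k) (Suc k) \<le> \<dots>" .
    have A_C_half: "A\<^sub>C / \<beta> \<le> 3 * A\<^sub>C / (2 * \<beta>)"
      using A_C_nonneg \<beta>_pos by (simp add: field_simps)
    then have "a\<^sub>\<theta> + A\<^sub>C / \<beta> \<le> 1 / (2 * \<eta>\<theta> (Suc k)) - L / 2"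
      using a_le[of "Suc k"] by linarith
    then have policy: "(a\<^sub>\<theta> + A\<^sub>C / \<beta>) * t\<^sup>2 \<le> (1 / (2 * \<eta>\<theta> (Suc k)) - L / 2) * t\<^sup>2"
      by (rule mult_right_mono) simp
    have policy_gain: "2 * \<epsilon> * t\<^sup>2 \<le> a\<^sub>\<theta> * t\<^sup>2" and primal_gain: "2 * \<epsilon> * X\<^sup>2 \<le> 1 / (24 * \<eta>) * X\<^sup>2"
      and primal_gain': "2 * \<epsilon> * X'\<^sup>2 \<le> 1 / (24 * \<eta>) * X'\<^sup>2"
      by (rule mult_right_mono, rule \<epsilon>, simp)+
    \<comment> \<open>In this unit the margins are integers: \<open>12 - 3 - 2 = 7\<close> for the
      new increment of \<open>x\<close> and \<open>3 - 2 = 1\<close> for the old one, so the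
      conclusion is linear arithmetic.\<close>
    define u where "u = 1 / (24 * \<eta>)"
    have u: "1 / (2 * \<eta>) = 12 * u" "1 / (8 * \<eta>) = 3 * u" "1 / (12 * \<eta>) = 2 * u" "1 / (24 * \<eta>) = u" "0 \<le> u"
      using \<eta>_pos by (auto simp: u_def field_simps)
    have uX': "0 \<le> u * X'\<^sup>2" using u(5) by simp
    show ?thesis
      using lagrangian_step[of "Suc k"] dual_step_square[of k] gap policy policy_gain primal_gain primal_gain' uX'
      unfolding potential_def nat.case defs[symmetric] u
      by (simp add: algebra_simps)
  qed
  with \<epsilon>(1) C' show ?thesis by blast
qed

section \<open>Convergence of a realization with square-summable errors\<close>

lemma convergence:
  assumes sum_E: "summable (\<lambda>k. (norm (E k))\<^sup>2)"
  shows "convergent potential"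
    and "summable (\<lambda>k. (T k)\<^sup>2)" and "summable (\<lambda>k. (norm (dx k))\<^sup>2)"
proof -
  obtain \<epsilon> C where \<epsilon>: "0 < \<epsilon>" and C: "0 \<le> C" and step: "\<And>k. potential (Suc (Suc k))
      + \<epsilon> * ((T (Suc k))\<^sup>2 + (norm (dx (Suc k)))\<^sup>2 + (norm (dx k))\<^sup>2)
    \<le> potential (Suc k) + C * ((norm (E (Suc k)))\<^sup>2 + (norm (E k))\<^sup>2)"
    using potential_descent by blast
  let ?C0 = "2 * \<kappa> ^ 4 * (norm c)\<^sup>2 / \<beta>"
  \<comment> \<open>The error in the lower bound is replaced by the whole series to get one constant
    valid for all \<open>k\<close>.\<close>
  have low: "Binf - ?C0 * (\<Sum>j. (norm (E j))\<^sup>2) \<le> potential (Suc k)" for k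
  proof -
    have "(norm (E k))\<^sup>2 \<le> (\<Sum>j. (norm (E j))\<^sup>2)"
      using sum_le_suminf[OF sum_E, of "{k}"] by simp
    then have "?C0 * (norm (E k))\<^sup>2 \<le> ?C0 * (\<Sum>j. (norm (E j))\<^sup>2)"
      using \<beta>_pos by (intro mult_left_mono) auto
    moreover have "0 \<le> \<beta> / 4 * (norm (blinfun_apply (K (Suc k)) (x (Suc k)) - b))\<^sup>2
        + (1 / (8 * \<eta>) - 1 / (18 * \<eta>)) * (norm (dx k))\<^sup>2"
      using \<beta>_pos \<eta>_pos by (intro add_nonneg_nonneg mult_nonneg_nonneg) (auto simp: field_simps)
    ultimately show ?thesis using potential_lower_bound[of k] by linarith
  qed
  have sum_e: "summable (\<lambda>k. C * ((norm (E (Suc k)))\<^sup>2 + (norm (E k))\<^sup>2))"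
    using sum_E by (intro summable_mult summable_add) (simp_all add: summable_Suc_iff[of "\<lambda>k. (norm (E k))\<^sup>2"])
  have nonneg: "0 \<le> \<epsilon> * ((T (Suc k))\<^sup>2 + (norm (dx (Suc k)))\<^sup>2 + (norm (dx k))\<^sup>2)"
      "0 \<le> C * ((norm (E (Suc k)))\<^sup>2 + (norm (E k))\<^sup>2)" for k
    using \<epsilon> C by auto
  note * = descent_convergent_summable[where u = "\<lambda>k. potential (Suc k)", OF step nonneg sum_e low]
  have "convergent (\<lambda>k. potential (Suc k))"
    by (rule *(1))
  then show "convergent potential" by (simp add: convergent_Suc_iff)
  have g: "summable (\<lambda>k. (T (Suc k))\<^sup>2 + (norm (dx (Suc k)))\<^sup>2 + (norm (dx k))\<^sup>2)"
    using *(2) \<epsilon> by (subst (asm) summable_cmult_iff) auto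
  have "summable (\<lambda>k. (T (Suc k))\<^sup>2)"
    by (rule summable_comparison_test'[OF g]) simp
  then show "summable (\<lambda>k. (T k)\<^sup>2)" using summable_Suc_iff by blast
  show "summable (\<lambda>k. (norm (dx k))\<^sup>2)"
    by (rule summable_comparison_test'[OF g]) simp
qed

text \<open>For the estimated operator both residuals are exact expressions in the increments: the
  dual update gives the constraint residual as the dual increment over \<open>\<beta>\<close>, and
  primal optimality gives the dual residual as the increment of \<open>x\<close> over
  \<open>\<eta>\<close>, up to sign. Going over to the true operator costs the norm of
  \<open>E k\<close> times a bounded iterate.\<close>

lemma residuals_vanish:
  assumes sum_E: "summable (\<lambda>k. (norm (E k))\<^sup>2)"
  shows "T \<longlonglongrightarrow> 0" and "(\<lambda>k. norm (dx k)) \<longlonglongrightarrow> 0" and "(\<lambda>k. norm (E k)) \<longlonglongrightarrow> 0"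
    and "(\<lambda>k. norm (blinfun_apply (K k) (x k) - b)) \<longlonglongrightarrow> 0"
    and "(\<lambda>k. norm (c + adjoint (blinfun_apply (K k)) (y k))) \<longlonglongrightarrow> 0"
proof -
  note conv = convergence[OF sum_E]
  show T: "T \<longlonglongrightarrow> 0" and dx: "(\<lambda>k. norm (dx k)) \<longlonglongrightarrow> 0" and E: "(\<lambda>k. norm (E k)) \<longlonglongrightarrow> 0"
    by (intro tendsto_zero_of_square_summable conv(2,3) sum_E)+
  obtain R Y where R: "\<And>k. norm (x k) \<le> R" and Y: "\<And>k. norm (y k) \<le> Y"
    using primal_bounded dual_bounded by blast
  have T': "(\<lambda>k. T (Suc k)) \<longlonglongrightarrow> 0" and dx': "(\<lambda>k. norm (dx (Suc k))) \<longlonglongrightarrow> 0"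
    and E': "(\<lambda>k. norm (E (Suc k))) \<longlonglongrightarrow> 0"
    using LIMSEQ_Suc[OF T] LIMSEQ_Suc[OF dx] LIMSEQ_Suc[OF E] by simp_all
  have "(\<lambda>k. norm (dy (Suc k))) \<longlonglongrightarrow> 0"
  proof (rule Lim_null_comparison)
    show "\<forall>\<^sub>F k in sequentially. norm (norm (dy (Suc k))) \<le>
        \<kappa>\<^sup>2 * norm c * (LK * T (Suc k) + norm (E (Suc k)) + norm (E k))
         + \<kappa> / \<eta> * norm (dx (Suc k)) + \<kappa> / \<eta> * norm (dx k)"
      using dual_step_bound by simp
    show "(\<lambda>k. \<kappa>\<^sup>2 * norm c * (LK * T (Suc k) + norm (E (Suc k)) + norm (E k))
         + \<kappa> / \<eta> * norm (dx (Suc k)) + \<kappa> / \<eta> * norm (dx k)) \<longlonglongrightarrow> 0"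
      by (intro tendsto_add_zero tendsto_mult_right_zero tendsto_mult_left_zero tendsto_divide_zero T' dx' dx E E')
  qed
  then have dy: "(\<lambda>k. norm (dy k)) \<longlonglongrightarrow> 0" by (rule LIMSEQ_imp_Suc)
  have "(\<lambda>k. norm (blinfun_apply (K (Suc k)) (x (Suc k)) - b)) \<longlonglongrightarrow> 0"
  proof (rule Lim_null_comparison)
    have "norm (blinfun_apply (K (Suc k)) (x (Suc k)) - b) \<le> norm (dy k) / \<beta> + norm (E k) * R" for k
    proof -
      have "blinfun_apply (K (Suc k)) (x (Suc k)) - b = (1 / \<beta>) *\<^sub>R dy k - blinfun_apply (E k) (x (Suc k))"
        using dual_step[of k] \<beta>_pos by (simp add: blinfun.add_left)
      also have "norm \<dots> \<le> norm ((1 / \<beta>) *\<^sub>R dy k) + norm (blinfun_apply (E k) (x (Suc k)))"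
        by (rule norm_triangle_ineq4)
      also have "\<dots> \<le> norm (dy k) / \<beta> + norm (E k) * R"
        using \<beta>_pos by (intro add_mono order_trans[OF norm_blinfun] mult_left_mono R) auto
      finally show ?thesis .
    qed
    then show "\<forall>\<^sub>F k in sequentially. norm (norm (blinfun_apply (K (Suc k)) (x (Suc k)) - b))
        \<le> norm (dy k) / \<beta> + norm (E k) * R" by simp
    show "(\<lambda>k. norm (dy k) / \<beta> + norm (E k) * R) \<longlonglongrightarrow> 0"
      by (intro tendsto_add_zero tendsto_mult_right_zero tendsto_mult_left_zero tendsto_divide_zero dy E)
  qed
  then show "(\<lambda>k. norm (blinfun_apply (K k) (x k) - b)) \<longlonglongrightarrow> 0" by (rule LIMSEQ_imp_Suc)
  have "(\<lambda>k. norm (c + adjoint (blinfun_apply (K (Suc k))) (y (Suc k)))) \<longlonglongrightarrow> 0"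
  proof (rule Lim_null_comparison)
    have "norm (c + adjoint (blinfun_apply (K (Suc k))) (y (Suc k))) \<le> norm (dx k) / \<eta> + norm (E k) * Y" for k
    proof (rule norm_le_of_inner_le)
      have "0 \<le> Y" using Y[of 0] norm_ge_zero order_trans by blast
      then show "0 \<le> norm (dx k) / \<eta> + norm (E k) * Y" using \<eta>_pos by simp
      fix h
      have lin: "linear (blinfun_apply (K (Suc k)))"
        using blinfun.bounded_linear_right bounded_linear.linear by blast
      have "(c + adjoint (blinfun_apply (K (Suc k))) (y (Suc k))) \<bullet> h
          = - (dx k \<bullet> h) / \<eta> + - (y (Suc k) \<bullet> blinfun_apply (E k) h)"
        using primal_optimality[of h k] adjoint_works[OF lin, of h "y (Suc k)"]
        by (simp add: inner_add_left inner_add_right blinfun.add_left inner_commute)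
      also have "\<dots> \<le> norm (dx k) * norm h / \<eta> + Y * (norm (E k) * norm h)"
        using \<eta>_pos \<open>0 \<le> Y\<close>
        by (intro add_mono divide_right_mono neg_inner_le order_trans[OF neg_inner_le] mult_mono Y norm_blinfun) auto
      finally show "(c + adjoint (blinfun_apply (K (Suc k))) (y (Suc k))) \<bullet> h
          \<le> (norm (dx k) / \<eta> + norm (E k) * Y) * norm h"
        by (simp add: algebra_simps)
    qed
    then show "\<forall>\<^sub>F k in sequentially. norm (norm (c + adjoint (blinfun_apply (K (Suc k))) (y (Suc k))))
        \<le> norm (dx k) / \<eta> + norm (E k) * Y" by simp
    show "(\<lambda>k. norm (dx k) / \<eta> + norm (E k) * Y) \<longlonglongrightarrow> 0"
      by (intro tendsto_add_zero tendsto_mult_right_zero tendsto_mult_left_zero tendsto_divide_zero dx E)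
  qed
  then show "(\<lambda>k. norm (c + adjoint (blinfun_apply (K k)) (y k))) \<longlonglongrightarrow> 0" by (rule LIMSEQ_imp_Suc)
qed

end

section \<open>The occupancy operator\<close>

lemma kern_transpose_eq_sum:
  "kern_transpose P q = (\<Sum>i\<in>UNIV. q $ i *\<^sub>R P (fst i) (snd i))"
proof -
  have "(\<Sum>s\<in>UNIV. \<Sum>a\<in>UNIV. P s a $ s' * q $ (s, a)) = (\<Sum>i\<in>UNIV. q $ i * P (fst i) (snd i) $ s')" for s'
    by (simp add: sum.cartesian_product case_prod_unfold UNIV_Times_UNIV mult.commute)
  then show ?thesis
    by (simp add: kern_transpose_def vec_eq_iff)
qed

lemma Kop_diff_apply:
  "blinfun_apply (Kop D P \<theta> - Kop D Q \<theta>) x =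
     (- disc D *\<^sub>R (kern_transpose P (fst x) - kern_transpose Q (fst x)), 0)"
  by (cases x) (simp add: blinfun.diff_left Kop_apply algebra_simps)

text \<open>The policy sits in a block that is common to both operators, so it cancels. Hence the
  estimation error is one fixed operator, and the supremum in \<open>kern_err\<close> is over a
  constant.\<close>

lemma Kop_diff_eq: "Kop D P \<theta> - Kop D Q \<theta> = Kop D P \<theta>' - Kop D Q \<theta>'"
  by (rule blinfun_eqI) (simp add: Kop_diff_apply)

lemma norm_Kop_diff_le:
  assumes "0 \<le> disc D" "disc D \<le> 1"
  shows "norm (Kop D P \<theta> - Kop D Q \<theta>) \<le> (\<Sum>i\<in>UNIV. norm (P (fst i) (snd i) - Q (fst i) (snd i)))"
proof (rule norm_blinfun_bound)
  fix x :: "('a, 'b) primal"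
  have q: "\<bar>fst x $ i\<bar> \<le> norm x" for i
    using order_trans[OF component_le_norm_cart[of "fst x" i] norm_fst_le[of "fst x" "snd x"]] by simp
  have "kern_transpose P (fst x) - kern_transpose Q (fst x)
      = (\<Sum>i\<in>UNIV. fst x $ i *\<^sub>R (P (fst i) (snd i) - Q (fst i) (snd i)))"
    by (simp add: kern_transpose_eq_sum scaleR_diff_right sum_subtractf)
  also have "norm \<dots> \<le> (\<Sum>i\<in>UNIV. norm x * norm (P (fst i) (snd i) - Q (fst i) (snd i)))"
    using q by (intro sum_norm_le) (simp add: mult_right_mono)
  also have "\<dots> = (\<Sum>i\<in>UNIV. norm (P (fst i) (snd i) - Q (fst i) (snd i))) * norm x"
    by (simp add: sum_distrib_left sum_distrib_right mult.commute)
  finally have n: "norm (kern_transpose P (fst x) - kern_transpose Q (fst x)) \<le> \<dots>" .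
  have "norm (blinfun_apply (Kop D P \<theta> - Kop D Q \<theta>) x)
      = disc D * norm (kern_transpose P (fst x) - kern_transpose Q (fst x))"
    unfolding Kop_diff_apply using assms by (simp add: norm_Pair norm_minus_commute)
  also have "\<dots> \<le> 1 * norm (kern_transpose P (fst x) - kern_transpose Q (fst x))"
    using assms by (intro mult_right_mono) auto
  finally show "norm (blinfun_apply (Kop D P \<theta> - Kop D Q \<theta>) x)
      \<le> (\<Sum>i\<in>UNIV. norm (P (fst i) (snd i) - Q (fst i) (snd i))) * norm x"
    using n by simp
qed (simp add: sum_nonneg)

text \<open>A null vector satisfies the homogeneous flow equation: \<open>d\<close> equals
  \<open>disc D\<close> times its image under the transition operator of the policy. That operator
  does not increase the sum of absolute values, because the rows and the policy are probability
  vectors, so \<open>disc D < 1\<close> forces \<open>d = 0\<close>, and then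
  \<open>q = 0\<close>.\<close>

lemma Kop_injective:
  fixes D :: "('s::finite, 'a::finite, 'p) occ_problem"
  assumes disc: "0 < disc D" "disc D < 1" and P: "\<And>s a. P s a \<in> prob_simplex"
    and zero: "blinfun_apply (Kop D P \<theta>) (q, d) = 0"
  shows "q = 0 \<and> d = 0"
proof -
  have "- disc D *\<^sub>R kern_transpose P q + d = 0" "q - policy_op (policy D \<theta>) d = 0"
    using zero[unfolded Kop_apply zero_prod_def prod.inject] by blast+
  then have d: "d = disc D *\<^sub>R kern_transpose P q" and q: "q = policy_op (policy D \<theta>) d"
    unfolding eq_neg_iff_add_eq_0[symmetric, of d] right_minus_eq scaleR_minus_left
    by (metis add.commute add_eq_0_iff minus_minus)+
  have "(\<Sum>s'\<in>UNIV. \<bar>d $ s'\<bar>) \<le> disc D * (\<Sum>s\<in>UNIV. \<bar>d $ s\<bar>)"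
  proof -
    have "\<bar>d $ s'\<bar> \<le> disc D * (\<Sum>s\<in>UNIV. \<Sum>a\<in>UNIV. P s a $ s' * (pmf (policy D \<theta> s) a * \<bar>d $ s\<bar>))" for s'
    proof -
      have P_nonneg: "0 \<le> P s a $ s'" for s a using P by (auto simp: prob_simplex_def)
      have "d $ s' = disc D * (\<Sum>s\<in>UNIV. \<Sum>a\<in>UNIV. P s a $ s' * (pmf (policy D \<theta> s) a * d $ s))"
        by (subst d, subst q) (simp add: kern_transpose_def policy_op_def)
      then have "\<bar>d $ s'\<bar> = disc D * \<bar>\<Sum>s\<in>UNIV. \<Sum>a\<in>UNIV. P s a $ s' * (pmf (policy D \<theta> s) a * d $ s)\<bar>"
        using disc by (simp add: abs_mult)
      also have "\<dots> \<le> disc D * (\<Sum>s\<in>UNIV. \<Sum>a\<in>UNIV. \<bar>P s a $ s' * (pmf (policy D \<theta> s) a * d $ s)\<bar>)"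
        using disc by (intro mult_left_mono order_trans[OF sum_abs] sum_mono sum_abs) auto
      also have "\<dots> = disc D * (\<Sum>s\<in>UNIV. \<Sum>a\<in>UNIV. P s a $ s' * (pmf (policy D \<theta> s) a * \<bar>d $ s\<bar>))"
        by (simp add: abs_mult P_nonneg)
      finally show ?thesis .
    qed
    then have "(\<Sum>s'\<in>UNIV. \<bar>d $ s'\<bar>)
        \<le> (\<Sum>s'\<in>UNIV. disc D * (\<Sum>s\<in>UNIV. \<Sum>a\<in>UNIV. P s a $ s' * (pmf (policy D \<theta> s) a * \<bar>d $ s\<bar>)))"
      by (rule sum_mono)
    also have "\<dots> = disc D * (\<Sum>s\<in>UNIV. \<Sum>a\<in>UNIV. (\<Sum>s'\<in>UNIV. P s a $ s') * (pmf (policy D \<theta> s) a * \<bar>d $ s\<bar>))"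
      by (simp only: sum_distrib_left[symmetric] sum_distrib_right, subst sum.swap, subst (2) sum.swap) (rule refl)
    also have "\<dots> = disc D * (\<Sum>s\<in>UNIV. (\<Sum>a\<in>UNIV. pmf (policy D \<theta> s) a) * \<bar>d $ s\<bar>)"
      using P by (simp add: prob_simplex_def sum_distrib_right)
    also have "\<dots> = disc D * (\<Sum>s\<in>UNIV. \<bar>d $ s\<bar>)"
      by (simp add: sum_pmf_eq_1)
    finally show ?thesis .
  qed
  then have "(1 - disc D) * (\<Sum>s\<in>UNIV. \<bar>d $ s\<bar>) \<le> 0"
    by (simp add: algebra_simps)
  then have "(\<Sum>s\<in>UNIV. \<bar>d $ s\<bar>) \<le> 0"
    using disc by (simp add: mult_le_0_iff)
  then have "d = 0"
    using sum_nonneg_eq_0_iff[of UNIV "\<lambda>s. \<bar>d $ s\<bar>"] by (simp add: vec_eq_iff order_antisym sum_nonneg)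
  then show ?thesis using q by (simp add: policy_op_def vec_eq_iff)
qed

lemma bij_Kop:
  fixes D :: "('s::finite, 'a::finite, 'p) occ_problem"
  assumes "0 < disc D" "disc D < 1" "\<And>s a. P s a \<in> prob_simplex"
  shows "bij (blinfun_apply (Kop D P \<theta>))"
proof (rule bijI)
  have lin: "linear (blinfun_apply (Kop D P \<theta>))"
    using blinfun.bounded_linear_right bounded_linear.linear by blast
  show inj: "inj (blinfun_apply (Kop D P \<theta>))"
    unfolding linear_injective_0[OF lin]
    using Kop_injective[OF assms] by (auto simp: zero_prod_def)
  \<comment> \<open>The two blocks are ordered differently in the domain and in the codomain; after
    a swap the operator is an endomorphism, for which injectivity gives surjectivity.\<close>
  have swap: "linear (prod.swap :: ('s, 'a) dual \<Rightarrow> ('s, 'a) primal)"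
    by (rule linearI) auto
  have "surj (prod.swap \<circ> blinfun_apply (Kop D P \<theta>))"
    by (intro linear_injective_imp_surjective linear_compose lin swap inj_compose inj) simp_all
  then show "surj (blinfun_apply (Kop D P \<theta>))"
    by (metis bij_swap bij_is_inj comp_assoc comp_surj surj_iff swap_comp_swap comp_id id_comp surj_swap)
qed

section \<open>Dependence of the operator on the policy parameter\<close>

text \<open>The policy block for an arbitrary weight vector, not only for probabilities, so that it
  is linear in \<open>w\<close> and can be applied to differences of policies.\<close>

definition policy_blin :: "real ^ ('s::finite \<times> 'a::finite) \<Rightarrow> ('s, 'a) primal \<Rightarrow>\<^sub>L ('s, 'a) dual" where
  "policy_blin w = Blinfun (\<lambda>x. (0, - (\<chi> i. w $ i * snd x $ fst i)))"

lemma policy_blin_apply: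
  fixes w :: "real ^ ('s::finite \<times> 'a::finite)"
  shows "blinfun_apply (policy_blin w) x = (0, - (\<chi> i. w $ i * snd x $ fst i))"
proof -
  have "linear (\<lambda>x :: ('s, 'a) primal. (0 :: real ^ 's, - (\<chi> i. w $ i * snd x $ fst i) :: real ^ ('s \<times> 'a)))"
    by (rule linearI) (auto simp: vec_eq_iff algebra_simps)
  then show ?thesis
    unfolding policy_blin_def by (simp add: bounded_linear_Blinfun_apply linear_conv_bounded_linear)
qed

lemma bounded_linear_policy_blin: "bounded_linear policy_blin"
proof -
  have "linear policy_blin"
    by (rule linearI; rule blinfun_eqI)
       (auto simp: policy_blin_apply blinfun.add_left blinfun.scaleR_left vec_eq_iff algebra_simps)
  then show ?thesis by (simp add: linear_conv_bounded_linear)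
qed

definition policy_vec :: "('s::finite, 'a::finite, 'p) occ_problem \<Rightarrow> 'p \<Rightarrow> real ^ ('s \<times> 'a)" where
  "policy_vec D \<theta> = (\<chi> i. pmf (policy D \<theta> (fst i)) (snd i))"

text \<open>The operator is affine in the vector of policy probabilities. This reduces boundedness
  and differentiability in \<open>\<theta>\<close> to the same properties of that vector.\<close>

lemma Kop_policy: "Kop D P \<theta> = Kop D P \<theta>' + policy_blin (policy_vec D \<theta> - policy_vec D \<theta>')"
proof (rule blinfun_eqI)
  fix x :: "('a, 'b) primal"
  show "blinfun_apply (Kop D P \<theta>) x = blinfun_apply (Kop D P \<theta>' + policy_blin (policy_vec D \<theta> - policy_vec D \<theta>')) x"
    by (cases x)
       (auto simp: Kop_apply blinfun.add_left policy_blin_apply policy_op_def policy_vec_def vec_eq_iff algebra_simps)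
qed

text \<open>Policy probabilities lie in the unit interval, so the policy vectors have bounded
  differences; \<open>undefined\<close> stands for an arbitrary base point.\<close>

lemma norm_Kop_bounded:
  fixes D :: "('a::finite, 'b::finite, 'p) occ_problem"
  shows "\<exists>B. \<forall>\<theta>. norm (Kop D P \<theta>) \<le> B"
proof -
  obtain C where C: "0 \<le> C" "\<And>w. norm (policy_blin w :: ('a, 'b) primal \<Rightarrow>\<^sub>L ('a, 'b) dual) \<le> norm w * C"
    using bounded_linear.nonneg_bounded[OF bounded_linear_policy_blin] by blast
  have "norm (Kop D P \<theta>) \<le> norm (Kop D P undefined) + real CARD('a \<times> 'b) * C" for \<theta>
  proof -
    let ?w = "policy_vec D \<theta> - policy_vec D undefined"
    have "norm ?w \<le> (\<Sum>i\<in>UNIV. \<bar>?w $ i\<bar>)" by (rule norm_le_l1_cart)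
    also have "\<dots> \<le> (\<Sum>i::'a \<times> 'b\<in>UNIV. 1)"
    proof (rule sum_mono)
      fix i
      have "\<bar>u - v\<bar> \<le> 1" if "0 \<le> u" "u \<le> 1" "0 \<le> v" "v \<le> 1" for u v :: real using that by linarith
      then show "\<bar>?w $ i\<bar> \<le> 1" by (simp add: policy_vec_def pmf_le_1)
    qed
    finally have "norm ?w \<le> real CARD('a \<times> 'b)" by simp
    then have "norm (policy_blin ?w) \<le> real CARD('a \<times> 'b) * C"
      using C by (meson mult_right_mono order_trans)
    then show ?thesis
      unfolding Kop_policy[of D P \<theta> undefined] by (meson add_left_mono norm_triangle_ineq order_trans)
  qed
  then show ?thesis by blast
qed

lemma policy_vec_differentiable:
  assumes "\<And>s a. cont_diff_on U (\<lambda>\<theta>. pmf (policy D \<theta> s) a)" "\<theta> \<in> U"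
  shows "policy_vec D differentiable (at \<theta>)"
proof -
  have "(\<lambda>\<theta>. policy_vec D \<theta> \<bullet> v) differentiable (at \<theta>)" if "v \<in> Basis" for v
  proof -
    have "\<exists>i. v = axis i 1" using that unfolding Basis_vec_def by auto
    then obtain i where v: "v = axis i 1" by blast
    have "(\<lambda>\<theta>. policy_vec D \<theta> \<bullet> v) = (\<lambda>\<theta>. pmf (policy D \<theta> (fst i)) (snd i))"
      by (simp add: v policy_vec_def inner_axis)
    moreover have "(\<lambda>\<theta>. pmf (policy D \<theta> (fst i)) (snd i)) differentiable (at \<theta>)"
      using assms unfolding cont_diff_on_def gderiv_def differentiable_def by blast
    ultimately show ?thesis by simp
  qed
  then show ?thesis by (subst differentiable_componentwise_within) blast
qed

text \<open>The kernels \<open>P\<close> and \<open>Q\<close> may differ because, by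
  \<open>Kop_policy\<close>, the derivative does not see the kernel. This lets the gradient of the
  estimated term be written with the derivative of the true operator, which is the one in the
  residual.\<close>

lemma Kop_has_derivative:
  assumes "\<And>s a. cont_diff_on U (\<lambda>\<theta>. pmf (policy D \<theta> s) a)" "\<theta> \<in> U"
  shows "(Kop D P has_derivative frechet_derivative (Kop D Q) (at \<theta>)) (at \<theta>)"
proof -
  have "(policy_vec D has_derivative frechet_derivative (policy_vec D) (at \<theta>)) (at \<theta>)"
    using policy_vec_differentiable[OF assms] frechet_derivative_works by blast
  then have *: "(Kop D P has_derivative (\<lambda>h. policy_blin (frechet_derivative (policy_vec D) (at \<theta>) h))) (at \<theta>)" for P
  proof -
    have eq: "Kop D P = (\<lambda>\<theta>'. Kop D P \<theta> + policy_blin (policy_vec D \<theta>' - policy_vec D \<theta>))"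
      by (rule ext) (rule Kop_policy)
    show ?thesis
      by (subst eq) (auto intro!: derivative_eq_intros bounded_linear.has_derivative[OF bounded_linear_policy_blin]
        \<open>(policy_vec D has_derivative _) _\<close>)
  qed
  have "frechet_derivative (Kop D Q) (at \<theta>) = (\<lambda>h. policy_blin (frechet_derivative (policy_vec D) (at \<theta>) h))"
    using frechet_derivative_at[OF *[of Q]] by simp
  then show ?thesis using *[of P] by simp
qed

lemma grad_eqI: "GDERIV f u :> g \<Longrightarrow> grad f u = g"
  unfolding grad_def
proof (rule the_equality)
  fix g' assume "GDERIV f u :> g" "GDERIV f u :> g'"
  then have "(\<lambda>h. inner h g) = (\<lambda>h. inner h g')"
    unfolding gderiv_def by (rule has_derivative_unique)
  then show "g' = g" by (metis inner_commute vector_eq_ldot)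
qed

lemma GDERIV_aug:
  fixes D :: "('s::finite, 'a::finite, 'p::euclidean_space) occ_problem"
  assumes "\<And>s a. cont_diff_on U (\<lambda>\<theta>. pmf (policy D \<theta> s) a)" "\<theta> \<in> U"
  shows "GDERIV (aug D \<beta> P x y) \<theta> :>
    adjoint (\<lambda>h. blinfun_apply (frechet_derivative (Kop D Q) (at \<theta>) h) x) (y + \<beta> *\<^sub>R Fres D P \<theta> x)"
proof -
  let ?K' = "frechet_derivative (Kop D Q) (at \<theta>)"
  let ?J = "\<lambda>h. blinfun_apply (?K' h) x"
  have K: "(Kop D P has_derivative ?K') (at \<theta>)" by (rule Kop_has_derivative[OF assms])
  have F: "((\<lambda>\<theta>'. Fres D P \<theta>' x) has_derivative ?J) (at \<theta>)"
    unfolding Fres_def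
    using has_derivative_diff[OF bounded_linear.has_derivative[OF blinfun.bounded_linear_left K] has_derivative_const]
    by simp
  have lin: "linear ?J" using has_derivative_linear[OF F] .
  have "(aug D \<beta> P x y has_derivative (\<lambda>h. inner y (?J h) + \<beta> / 2 * (2 * inner (Fres D P \<theta> x) (?J h)))) (at \<theta>)"
    unfolding aug_def power2_norm_eq_inner
    by (rule derivative_eq_intros F refl | simp add: inner_commute)+
  moreover have "(\<lambda>h. inner y (?J h) + \<beta> / 2 * (2 * inner (Fres D P \<theta> x) (?J h)))
      = (\<lambda>h. inner h (adjoint ?J (y + \<beta> *\<^sub>R Fres D P \<theta> x)))"
    by (rule ext) (simp add: adjoint_works[OF lin] inner_add_left inner_add_right inner_commute)
  ultimately show ?thesis unfolding gderiv_def by simp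
qed

lemma frechet_derivative_Fres:
  assumes "\<And>s a. cont_diff_on U (\<lambda>\<theta>. pmf (policy D \<theta> s) a)" "\<theta> \<in> U"
  shows "frechet_derivative (\<lambda>\<theta>'. Fres D P \<theta>' x) (at \<theta>) =
    (\<lambda>h. blinfun_apply (frechet_derivative (Kop D P) (at \<theta>) h) x)"
proof -
  have K: "(Kop D P has_derivative frechet_derivative (Kop D P) (at \<theta>)) (at \<theta>)"
    by (rule Kop_has_derivative[OF assms])
  have F: "((\<lambda>\<theta>'. Fres D P \<theta>' x) has_derivative (\<lambda>h. blinfun_apply (frechet_derivative (Kop D P) (at \<theta>) h) x)) (at \<theta>)"
    unfolding Fres_def
    using has_derivative_diff[OF bounded_linear.has_derivative[OF blinfun.bounded_linear_left K] has_derivative_const]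
    by simp
  then show ?thesis using frechet_derivative_at by metis
qed

section \<open>First-order tools\<close>

text \<open>The descent lemma along a segment: after subtraction of the linear and quadratic parts,
  the restriction of \<open>f\<close> to the segment has a nonpositive derivative.\<close>

lemma lipschitz_gradient_descent:
  fixes f :: "'v::real_inner \<Rightarrow> real"
  assumes g: "\<And>z. z \<in> closed_segment u w \<Longrightarrow> GDERIV f z :> g z"
    and lip: "L-lipschitz_on (closed_segment u w) g"
  shows "f w \<le> f u + inner (g u) (w - u) + L / 2 * (norm (w - u))\<^sup>2"
proof -
  define d where "d = w - u"
  define h where "h t = f (u + t *\<^sub>R d) - t * inner (g u) d - L / 2 * t\<^sup>2 * (norm d)\<^sup>2" for t
  have "h 1 \<le> h 0"
  proof (rule DERIV_nonpos_imp_nonincreasing[of 0 1 h])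
    fix t :: real assume t: "0 \<le> t" "t \<le> 1"
    have z: "u + t *\<^sub>R d \<in> closed_segment u w"
      unfolding in_segment using t by (intro exI[of _ t]) (simp add: d_def algebra_simps)
    have f': "(f has_derivative (\<lambda>v. inner v (g (u + t *\<^sub>R d)))) (at (u + t *\<^sub>R d))"
      using g[OF z] by (simp add: gderiv_def)
    have line: "((\<lambda>t. u + t *\<^sub>R d) has_derivative (\<lambda>s. s *\<^sub>R d)) (at t)"
      by (auto intro!: derivative_eq_intros)
    have "((\<lambda>t. f (u + t *\<^sub>R d)) has_derivative (\<lambda>s. inner (s *\<^sub>R d) (g (u + t *\<^sub>R d)))) (at t)"
      by (rule has_derivative_compose[OF line f'])
    moreover have "(\<lambda>s. inner (s *\<^sub>R d) (g (u + t *\<^sub>R d))) = (*) (inner d (g (u + t *\<^sub>R d)))"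
      by (auto simp: mult.commute)
    ultimately have "DERIV (\<lambda>t. f (u + t *\<^sub>R d)) t :> inner d (g (u + t *\<^sub>R d))"
      by (simp add: has_field_derivative_def)
    then have "DERIV h t :> inner d (g (u + t *\<^sub>R d)) - inner (g u) d - L * t * (norm d)\<^sup>2"
      unfolding h_def by (auto intro!: derivative_eq_intros)
    moreover have "inner d (g (u + t *\<^sub>R d)) - inner (g u) d \<le> L * t * (norm d)\<^sup>2"
    proof -
      have "inner d (g (u + t *\<^sub>R d)) - inner (g u) d = inner (g (u + t *\<^sub>R d) - g u) d"
        by (simp add: inner_diff_right inner_commute)
      also have "\<dots> \<le> norm (g (u + t *\<^sub>R d) - g u) * norm d"
        by (rule norm_cauchy_schwarz)
      also have "\<dots> \<le> (L * (t * norm d)) * norm d"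
        using lipschitz_onD[OF lip z, of u] t by (intro mult_right_mono) (auto simp: dist_norm)
      finally show ?thesis by (simp add: power2_eq_square mult_ac)
    qed
    ultimately show "\<exists>y. DERIV h t :> y \<and> y \<le> 0" by fastforce
  qed simp
  then show ?thesis by (simp add: h_def d_def)
qed

text \<open>Division by the distance turns the quadratic loss into
  \<open>- C * norm (w - u)\<close>, which tends to 0 and so does not affect the lower
  limit.\<close>

lemma regular_subdiff_quadratic_minorant:
  fixes f :: "'v::euclidean_space \<Rightarrow> ereal"
  assumes fin: "\<bar>f u\<bar> \<noteq> \<infinity>"
    and minor: "\<And>w. f u + ereal (inner v (w - u) - C * (norm (w - u))\<^sup>2) \<le> f w"
  shows "v \<in> regular_subdiff f u"
proof -
  let ?q = "\<lambda>w. (f w - f u - ereal (inner v (w - u))) / ereal (norm (w - u))"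
  have "ereal (- C * norm (w - u)) \<le> ?q w" if "w \<noteq> u" for w
  proof -
    have n: "0 < norm (w - u)" using that by simp
    obtain a where a: "f u = ereal a" using fin by auto
    show ?thesis
    proof (cases "f w")
      case (real c)
      have "- C * norm (w - u) * norm (w - u) \<le> c - a - inner v (w - u)"
        using minor[of w] by (simp add: a real power2_eq_square)
      then have "- C * norm (w - u) \<le> (c - a - inner v (w - u)) / norm (w - u)"
        using n by (subst pos_le_divide_eq)
      then show ?thesis using n by (simp add: a real)
    next
      case PInf
      then show ?thesis using n by (simp add: a)
    next
      case MInf
      then show ?thesis using minor[of w] a by simp
    qed
  qed
  then have ev: "eventually (\<lambda>w. ereal (- C * norm (w - u)) \<le> ?q w) (at u)"
    by (auto simp: eventually_at_filter)
  have "((\<lambda>w. - C * norm (w - u)) \<longlongrightarrow> - C * norm (u - u)) (at u)"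
    by (intro tendsto_intros)
  then have "((\<lambda>w. ereal (- C * norm (w - u))) \<longlongrightarrow> 0) (at u)"
    by (simp add: zero_ereal_def)
  then have "Liminf (at u) (\<lambda>w. ereal (- C * norm (w - u))) = 0"
    by (intro lim_imp_Liminf) auto
  with Liminf_mono[OF ev] show ?thesis
    by (simp add: regular_subdiff_def fin)
qed

lemma regular_subdiff_subset_limiting: "regular_subdiff f u \<subseteq> limiting_subdiff f u"
proof
  fix v assume v: "v \<in> regular_subdiff f u"
  then have "\<bar>f u\<bar> \<noteq> \<infinity>" by (simp add: regular_subdiff_def)
  with v show "v \<in> limiting_subdiff f u"
    unfolding limiting_subdiff_def
    by (intro CollectI conjI exI[of _ "\<lambda>_. u"] exI[of _ "\<lambda>_. v"]) auto
qed

section \<open>One realization of the algorithm\<close>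

lemma prob_simplex_nonempty: "prob_simplex \<noteq> {}"
proof -
  have "(\<chi> i. 1 / real CARD('s)) \<in> (prob_simplex :: (real ^ 's::finite) set)"
    by (simp add: prob_simplex_def)
  then show ?thesis by blast
qed

lemma closed_prob_simplex: "closed (prob_simplex :: (real ^ 's::finite) set)"
proof -
  have "prob_simplex = (\<Inter>i. {v :: real ^ 's. 0 \<le> v $ i}) \<inter> {v. (\<Sum>i\<in>UNIV. v $ i) = 1}"
    by (auto simp: prob_simplex_def)
  moreover have "closed {v :: real ^ 's. 0 \<le> v $ i}" for i
    by (intro closed_Collect_le continuous_intros)
  moreover have "closed {v :: real ^ 's. (\<Sum>i\<in>UNIV. v $ i) = 1}"
    by (intro closed_Collect_eq continuous_intros)
  ultimately show ?thesis by (metis (no_types, lifting) closed_INT closed_Int)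
qed

lemma convex_prob_simplex: "convex (prob_simplex :: (real ^ 's::finite) set)"
  by (rule convexI) (simp add: prob_simplex_def sum.distrib sum_distrib_left[symmetric])

lemma true_rows_in_simplex: "true_rows D s a \<in> prob_simplex"
  by (simp add: true_rows_def prob_simplex_def sum_pmf_eq_1)

lemma P_hat_in_simplex: "P_hat D th z k s a \<in> prob_simplex"
  unfolding P_hat_def est_rows_def
  by (rule closest_point_in_set[OF closed_prob_simplex prob_simplex_nonempty])

lemma aug_eq_aug_term: "aug D \<beta> P x y \<theta> = aug_term \<beta> (bvec D) (Kop D P \<theta>) x y"
  by (simp add: aug_def aug_term_def Fres_def)

text \<open>Everything that holds for a fixed outcome. The randomness of the trajectories is felt
  here only through the errors \<open>kern_err\<close>, whose square-summability is a premise of the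
  convergence lemmas.\<close>

locale occ_admm_run =
  fixes D :: "('s::finite, 'a::finite, 'p::euclidean_space) occ_problem"
    and U :: "'p set" and th :: "nat \<Rightarrow> 'p" and x :: "nat \<Rightarrow> ('s, 'a) primal" and y :: "nat \<Rightarrow> ('s, 'a) dual"
    and z :: "nat \<Rightarrow> ('s, 'a) step list" and \<eta>\<theta> :: "nat \<Rightarrow> real"
    and \<beta> \<eta>x \<eta>min Lbar LK \<kappa> A\<^sub>C a\<^sub>\<theta> Binf :: real
  assumes disc: "0 < disc D" "disc D < 1"
    and convex_feasible: "convex (feasible D)"
    and feasible_U: "feasible D \<subseteq> U"
    and policy_smooth: "\<And>s a. cont_diff_on U (\<lambda>\<theta>. pmf (policy D \<theta> s) a)"
    and proper: "proper_fun (psi D)"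
    and Binf_eq: "ereal Binf = (INF \<theta>\<in>feasible D. reduced_obj D \<theta>)"
    and start: "psi D (th 0) < \<infinity>"
    and run: "admm_run D \<beta> \<eta>x \<eta>\<theta> th x y z"
    and true_inv: "\<And>\<theta>. \<theta> \<in> feasible D \<Longrightarrow> onorm (inv (blinfun_apply (Kop D (true_rows D) \<theta>))) \<le> \<kappa>"
    and hat_inv: "\<And>k \<theta>. \<theta> \<in> feasible D \<Longrightarrow> onorm (inv (blinfun_apply (Kop D (P_hat D th z k) \<theta>))) \<le> \<kappa>"
    and Kop_lip: "\<And>\<theta> \<theta>'. \<theta> \<in> feasible D \<Longrightarrow> \<theta>' \<in> feasible D \<Longrightarrow>
           norm (Kop D (true_rows D) \<theta> - Kop D (true_rows D) \<theta>') \<le> LK * norm (\<theta> - \<theta>')"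
    and Kop_deriv_bounded: "\<exists>B. \<forall>\<theta>\<in>feasible D. onorm (frechet_derivative (Kop D (true_rows D)) (at \<theta>)) \<le> B"
    and grad_lip: "\<And>k. Lbar-lipschitz_on (closed_segment (th k) (th (Suc k)))
           (grad (aug D \<beta> (P_hat D th z k) (x k) (y k)))"
    and params: "0 < \<eta>x" "\<beta> > 36 * \<kappa>\<^sup>2 / \<eta>x"
    and \<eta>min: "0 < \<eta>min" "\<And>k. \<eta>min \<le> \<eta>\<theta> k"
    and A_C_eq: "A\<^sub>C = 9 * \<kappa> ^ 4 * LK\<^sup>2 * (norm (cvec D))\<^sup>2"
    and a_pos': "0 < a\<^sub>\<theta>"
    and a_le': "\<And>k. a\<^sub>\<theta> \<le> 1 / (2 * \<eta>\<theta> k) - Lbar / 2 - 3 * A\<^sub>C / (2 * \<beta>)"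
begin

abbreviation "K\<^sub>t \<equiv> Kop D (true_rows D)"
abbreviation "P\<^sub>h k \<equiv> P_hat D th z k"

text \<open>The initial parameter is only a representative: by \<open>Kop_diff_eq\<close> every
  parameter gives the same operator.\<close>

definition "err k = Kop D (P\<^sub>h k) (th 0) - K\<^sub>t (th 0)"

lemma Kop_hat: "Kop D (P\<^sub>h k) \<theta> = K\<^sub>t \<theta> + err k"
  using Kop_diff_eq[of D "P\<^sub>h k" \<theta> "true_rows D" "th 0"] by (simp add: err_def algebra_simps)

lemma th_feasible: "th k \<in> feasible D"
proof (cases k)
  case 0
  then show ?thesis using start by (simp add: psi_def split: if_splits)
next
  case (Suc j)
  then show ?thesis using run by (simp add: admm_run_def is_arg_min_def)
qed

lemma th_U: "th k \<in> U"
  using th_feasible feasible_U by blast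

lemma penalty_not_MInf: "\<theta> \<in> feasible D \<Longrightarrow> penalty D \<theta> \<noteq> -\<infinity>"
  using proper by (auto simp: proper_fun_def psi_def dest: spec[of _ \<theta>])

abbreviation "g\<^sub>h k \<equiv> grad (aug D \<beta> (P\<^sub>h k) (x k) (y k)) (th k)"

lemma th_optimal:
  assumes "\<theta> \<in> feasible D"
  shows "penalty D (th (Suc k)) + ereal (inner (g\<^sub>h k) (th (Suc k) - th k) + 1 / (2 * \<eta>\<theta> k) * (norm (th (Suc k) - th k))\<^sup>2)
    \<le> penalty D \<theta> + ereal (inner (g\<^sub>h k) (\<theta> - th k) + 1 / (2 * \<eta>\<theta> k) * (norm (\<theta> - th k))\<^sup>2)"
  using run assms unfolding admm_run_def is_arg_min_def by (meson not_le)

text \<open>The previous parameter competes in the policy step with a finite objective, so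
  finiteness is inherited from the start.\<close>

lemma penalty_finite: "\<bar>penalty D (th k)\<bar> \<noteq> \<infinity>"
proof -
  have "penalty D (th k) < \<infinity>"
  proof (induction k)
    case 0
    then show ?case using start th_feasible[of 0] by (simp add: psi_def)
  next
    case (Suc k)
    have "penalty D (th (Suc k)) + ereal t \<le> penalty D (th k)" if "t = inner (g\<^sub>h k) (th (Suc k) - th k) + 1 / (2 * \<eta>\<theta> k) * (norm (th (Suc k) - th k))\<^sup>2" for t
      using th_optimal[OF th_feasible[of k], of k] by (simp add: that zero_ereal_def[symmetric])
    then show ?case using Suc by (metis ereal_infty_less(1) ereal_plus_eq_PInfty linorder_not_less not_less_iff_gr_or_eq top_greatest)
  qed
  then show ?thesis using penalty_not_MInf[OF th_feasible[of k]] by auto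
qed

definition "pen k = real_of_ereal (penalty D (th k))"

lemma penalty_eq: "penalty D (th k) = ereal (pen k)"
  using penalty_finite[of k] by (simp add: pen_def ereal_real)

lemma GDERIV_hat:
  assumes "\<theta> \<in> U"
  shows "GDERIV (aug D \<beta> (P\<^sub>h k) (x k) (y k)) \<theta> :> grad (aug D \<beta> (P\<^sub>h k) (x k) (y k)) \<theta>"
  using GDERIV_aug[OF policy_smooth assms] grad_eqI by metis

lemma segment_U: "closed_segment (th k) (th (Suc k)) \<subseteq> U"
  using closed_segment_subset[OF th_feasible th_feasible convex_feasible] feasible_U by blast

text \<open>A chosen bound, because the interpretation of \<open>perturbed_admm\<close> below takes
  it as a parameter.\<close>

definition "Kbd = (SOME B. \<forall>\<theta>. norm (K\<^sub>t \<theta>) \<le> B)"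

lemma Kbd: "norm (K\<^sub>t \<theta>) \<le> Kbd"
  using someI_ex[OF norm_Kop_bounded[of D "true_rows D"]] by (simp add: Kbd_def)

text \<open>The old parameter is the competitor in the policy step, and the descent lemma replaces
  the linearization by the estimated term itself.\<close>

lemma policy_step_real:
  "pen (Suc k) + aug D \<beta> (P\<^sub>h k) (x k) (y k) (th (Suc k)) + (1 / (2 * \<eta>\<theta> k) - Lbar / 2) * (norm (th (Suc k) - th k))\<^sup>2
    \<le> pen k + aug D \<beta> (P\<^sub>h k) (x k) (y k) (th k)"
proof -
  have "pen (Suc k) + (inner (g\<^sub>h k) (th (Suc k) - th k) + 1 / (2 * \<eta>\<theta> k) * (norm (th (Suc k) - th k))\<^sup>2) \<le> pen k"
    using th_optimal[OF th_feasible[of k], of k] by (simp add: penalty_eq)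
  moreover have "aug D \<beta> (P\<^sub>h k) (x k) (y k) (th (Suc k)) \<le> aug D \<beta> (P\<^sub>h k) (x k) (y k) (th k)
      + inner (g\<^sub>h k) (th (Suc k) - th k) + Lbar / 2 * (norm (th (Suc k) - th k))\<^sup>2"
    using segment_U by (intro lipschitz_gradient_descent GDERIV_hat grad_lip) blast
  ultimately show ?thesis by (simp add: left_diff_distrib)
qed

sublocale perturbed_admm "\<lambda>k. K\<^sub>t (th k)" err "bvec D" "cvec D" x y pen "\<lambda>k. norm (th (Suc k) - th k)" \<eta>\<theta>
    \<beta> \<eta>x \<kappa> LK Lbar A\<^sub>C a\<^sub>\<theta> Binf Kbd
proof
  fix k
  show "bij (blinfun_apply (K\<^sub>t (th k)))"
    by (rule bij_Kop[OF disc true_rows_in_simplex])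
  show "bij (blinfun_apply (K\<^sub>t (th (Suc k)) + err k))"
    unfolding Kop_hat[symmetric] by (rule bij_Kop[OF disc P_hat_in_simplex])
  show "onorm (inv (blinfun_apply (K\<^sub>t (th k)))) \<le> \<kappa>"
    by (rule true_inv[OF th_feasible])
  show "onorm (inv (blinfun_apply (K\<^sub>t (th (Suc k)) + err k))) \<le> \<kappa>"
    unfolding Kop_hat[symmetric] by (rule hat_inv[OF th_feasible])
  show "norm (K\<^sub>t (th (Suc k)) - K\<^sub>t (th k)) \<le> LK * norm (th (Suc k) - th k)"
    by (rule Kop_lip[OF th_feasible th_feasible])
  show "norm (K\<^sub>t (th k)) \<le> Kbd" by (rule Kbd)
  show "pen (Suc k) + aug_term \<beta> (bvec D) (K\<^sub>t (th (Suc k)) + err k) (x k) (y k)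
      + (1 / (2 * \<eta>\<theta> k) - Lbar / 2) * (norm (th (Suc k) - th k))\<^sup>2
      \<le> pen k + aug_term \<beta> (bvec D) (K\<^sub>t (th k) + err k) (x k) (y k)"
    using policy_step_real[of k] unfolding aug_eq_aug_term Kop_hat .
  show "is_arg_min (\<lambda>w. cvec D \<bullet> w + aug_term \<beta> (bvec D) (K\<^sub>t (th (Suc k)) + err k) w (y k)
      + 1 / (2 * \<eta>x) * (norm (w - x k))\<^sup>2) (\<lambda>w. True) (x (Suc k))"
    using run unfolding admm_run_def aug_eq_aug_term Kop_hat by blast
  show "y (Suc k) = y k + \<beta> *\<^sub>R (blinfun_apply (K\<^sub>t (th (Suc k)) + err k) (x (Suc k)) - bvec D)"
    using run unfolding admm_run_def Fres_def Kop_hat by blast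
  have "ereal Binf \<le> reduced_obj D (th k)"
    unfolding Binf_eq by (rule INF_lower[OF th_feasible])
  then show "Binf \<le> pen k + cvec D \<bullet> inv (blinfun_apply (K\<^sub>t (th k))) (bvec D)"
    by (simp add: reduced_obj_def penalty_eq)
  show "a\<^sub>\<theta> \<le> 1 / (2 * \<eta>\<theta> k) - Lbar / 2 - 3 * A\<^sub>C / (2 * \<beta>)" by (rule a_le')
qed (use params A_C_eq a_pos' in auto)

lemma kern_err_eq: "kern_err D th z k = norm (err k)"
proof -
  have "feasible D \<noteq> {}" using th_feasible by blast
  moreover have "norm (Kop D (P\<^sub>h k) \<theta> - K\<^sub>t \<theta>) = norm (err k)" for \<theta>
    by (simp add: Kop_hat)
  ultimately show ?thesis by (simp add: kern_err_def)
qed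

lemma Phi_eq: "Phi D \<beta> (1 / (8 * \<eta>x)) th x y k = ereal (potential k)"
  by (cases k) (simp_all add: Phi_def aug_lagrangian_def penalty_eq potential_def LC_def aug_eq_aug_term incr_def)

lemma Phi_lower:
  "Phi_lower_bound D \<beta> (1 / (8 * \<eta>x)) Binf (2 * \<kappa> ^ 4 * (norm (cvec D))\<^sup>2 / \<beta>) (1 / (8 * \<eta>x) - 1 / (18 * \<eta>x)) th x y z"
  unfolding Phi_lower_bound_def
proof (intro allI impI)
  fix k :: nat assume "1 \<le> k"
  then obtain j where k: "k = Suc j" by (cases k) auto
  show "ereal (Binf + \<beta> / 4 * (norm (Fres D (true_rows D) (th k) (x k)))\<^sup>2
            + (1 / (8 * \<eta>x) - 1 / (18 * \<eta>x)) * (norm (incr x k))\<^sup>2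
            - 2 * \<kappa> ^ 4 * (norm (cvec D))\<^sup>2 / \<beta> * (prev_err D th z k)\<^sup>2)
       \<le> Phi D \<beta> (1 / (8 * \<eta>x)) th x y k"
    using potential_lower_bound[of j]
    unfolding Phi_eq by (simp add: k incr_def prev_err_def kern_err_eq Fres_def)
qed

lemma Psi_converges:
  assumes "summable (\<lambda>k. (kern_err D th z k)\<^sup>2)"
  shows "\<exists>l::real. (\<lambda>k. Psi D \<beta> (1 / (8 * \<eta>x)) Binf C0 th x y z k) \<longlonglongrightarrow> ereal l"
proof -
  have E: "summable (\<lambda>k. (norm (err k))\<^sup>2)" using assms by (simp add: kern_err_eq)
  obtain l where l: "potential \<longlonglongrightarrow> l"
    using convergence(1)[OF E] by (auto simp: convergent_def)
  have "(\<lambda>k. prev_err D th z (Suc k)) \<longlonglongrightarrow> 0"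
    using residuals_vanish(3)[OF E] by (simp add: prev_err_def kern_err_eq)
  then have "(\<lambda>k. prev_err D th z k) \<longlonglongrightarrow> 0" by (rule LIMSEQ_imp_Suc)
  then have "(\<lambda>k. potential k - Binf + 1 + C0 * (prev_err D th z k)\<^sup>2) \<longlonglongrightarrow> l - Binf + 1 + C0 * 0\<^sup>2"
    by (intro tendsto_intros l)
  then have "(\<lambda>k. ereal (potential k - Binf + 1 + C0 * (prev_err D th z k)\<^sup>2)) \<longlonglongrightarrow> ereal (l - Binf + 1)"
    by simp
  moreover have "Psi D \<beta> (1 / (8 * \<eta>x)) Binf C0 th x y z k
      = ereal (potential k - Binf + 1 + C0 * (prev_err D th z k)\<^sup>2)" for k
    by (simp add: Psi_def Phi_eq one_ereal_def)
  ultimately show ?thesis by auto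
qed

lemma increments_summable:
  assumes "summable (\<lambda>k. (kern_err D th z k)\<^sup>2)"
  shows "summable (\<lambda>k. (norm (incr th (Suc k)))\<^sup>2 + (norm (incr x (Suc k)))\<^sup>2 + (norm (incr x k))\<^sup>2)"
proof -
  have E: "summable (\<lambda>k. (norm (err k))\<^sup>2)" using assms by (simp add: kern_err_eq)
  have x: "summable (\<lambda>k. (norm (incr x (Suc k)))\<^sup>2)"
    using convergence(3)[OF E] by (simp add: incr_def)
  then have "summable (\<lambda>k. (norm (incr x k))\<^sup>2)"
    using summable_Suc_iff by blast
  moreover have "summable (\<lambda>k. (norm (incr th (Suc k)))\<^sup>2)"
    using convergence(2)[OF E] by (simp add: incr_def)
  ultimately show ?thesis using x by (intro summable_add)
qed

section \<open>Stationarity in the policy parameter\<close>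

text \<open>The element that the policy step provides in the set whose distance from 0 enters the
  residual: a subgradient of \<open>psi D\<close> plus the true coupling term, both at the new
  iterate.\<close>

definition "stat_err k = - (g\<^sub>h k + (1 / \<eta>\<theta> k) *\<^sub>R (th (Suc k) - th k))
  + adjoint (frechet_derivative (\<lambda>\<theta>'. Fres D (true_rows D) \<theta>' (x (Suc k))) (at (th (Suc k)))) (y (Suc k))"

text \<open>The penalty is not assumed convex, so optimality gives the subgradient inequality only
  up to a quadratic term. Expanding the square of \<open>w - th k\<close> around
  \<open>th (Suc k)\<close> shows that this loss is \<open>1 / (2 * \<eta>\<theta> k)\<close> times
  the squared distance, which the regular subdifferential tolerates.\<close>

lemma optimality_subgradient:
  "- (g\<^sub>h k + (1 / \<eta>\<theta> k) *\<^sub>R (th (Suc k) - th k)) \<in> limiting_subdiff (psi D) (th (Suc k))"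
proof (rule subsetD[OF regular_subdiff_subset_limiting], rule regular_subdiff_quadratic_minorant)
  let ?u = "th (Suc k)" and ?t = "th k" and ?g = "g\<^sub>h k" and ?\<eta> = "\<eta>\<theta> k"
  show "\<bar>psi D ?u\<bar> \<noteq> \<infinity>"
    using penalty_finite[of "Suc k"] th_feasible[of "Suc k"] by (simp add: psi_def)
  fix w
  show "psi D ?u + ereal (inner (- (?g + (1 / ?\<eta>) *\<^sub>R (?u - ?t))) (w - ?u) - 1 / (2 * ?\<eta>) * (norm (w - ?u))\<^sup>2) \<le> psi D w"
  proof (cases "w \<in> feasible D")
    case True
    have \<eta>: "?\<eta> > 0" using \<eta>min(1) \<eta>min(2)[of k] by linarith
    define a where "a = (?u - ?t) \<bullet> (w - ?u)"
    have sq: "(norm (w - ?t))\<^sup>2 = (norm (?u - ?t))\<^sup>2 + 2 * a + (norm (w - ?u))\<^sup>2"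
      using norm_add_scaleR_square[of "?u - ?t" 1 "w - ?u"] by (simp add: a_def power2_norm_eq_inner)
    have "inner (- (?g + (1 / ?\<eta>) *\<^sub>R (?u - ?t))) (w - ?u) = - inner ?g (w - ?u) - a / ?\<eta>"
      by (simp only: inner_minus_left inner_add_left inner_scaleR_left a_def) simp
    moreover have "- inner ?g (w - ?u) = inner ?g (?u - ?t) - inner ?g (w - ?t)"
      by (simp add: inner_diff_right)
    ultimately have id: "inner (- (?g + (1 / ?\<eta>) *\<^sub>R (?u - ?t))) (w - ?u) - 1 / (2 * ?\<eta>) * (norm (w - ?u))\<^sup>2
        = (inner ?g (?u - ?t) + 1 / (2 * ?\<eta>) * (norm (?u - ?t))\<^sup>2) - (inner ?g (w - ?t) + 1 / (2 * ?\<eta>) * (norm (w - ?t))\<^sup>2)"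
      using \<eta> by (simp only: sq) (simp add: field_simps)
    show ?thesis
      using th_optimal[OF True, of k] True th_feasible[of "Suc k"]
      unfolding id psi_def by (cases "penalty D w") (auto simp: penalty_eq)
  next
    case False
    then show ?thesis by (simp add: psi_def)
  qed
qed

text \<open>The gradient of the estimated term at the new parameter is inserted. This leaves the
  proximal term, where \<open>\<eta>min\<close> keeps the inverse step size bounded, a gradient
  change controlled by \<open>Lbar\<close>, and a difference of two adjoints built from the same
  derivative.\<close>

lemma stat_err_vanishes:
  assumes "summable (\<lambda>k. (kern_err D th z k)\<^sup>2)"
  shows "(\<lambda>k. norm (stat_err k)) \<longlonglongrightarrow> 0"
proof -
  have E: "summable (\<lambda>k. (norm (err k))\<^sup>2)" using assms by (simp add: kern_err_eq)
  obtain R Y where R: "\<And>k. norm (x k) \<le> R" and Y: "\<And>k. norm (y k) \<le> Y"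
    using primal_bounded dual_bounded by blast
  have R_nonneg: "0 \<le> R" and Y_nonneg: "0 \<le> Y"
    using R[of 0] Y[of 0] norm_ge_zero order_trans by blast+
  obtain B0 where B0: "\<And>\<theta>. \<theta> \<in> feasible D \<Longrightarrow> onorm (frechet_derivative K\<^sub>t (at \<theta>)) \<le> B0"
    using Kop_deriv_bounded by blast
  define B where "B = max B0 0"
  have B_nonneg: "0 \<le> B" by (simp add: B_def)
  let ?K' = "\<lambda>k. frechet_derivative K\<^sub>t (at (th k))"
  have K'_bl: "bounded_linear (?K' k)" for k
    using Kop_has_derivative[OF policy_smooth th_U] has_derivative_bounded_linear by blast
  have K'_bound: "norm (?K' k h) \<le> B * norm h" for k h
  proof (rule order_trans[OF onorm[OF K'_bl]])
    have "onorm (?K' k) \<le> B"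
      using B0[OF th_feasible[of k]] by (simp add: B_def le_max_iff_disj)
    then show "onorm (?K' k) * norm h \<le> B * norm h" by (rule mult_right_mono) simp
  qed
  have lin: "linear (\<lambda>h. blinfun_apply (?K' k h) w)" for k w
  proof -
    have "bounded_linear (\<lambda>h. blinfun_apply (?K' k h) w)"
      using bounded_linear_compose[OF blinfun.bounded_linear_left[of w] K'_bl[of k]] .
    then show ?thesis by (rule bounded_linear.linear)
  qed
  define u where "u k = 1 / \<eta>min * norm (th (Suc k) - th k) + Lbar * norm (th (Suc k) - th k)
      + (B * Y * norm (dx k) + B * R * \<beta> * ((Kbd + norm (err k)) * norm (dx k)))" for k
  have "norm (stat_err k) \<le> u k" for k
  proof -
    let ?g' = "grad (aug D \<beta> (P\<^sub>h k) (x k) (y k)) (th (Suc k))"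
    \<comment> \<open>The dual update with the old primal iterate in place of the new one; hence it
      differs from \<open>y (Suc k)\<close> by \<open>\<beta>\<close> times \<open>H k\<close>
      applied to the increment of \<open>x\<close>.\<close>
    let ?w = "y k + \<beta> *\<^sub>R Fres D (P\<^sub>h k) (th (Suc k)) (x k)"
    let ?J = "\<lambda>v h. blinfun_apply (?K' (Suc k) h) v"
    have g': "?g' = adjoint (?J (x k)) ?w"
      by (rule grad_eqI[OF GDERIV_aug[OF policy_smooth th_U]])
    have J: "frechet_derivative (\<lambda>\<theta>'. Fres D (true_rows D) \<theta>' (x (Suc k))) (at (th (Suc k))) = ?J (x (Suc k))"
      by (rule frechet_derivative_Fres[OF policy_smooth th_U])
    have yw: "y (Suc k) - ?w = \<beta> *\<^sub>R blinfun_apply (H k) (dx k)"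
      unfolding dual_step Fres_def Kop_hat by (simp add: blinfun.diff_right scaleR_diff_right)
    have norm_yw: "norm (y (Suc k) - ?w) \<le> \<beta> * ((Kbd + norm (err k)) * norm (dx k))"
    proof -
      have "norm (H k) \<le> Kbd + norm (err k)"
        by (intro order_trans[OF norm_triangle_ineq] add_right_mono Kbd)
      then have "norm (blinfun_apply (H k) (dx k)) \<le> (Kbd + norm (err k)) * norm (dx k)"
        by (intro order_trans[OF norm_blinfun] mult_right_mono) auto
      then show ?thesis unfolding yw using \<beta>_pos by simp
    qed
    have "stat_err k = - ((1 / \<eta>\<theta> k) *\<^sub>R (th (Suc k) - th k)) + (?g' - g\<^sub>h k)
        + (adjoint (?J (x (Suc k))) (y (Suc k)) - adjoint (?J (x k)) ?w)"
      unfolding stat_err_def J g' by simp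
    then have "norm (stat_err k) \<le> norm ((1 / \<eta>\<theta> k) *\<^sub>R (th (Suc k) - th k)) + norm (?g' - g\<^sub>h k)
        + norm (adjoint (?J (x (Suc k))) (y (Suc k)) - adjoint (?J (x k)) ?w)"
      by (simp only: norm_minus_cancel[of "(1 / \<eta>\<theta> k) *\<^sub>R (th (Suc k) - th k)", symmetric])
        (rule order_trans[OF norm_triangle_ineq add_right_mono[OF norm_triangle_ineq]])
    also have "\<dots> \<le> u k"
      unfolding u_def
    proof (intro add_mono)
      have "1 / \<eta>\<theta> k \<le> 1 / \<eta>min" "0 \<le> 1 / \<eta>\<theta> k"
        using \<eta>min(1) \<eta>min(2)[of k] by (auto intro!: divide_left_mono)
      then show "norm ((1 / \<eta>\<theta> k) *\<^sub>R (th (Suc k) - th k)) \<le> 1 / \<eta>min * norm (th (Suc k) - th k)"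
        by (simp only: norm_scaleR) (intro mult_right_mono; simp)
      show "norm (?g' - g\<^sub>h k) \<le> Lbar * norm (th (Suc k) - th k)"
        using lipschitz_onD[OF grad_lip[of k], of "th (Suc k)" "th k"] by (simp add: dist_norm)
      show "norm (adjoint (?J (x (Suc k))) (y (Suc k)) - adjoint (?J (x k)) ?w)
        \<le> B * Y * norm (dx k) + B * R * \<beta> * ((Kbd + norm (err k)) * norm (dx k))"
      proof (rule norm_le_of_inner_le)
        have "0 \<le> Kbd" using Kbd norm_ge_zero order_trans by blast
        then show "0 \<le> B * Y * norm (dx k) + B * R * \<beta> * ((Kbd + norm (err k)) * norm (dx k))"
          using B_nonneg Y_nonneg R_nonneg \<beta>_pos by simp
        fix h
        have "(adjoint (?J (x (Suc k))) (y (Suc k)) - adjoint (?J (x k)) ?w) \<bullet> h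
            = ?J (x (Suc k)) h \<bullet> y (Suc k) - ?J (x k) h \<bullet> ?w"
          using adjoint_works[OF lin[of "Suc k" "x (Suc k)"], of h "y (Suc k)"]
            adjoint_works[OF lin[of "Suc k" "x k"], of h ?w]
          by (simp only: inner_commute[of _ h] inner_diff_right)
        also have "\<dots> = ?J (dx k) h \<bullet> y (Suc k) + ?J (x k) h \<bullet> (y (Suc k) - ?w)"
          by (simp only: blinfun.diff_right inner_diff_left inner_diff_right)
        also have "\<dots> \<le> (B * norm h * norm (dx k)) * Y
            + (B * norm h * R) * (\<beta> * ((Kbd + norm (err k)) * norm (dx k)))"
          using B_nonneg R_nonneg
          by (intro add_mono order_trans[OF norm_cauchy_schwarz] mult_mono Y norm_yw
              order_trans[OF norm_blinfun] K'_bound R) (auto intro!: mult_nonneg_nonneg)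
        finally show "(adjoint (?J (x (Suc k))) (y (Suc k)) - adjoint (?J (x k)) ?w) \<bullet> h
            \<le> (B * Y * norm (dx k) + B * R * \<beta> * ((Kbd + norm (err k)) * norm (dx k))) * norm h"
          by (simp add: algebra_simps)
      qed
    qed
    finally show ?thesis .
  qed
  moreover have "u \<longlonglongrightarrow> 0"
  proof -
    have "(\<lambda>k. (Kbd + norm (err k)) * norm (dx k)) \<longlonglongrightarrow> (Kbd + 0) * 0"
      by (intro tendsto_intros residuals_vanish[OF E])
    then have "(\<lambda>k. (Kbd + norm (err k)) * norm (dx k)) \<longlonglongrightarrow> 0" by simp
    then show ?thesis
      unfolding u_def
      by (intro tendsto_add_zero tendsto_mult_right_zero residuals_vanish[OF E])
  qed
  ultimately show ?thesis
    by (intro Lim_null_comparison[of "\<lambda>k. norm (stat_err k)" u]) auto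
qed

text \<open>Membership of \<open>stat_err k\<close> makes the set nonempty, hence its distance from
  0 finite and at most the norm of \<open>stat_err k\<close>. Iteration \<open>k\<close> controls
  the residual at index \<open>Suc k\<close>.\<close>

lemma kkt_vanishes:
  assumes "summable (\<lambda>k. (kern_err D th z k)\<^sup>2)"
  shows "(\<lambda>k. kkt_residual D (th k) (x k) (y k)) \<longlonglongrightarrow> 0"
proof -
  have E: "summable (\<lambda>k. (norm (err k))\<^sup>2)" using assms by (simp add: kern_err_eq)
  let ?A = "\<lambda>k. norm (cvec D + adjoint (blinfun_apply (K\<^sub>t (th k))) (y k))"
  let ?F = "\<lambda>k. norm (Fres D (true_rows D) (th k) (x k))"
  have F: "?F \<longlonglongrightarrow> 0" unfolding Fres_def by (rule residuals_vanish(4)[OF E])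
  have A: "?A \<longlonglongrightarrow> 0" by (rule residuals_vanish(5)[OF E])
  define u where "u k = (norm (stat_err k))\<^sup>2 + (?A (Suc k))\<^sup>2 + (?F (Suc k))\<^sup>2" for k
  have "u \<longlonglongrightarrow> 0\<^sup>2 + 0\<^sup>2 + 0\<^sup>2"
    unfolding u_def using LIMSEQ_Suc[OF F] LIMSEQ_Suc[OF A]
    by (intro tendsto_add tendsto_power stat_err_vanishes[OF assms])
  then have u: "(\<lambda>k. ereal (u k)) \<longlonglongrightarrow> 0" by (simp add: zero_ereal_def)
  have bounds: "0 \<le> kkt_residual D (th (Suc k)) (x (Suc k)) (y (Suc k)) \<and>
      kkt_residual D (th (Suc k)) (x (Suc k)) (y (Suc k)) \<le> ereal (u k)" for k
  proof -
    let ?S = "(\<lambda>v. v + adjoint (frechet_derivative (\<lambda>\<theta>'. Fres D (true_rows D) \<theta>' (x (Suc k))) (at (th (Suc k)))) (y (Suc k)))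
                     ` limiting_subdiff (psi D) (th (Suc k))"
    let ?e = "edist_set 0 ?S"
    have "stat_err k \<in> ?S"
      unfolding stat_err_def using optimality_subgradient by blast
    then have "?e \<le> ereal (norm (stat_err k))"
      unfolding edist_set_def by (intro INF_lower2) auto
    moreover have "0 \<le> ?e"
      unfolding edist_set_def by (intro INF_greatest) auto
    ultimately obtain e where e: "?e = ereal e" "0 \<le> e" "e \<le> norm (stat_err k)"
      by (cases ?e) auto
    have "kkt_residual D (th (Suc k)) (x (Suc k)) (y (Suc k)) = ereal (e\<^sup>2 + (?A (Suc k))\<^sup>2 + (?F (Suc k))\<^sup>2)"
      unfolding kkt_residual_def e(1) by simp
    moreover have "e\<^sup>2 \<le> (norm (stat_err k))\<^sup>2" using e by (intro power_mono)
    ultimately show ?thesis by (simp add: u_def)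
  qed
  have "(\<lambda>k. kkt_residual D (th (Suc k)) (x (Suc k)) (y (Suc k))) \<longlonglongrightarrow> 0"
    by (rule tendsto_sandwich[OF _ _ tendsto_const u]) (use bounds in auto)
  then show ?thesis by (rule LIMSEQ_imp_Suc)
qed

end

section \<open>Variance of the block estimator\<close>

lemma finite_UNIV_step [simp]: "finite (UNIV :: ('s::finite, 'a::finite) step set)"
proof -
  have "(UNIV :: ('s, 'a) step set) = range Rst \<union> range (\<lambda>(s, a, s'). Env s a s')"
  proof (intro set_eqI iffI UNIV_I)
    fix u :: "('s, 'a) step"
    show "u \<in> range Rst \<union> range (\<lambda>(s, a, s'). Env s a s')"
      by (cases u) (auto simp: image_iff)
  qed
  then show ?thesis by (metis finite finite_UnI finite_imageI)
qed

lemma finite_set_pmf_step [simp]: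
  fixes p :: "('s::finite, 'a::finite) step pmf"
  shows "finite (set_pmf p)"
  by (rule finite_subset[OF subset_UNIV finite_UNIV_step])

lemma set_traj_pmf: "set_pmf (traj_pmf D \<theta> n s) \<subseteq> {z. length z = n}"
  by (induction n arbitrary: s) (auto simp: subset_eq)

lemma finite_set_traj_pmf [simp]:
  fixes D :: "('s::finite, 'a::finite, 'p) occ_problem"
  shows "finite (set_pmf (traj_pmf D \<theta> n s))"
proof (rule finite_subset[OF set_traj_pmf])
  show "finite {z :: ('s, 'a) step list. length z = n}"
    using finite_lists_length_eq[OF finite_UNIV_step, of n] by simp
qed

lemma expectation_bind_finite:
  fixes h :: "'b \<Rightarrow> real"
  assumes "finite (set_pmf p)" "\<And>u. u \<in> set_pmf p \<Longrightarrow> finite (set_pmf (f u))"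
  shows "measure_pmf.expectation (bind_pmf p f) h =
    measure_pmf.expectation p (\<lambda>u. measure_pmf.expectation (f u) h)"
  using assms by (subst pmf_expectation_bind[of "set_pmf p"]) (auto simp: integral_measure_pmf[of "set_pmf p"])

definition block_pmf :: "('s, 'a, 'p) occ_problem \<Rightarrow> 'p \<Rightarrow> 's \<Rightarrow> (('s, 'a) step \<times> ('s, 'a) step) pmf" where
  "block_pmf D \<theta> s = bind_pmf (step_pmf D \<theta> s) (\<lambda>u. map_pmf (Pair u) (step_pmf D \<theta> (end_state u)))"

lemma finite_set_block_pmf [simp]:
  fixes D :: "('s::finite, 'a::finite, 'p) occ_problem"
  shows "finite (set_pmf (block_pmf D \<theta> s))"
  by (simp add: block_pmf_def)

lemma traj_pmf_block:
  "traj_pmf D \<theta> (Suc (Suc n)) s =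
     bind_pmf (block_pmf D \<theta> s) (\<lambda>(u, v). map_pmf (\<lambda>z. u # v # z) (traj_pmf D \<theta> n (end_state v)))"
  by (simp add: block_pmf_def bind_assoc_pmf map_pmf_def bind_return_pmf)

definition block_sum :: "('u \<Rightarrow> 'u \<Rightarrow> real) \<Rightarrow> 'u list \<Rightarrow> real" where
  "block_sum w z = (\<Sum>j<length z div 2. w (z ! (2 * j)) (z ! (2 * j + 1)))"

text \<open>The second equation records that an unpaired last step belongs to no block.\<close>

lemma block_sum_simps [simp]:
  "block_sum w [] = 0" "block_sum w [u] = 0" "block_sum w (u # v # z) = w u v + block_sum w z"
  by (simp_all add: block_sum_def sum.lessThan_Suc_shift del: sum.lessThan_Suc)

text \<open>Consecutive blocks are linked through the end state, but the mean is 0 from every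
  starting state. Given the first block, the rest of the sum therefore has mean 0, the cross term in
  the square drops out, and the variances add up. The induction removes two steps at a time.\<close>

lemma traj_block_sum_moments:
  fixes D :: "('s::finite, 'a::finite, 'p) occ_problem"
  assumes mean: "\<And>s. measure_pmf.expectation (block_pmf D \<theta> s) (\<lambda>(u, v). w u v) = 0"
    and var: "\<And>s. measure_pmf.expectation (block_pmf D \<theta> s) (\<lambda>(u, v). (w u v)\<^sup>2) \<le> V"
  shows "measure_pmf.expectation (traj_pmf D \<theta> n s) (block_sum w) = 0"
    and "measure_pmf.expectation (traj_pmf D \<theta> n s) (\<lambda>z. (block_sum w z)\<^sup>2) \<le> real (n div 2) * V"
proof -
  note [simp] = integrable_measure_pmf_finite
  have step: "measure_pmf.expectation (traj_pmf D \<theta> (Suc (Suc n)) s) h =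
      measure_pmf.expectation (block_pmf D \<theta> s) (\<lambda>(u, v).
        measure_pmf.expectation (traj_pmf D \<theta> n (end_state v)) (\<lambda>z. h (u # v # z)))" for n s and h :: "_ \<Rightarrow> real"
    unfolding traj_pmf_block case_prod_unfold by (subst expectation_bind_finite) auto
  have "measure_pmf.expectation (traj_pmf D \<theta> n s) (block_sum w) = 0 \<and>
    measure_pmf.expectation (traj_pmf D \<theta> n s) (\<lambda>z. (block_sum w z)\<^sup>2) \<le> real (n div 2) * V"
  proof (induction n arbitrary: s rule: induct_nat_012)
    case 1
    then show ?case by (simp add: expectation_bind_finite map_pmf_def[symmetric])
  next
    case (ge2 n)
    have IH: "measure_pmf.expectation (traj_pmf D \<theta> n s) (block_sum w) = 0"
      "measure_pmf.expectation (traj_pmf D \<theta> n s) (\<lambda>z. (block_sum w z)\<^sup>2) \<le> real (n div 2) * V" for s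
      using ge2(1) by blast+
    have 1: "measure_pmf.expectation (traj_pmf D \<theta> (Suc (Suc n)) s) (block_sum w) = 0"
      unfolding step using mean[of s] by (simp add: IH)
    have "measure_pmf.expectation (traj_pmf D \<theta> (Suc (Suc n)) s) (\<lambda>z. (block_sum w z)\<^sup>2)
        = measure_pmf.expectation (block_pmf D \<theta> s) (\<lambda>(u, v). (w u v)\<^sup>2 +
            measure_pmf.expectation (traj_pmf D \<theta> n (end_state v)) (\<lambda>z. (block_sum w z)\<^sup>2))"
      unfolding step by (simp add: power2_sum IH)
    also have "\<dots> \<le> measure_pmf.expectation (block_pmf D \<theta> s) (\<lambda>(u, v). (w u v)\<^sup>2 + real (n div 2) * V)"
      by (intro integral_mono) (auto simp: IH(2))
    also have "\<dots> = measure_pmf.expectation (block_pmf D \<theta> s) (\<lambda>(u, v). (w u v)\<^sup>2) + real (n div 2) * V"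
      by (simp add: case_prod_unfold)
    also have "\<dots> \<le> real (Suc (Suc n) div 2) * V"
      using var[of s] by (simp add: algebra_simps)
    finally show ?case using 1 by blast
  qed simp
  then show "measure_pmf.expectation (traj_pmf D \<theta> n s) (block_sum w) = 0"
    "measure_pmf.expectation (traj_pmf D \<theta> n s) (\<lambda>z. (block_sum w z)\<^sup>2) \<le> real (n div 2) * V"
    by blast+
qed

lemma expectation_step_pmf:
  fixes D :: "('s::finite, 'a::finite, 'p) occ_problem" and h :: "('s, 'a) step \<Rightarrow> real"
  assumes "0 < disc D" "disc D < 1"
  shows "measure_pmf.expectation (step_pmf D \<theta> s) h =
    (1 - disc D) * (\<Sum>r\<in>UNIV. pmf (init D) r * h (Rst r))
    + disc D * (\<Sum>a\<in>UNIV. pmf (policy D \<theta> s) a * (\<Sum>s'\<in>UNIV. pmf (kern D s a) s' * h (Env s a s')))"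
proof -
  have "measure_pmf.expectation (step_pmf D \<theta> s) h =
      measure_pmf.expectation (map_pmf Rst (init D)) h * (1 - disc D) +
      measure_pmf.expectation (bind_pmf (policy D \<theta> s) (\<lambda>a. map_pmf (Env s a) (kern D s a))) h * disc D"
    unfolding step_pmf_def using assms by (subst expectation_bind_finite) auto
  also have "measure_pmf.expectation (bind_pmf (policy D \<theta> s) (\<lambda>a. map_pmf (Env s a) (kern D s a))) h =
      measure_pmf.expectation (policy D \<theta> s) (\<lambda>a. measure_pmf.expectation (kern D s a) (\<lambda>s'. h (Env s a s')))"
    by (subst expectation_bind_finite) auto
  finally show ?thesis
    by (simp add: integral_measure_pmf[of "UNIV :: 's set"] integral_measure_pmf[of "UNIV :: 'a set"] mult.commute)
qed

lemma expectation_step_pmf_Env: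
  fixes D :: "('s::finite, 'a::finite, 'p) occ_problem"
  assumes "0 < disc D" "disc D < 1"
  shows "measure_pmf.expectation (step_pmf D \<theta> r) (\<lambda>v. if v = Env s a s' then C else 0) =
    (if r = s then disc D * pmf (policy D \<theta> s) a * pmf (kern D s a) s' * C else 0)"
proof -
  have "(\<Sum>a'\<in>UNIV. pmf (policy D \<theta> r) a' * (\<Sum>t\<in>UNIV. pmf (kern D r a') t * (if Env r a' t = Env s a s' then C else 0)))
     = (\<Sum>a'\<in>UNIV. if a' = a then (if r = s then pmf (policy D \<theta> s) a * (pmf (kern D s a) s' * C) else 0) else 0)"
    by (intro sum.cong refl) (auto simp: if_distrib[of "\<lambda>t. _ * t"] cong: if_cong)
  then show ?thesis
    unfolding expectation_step_pmf[OF assms] by simp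
qed

text \<open>The reset in the first step draws the state afresh from \<open>init D\<close>, so the
  right-hand side does not involve the starting state \<open>r\<close>. This is the reason for using
  anchors.\<close>

lemma expectation_block_anchor:
  fixes D :: "('s::finite, 'a::finite, 'p) occ_problem"
  assumes disc: "0 < disc D" "disc D < 1"
  shows "measure_pmf.expectation (block_pmf D \<theta> r) (\<lambda>(u, v). if is_rst u \<and> v = Env s a s' then C else 0) =
    disc D * (1 - disc D) * pmf (init D) s * pmf (policy D \<theta> s) a * pmf (kern D s a) s' * C"
proof -
  have "measure_pmf.expectation (block_pmf D \<theta> r) (\<lambda>(u, v). if is_rst u \<and> v = Env s a s' then C else 0)
    = measure_pmf.expectation (step_pmf D \<theta> r) (\<lambda>u. measure_pmf.expectation (step_pmf D \<theta> (end_state u))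
         (\<lambda>v. if is_rst u \<and> v = Env s a s' then C else 0))"
    unfolding block_pmf_def by (subst expectation_bind_finite) auto
  also have "\<dots> = measure_pmf.expectation (step_pmf D \<theta> r) (\<lambda>u. if is_rst u then
       (if end_state u = s then disc D * pmf (policy D \<theta> s) a * pmf (kern D s a) s' * C else 0) else 0)"
    by (intro Bochner_Integration.integral_cong refl) (simp add: expectation_step_pmf_Env[OF disc, symmetric])
  also have "\<dots> = disc D * (1 - disc D) * pmf (init D) s * pmf (policy D \<theta> s) a * pmf (kern D s a) s' * C"
    unfolding expectation_step_pmf[OF disc] by (simp add: if_distrib[of "\<lambda>t. _ * t"] cong: if_cong)
  finally show ?thesis .
qed

text \<open>The weight of a block is \<open>1 / q\<close> with probability \<open>q * p\<close> and
  0 otherwise: it has mean \<open>p\<close> and second moment \<open>p / q\<close>, hence variance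
  at most \<open>1 / q\<close>, which the lower bounds on reset and policy probabilities make
  uniform.\<close>

lemma raw_rows_second_moment:
  fixes D :: "('s::finite, 'a::finite, 'p) occ_problem"
  assumes disc: "0 < disc D" "disc D < 1"
    and \<rho>: "0 < \<rho>min" "\<And>s. \<rho>min \<le> pmf (init D) s"
    and \<pi>: "0 < \<pi>min" "\<And>s a. \<pi>min \<le> pmf (policy D \<theta> s) a" and n: "2 \<le> n"
  shows "measure_pmf.expectation (traj_pmf D \<theta> n r)
      (\<lambda>z. (raw_rows D \<theta> z s a $ s' - pmf (kern D s a) s')\<^sup>2)
    \<le> 1 / (disc D * (1 - disc D) * \<rho>min * \<pi>min) / real (n div 2)"
proof -
  define p where "p = pmf (kern D s a) s'"
  define q where "q = disc D * (1 - disc D) * pmf (init D) s * pmf (policy D \<theta> s) a"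
  define V where "V = 1 / (disc D * (1 - disc D) * \<rho>min * \<pi>min)"
  have pos: "0 < pmf (init D) s" "0 < pmf (policy D \<theta> s) a"
    using \<rho> \<pi> less_le_trans by blast+
  have q_pos: "0 < q" unfolding q_def using disc pos by simp
  have V: "1 / q \<le> V"
    unfolding V_def q_def using disc pos \<rho> \<pi>
    by (intro divide_left_mono mult_mono mult_left_mono mult_pos_pos) auto
  have p: "0 \<le> p" "p \<le> 1" by (simp_all add: p_def pmf_le_1)
  let ?A = "\<lambda>u v. anchor_weight D \<theta> u v s a s'"
  define w where "w u v = ?A u v - p" for u v
  have A: "?A u v = (if is_rst u \<and> v = Env s a s' then 1 / q else 0)"
    "(?A u v)\<^sup>2 = (if is_rst u \<and> v = Env s a s' then (1 / q)\<^sup>2 else 0)" for u v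
    by (simp_all add: anchor_weight_def q_def)
  note [simp] = integrable_measure_pmf_finite
  have E1: "measure_pmf.expectation (block_pmf D \<theta> r) (\<lambda>(u, v). ?A u v) = p" for r
    unfolding A expectation_block_anchor[OF disc] using q_pos by (simp add: q_def[symmetric] p_def[symmetric])
  have E2: "measure_pmf.expectation (block_pmf D \<theta> r) (\<lambda>(u, v). (?A u v)\<^sup>2) = p / q" for r
    unfolding A(2) expectation_block_anchor[OF disc] q_def[symmetric] p_def[symmetric] using q_pos
    by (simp add: power2_eq_square)
  have mean: "measure_pmf.expectation (block_pmf D \<theta> r) (\<lambda>(u, v). w u v) = 0" for r
    using E1[of r] by (simp add: w_def case_prod_unfold)
  have var: "measure_pmf.expectation (block_pmf D \<theta> r) (\<lambda>(u, v). (w u v)\<^sup>2) \<le> V" for r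
  proof -
    have "measure_pmf.expectation (block_pmf D \<theta> r) (\<lambda>(u, v). (w u v)\<^sup>2) = p / q - 2 * p * p + p\<^sup>2"
      using E1[of r] E2[of r] by (simp add: w_def case_prod_unfold power2_diff mult.assoc)
    also have "\<dots> \<le> p / q" using p by (simp add: power2_eq_square)
    also have "\<dots> \<le> 1 / q" using p q_pos by (intro divide_right_mono) auto
    finally show ?thesis using V by simp
  qed
  let ?L = "real (n div 2)"
  have L: "0 < ?L" using n by simp
  have raw: "raw_rows D \<theta> z s a $ s' - p = block_sum w z / ?L" if "length z = n" for z
    using L by (simp add: raw_rows_def block_sum_def w_def that sum_subtractf diff_divide_distrib)
  have "measure_pmf.expectation (traj_pmf D \<theta> n r) (\<lambda>z. (raw_rows D \<theta> z s a $ s' - p)\<^sup>2)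
      = measure_pmf.expectation (traj_pmf D \<theta> n r) (\<lambda>z. (block_sum w z)\<^sup>2 / ?L\<^sup>2)"
    using set_traj_pmf[of D \<theta> n r]
    by (intro integral_cong_AE) (auto simp: AE_measure_pmf_iff raw power_divide subset_eq)
  also have "\<dots> = measure_pmf.expectation (traj_pmf D \<theta> n r) (\<lambda>z. (block_sum w z)\<^sup>2) / ?L\<^sup>2"
    by simp
  also have "\<dots> \<le> ?L * V / ?L\<^sup>2"
    by (intro divide_right_mono traj_block_sum_moments(2)[OF mean var]) auto
  also have "\<dots> = V / ?L" using L by (simp add: power2_eq_square)
  finally show ?thesis by (simp add: V_def p_def)
qed

section \<open>From conditional second moments to almost sure summability of the errors\<close>

text \<open>By monotone convergence the series has a finite expectation, so it is finite almost
  surely.\<close>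

lemma (in prob_space) AE_summable_of_expectation_bound:
  fixes e :: "nat \<Rightarrow> 'a \<Rightarrow> real"
  assumes int: "\<And>k. integrable M (e k)" and nonneg: "\<And>k \<omega>. \<omega> \<in> space M \<Longrightarrow> 0 \<le> e k \<omega>"
    and le: "\<And>k. expectation (e k) \<le> C k" and C: "summable C"
  shows "AE \<omega> in M. summable (\<lambda>k. e k \<omega>)"
proof -
  have e: "expectation (e k) \<ge> 0" for k
    using nonneg by (intro integral_nonneg_AE) auto
  have [measurable]: "e k \<in> borel_measurable M" for k
    using int by auto
  have "(\<integral>\<^sup>+\<omega>. (\<Sum>k. ennreal (e k \<omega>)) \<partial>M) = (\<Sum>k. \<integral>\<^sup>+\<omega>. ennreal (e k \<omega>) \<partial>M)"
    by (rule nn_integral_suminf) simp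
  also have "\<dots> = (\<Sum>k. ennreal (expectation (e k)))"
    using nonneg by (intro suminf_cong nn_integral_eq_integral int) auto
  also have "\<dots> = ennreal (\<Sum>k. expectation (e k))"
    using e le by (intro suminf_ennreal2 summable_comparison_test'[OF C]) auto
  finally have "(\<integral>\<^sup>+\<omega>. (\<Sum>k. ennreal (e k \<omega>)) \<partial>M) \<noteq> \<infinity>" by simp
  then have "AE \<omega> in M. (\<Sum>k. ennreal (e k \<omega>)) \<noteq> \<infinity>"
    by (intro nn_integral_PInf_AE) auto
  then show ?thesis
  proof (rule AE_mp, intro AE_I2 impI)
    fix \<omega> assume "\<omega> \<in> space M" "(\<Sum>k. ennreal (e k \<omega>)) \<noteq> \<infinity>"
    then show "summable (\<lambda>k. e k \<omega>)"
      using nonneg by (intro summable_suminf_not_top) auto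
  qed
qed

text \<open>The integrand depends on the outcome through \<open>Z\<close> and also through the
  history \<open>F\<close>. Splitting over the finitely many values of \<open>Z\<close> gives
  products of an \<open>F\<close>-measurable factor with an indicator, and the tower property
  replaces the indicator by its conditional probability. Finiteness of \<open>S\<close> also joins
  the exceptional null sets into one.\<close>

lemma (in prob_space) expectation_of_conditional_pmf:
  fixes Z :: "'a \<Rightarrow> 'z" and g :: "'z \<Rightarrow> 'a \<Rightarrow> real" and p :: "'a \<Rightarrow> 'z pmf"
  assumes sub: "subalgebra M F" and fin: "finite S"
    and Z: "Z \<in> measurable M (count_space UNIV)" "\<And>\<omega>. \<omega> \<in> space M \<Longrightarrow> Z \<omega> \<in> S"
    and cond: "\<And>\<zeta>. AE \<omega> in M. real_cond_exp M F (indicator {\<omega> \<in> space M. Z \<omega> = \<zeta>}) \<omega> = pmf (p \<omega>) \<zeta>"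
    and g: "\<And>\<zeta>. g \<zeta> \<in> borel_measurable F" "\<And>\<zeta> \<omega>. \<omega> \<in> space M \<Longrightarrow> \<zeta> \<in> S \<Longrightarrow> \<bar>g \<zeta> \<omega>\<bar> \<le> B"
    and supp: "\<And>\<omega>. set_pmf (p \<omega>) \<subseteq> S"
    and le: "\<And>\<omega>. \<omega> \<in> space M \<Longrightarrow> measure_pmf.expectation (p \<omega>) (\<lambda>\<zeta>. g \<zeta> \<omega>) \<le> C"
  shows "integrable M (\<lambda>\<omega>. g (Z \<omega>) \<omega>)" and "expectation (\<lambda>\<omega>. g (Z \<omega>) \<omega>) \<le> C"
proof -
  interpret F: finite_measure_subalgebra M F
    by unfold_locales (rule sub)
  let ?I = "\<lambda>\<zeta>. indicator {\<omega> \<in> space M. Z \<omega> = \<zeta>} :: 'a \<Rightarrow> real"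
  have [measurable]: "{\<omega> \<in> space M. Z \<omega> = \<zeta>} \<in> sets M" for \<zeta>
  proof -
    have "{\<omega> \<in> space M. Z \<omega> = \<zeta>} = Z -` {\<zeta>} \<inter> space M" by auto
    then show ?thesis using measurable_sets[OF Z(1), of "{\<zeta>}"] by simp
  qed
  have [measurable]: "g \<zeta> \<in> borel_measurable M" for \<zeta>
    by (rule measurable_from_subalg[OF sub g(1)])
  have int: "integrable M (\<lambda>\<omega>. g \<zeta> \<omega> * ?I \<zeta> \<omega>)" if "\<zeta> \<in> S" for \<zeta>
    using g(2) that
    by (intro integrable_const_bound[where B = B] AE_I2) (force simp: abs_mult split: split_indicator)+
  have eq: "g (Z \<omega>) \<omega> = (\<Sum>\<zeta>\<in>S. g \<zeta> \<omega> * ?I \<zeta> \<omega>)" if "\<omega> \<in> space M" for \<omega>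
  proof -
    have "(\<Sum>\<zeta>\<in>S. g \<zeta> \<omega> * ?I \<zeta> \<omega>) = (\<Sum>\<zeta>\<in>S. if \<zeta> = Z \<omega> then g \<zeta> \<omega> else 0)"
      using that by (intro sum.cong) auto
    then show ?thesis using fin Z(2)[OF that] by simp
  qed
  have int_sum: "integrable M (\<lambda>\<omega>. \<Sum>\<zeta>\<in>S. g \<zeta> \<omega> * ?I \<zeta> \<omega>)"
    by (intro Bochner_Integration.integrable_sum int)
  then show "integrable M (\<lambda>\<omega>. g (Z \<omega>) \<omega>)"
    using eq by (subst Bochner_Integration.integrable_cong[OF refl]) auto
  note ce = F.real_cond_exp_intg[OF int g(1)]
  have "expectation (\<lambda>\<omega>. g (Z \<omega>) \<omega>) = expectation (\<lambda>\<omega>. \<Sum>\<zeta>\<in>S. g \<zeta> \<omega> * ?I \<zeta> \<omega>)"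
    by (rule Bochner_Integration.integral_cong) (auto simp: eq)
  also have "\<dots> = (\<Sum>\<zeta>\<in>S. expectation (\<lambda>\<omega>. g \<zeta> \<omega> * ?I \<zeta> \<omega>))"
    by (intro Bochner_Integration.integral_sum int)
  also have "\<dots> = (\<Sum>\<zeta>\<in>S. expectation (\<lambda>\<omega>. g \<zeta> \<omega> * real_cond_exp M F (?I \<zeta>) \<omega>))"
    by (intro sum.cong refl ce(2)[symmetric]) auto
  also have "\<dots> = expectation (\<lambda>\<omega>. \<Sum>\<zeta>\<in>S. g \<zeta> \<omega> * real_cond_exp M F (?I \<zeta>) \<omega>)"
    by (intro Bochner_Integration.integral_sum[symmetric] ce(1)) auto
  also have "\<dots> \<le> expectation (\<lambda>\<omega>. C)"
  proof (rule integral_mono_AE)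
    show "integrable M (\<lambda>\<omega>. \<Sum>\<zeta>\<in>S. g \<zeta> \<omega> * real_cond_exp M F (?I \<zeta>) \<omega>)"
      by (intro Bochner_Integration.integrable_sum ce(1)) auto
    have "AE \<omega> in M. \<forall>\<zeta>\<in>S. real_cond_exp M F (?I \<zeta>) \<omega> = pmf (p \<omega>) \<zeta>"
      using fin cond by (intro AE_finite_allI) auto
    then show "AE \<omega> in M. (\<Sum>\<zeta>\<in>S. g \<zeta> \<omega> * real_cond_exp M F (?I \<zeta>) \<omega>) \<le> C"
    proof (rule AE_mp, intro AE_I2 impI)
      fix \<omega> assume \<omega>: "\<omega> \<in> space M" and "\<forall>\<zeta>\<in>S. real_cond_exp M F (?I \<zeta>) \<omega> = pmf (p \<omega>) \<zeta>"
      then have "(\<Sum>\<zeta>\<in>S. g \<zeta> \<omega> * real_cond_exp M F (?I \<zeta>) \<omega>) = (\<Sum>\<zeta>\<in>S. g \<zeta> \<omega> * pmf (p \<omega>) \<zeta>)"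
        by (intro sum.cong) auto
      also have "\<dots> = measure_pmf.expectation (p \<omega>) (\<lambda>\<zeta>. g \<zeta> \<omega>)"
        using fin supp by (intro integral_measure_pmf_real[symmetric]) auto
      finally show "(\<Sum>\<zeta>\<in>S. g \<zeta> \<omega> * real_cond_exp M F (?I \<zeta>) \<omega>) \<le> C"
        using le[OF \<omega>] by simp
    qed
  qed simp
  finally show "expectation (\<lambda>\<omega>. g (Z \<omega>) \<omega>) \<le> C" by (simp add: prob_space)
qed

text \<open>The error before projection onto the simplex: its moments are explicit, and projecting
  can only bring a row closer to the true one.\<close>

definition raw_sq_err :: "('s::finite, 'a::finite, 'p) occ_problem \<Rightarrow> 'p \<Rightarrow> ('s, 'a) step list \<Rightarrow> real" where
  "raw_sq_err D \<theta> \<zeta> = (\<Sum>i\<in>UNIV. \<Sum>s'\<in>UNIV.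
     (raw_rows D \<theta> \<zeta> (fst i) (snd i) $ s' - pmf (kern D (fst i) (snd i)) s')\<^sup>2)"

text \<open>A crude bound that serves integrability: every raw entry is an average of weights
  between 0 and \<open>V\<close>.\<close>

lemma raw_sq_err_bounded:
  fixes D :: "('s::finite, 'a::finite, 'p) occ_problem"
  assumes disc: "0 < disc D" "disc D < 1"
    and \<rho>: "0 < \<rho>min" "\<And>s. \<rho>min \<le> pmf (init D) s"
    and \<pi>: "0 < \<pi>min" "\<And>s a. \<pi>min \<le> pmf (policy D \<theta> s) a"
  shows "raw_sq_err D \<theta> \<zeta> \<le>
    real CARD('s \<times> 'a) * (real CARD('s) * (1 / (disc D * (1 - disc D) * \<rho>min * \<pi>min) + 1)\<^sup>2)"
proof -
  define V where "V = 1 / (disc D * (1 - disc D) * \<rho>min * \<pi>min)"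
  have V_nonneg: "0 \<le> V" using disc \<rho> \<pi> by (simp add: V_def)
  have w: "0 \<le> anchor_weight D \<theta> u v s a s'" "anchor_weight D \<theta> u v s a s' \<le> V" for u v s a s'
  proof -
    have pos: "0 < pmf (init D) s" "0 < pmf (policy D \<theta> s) a"
      using \<rho> \<pi> less_le_trans by blast+
    show "0 \<le> anchor_weight D \<theta> u v s a s'" using disc by (simp add: anchor_weight_def)
    have "1 / (disc D * (1 - disc D) * pmf (init D) s * pmf (policy D \<theta> s) a) \<le> V"
      unfolding V_def using disc pos \<rho> \<pi>
      by (intro divide_left_mono mult_mono mult_left_mono mult_pos_pos) auto
    then show "anchor_weight D \<theta> u v s a s' \<le> V" using V_nonneg by (simp add: anchor_weight_def)
  qed
  have raw: "0 \<le> raw_rows D \<theta> \<zeta> s a $ s'" "raw_rows D \<theta> \<zeta> s a $ s' \<le> V" for s a s'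
  proof -
    let ?n = "length \<zeta> div 2"
    let ?S = "\<Sum>j<?n. anchor_weight D \<theta> (\<zeta> ! (2 * j)) (\<zeta> ! (2 * j + 1)) s a s'"
    show "0 \<le> raw_rows D \<theta> \<zeta> s a $ s'" by (simp add: raw_rows_def sum_nonneg w(1))
    have "?S \<le> real ?n * V"
      using sum_bounded_above[of "{..<?n}" "\<lambda>j. anchor_weight D \<theta> (\<zeta> ! (2 * j)) (\<zeta> ! (2 * j + 1)) s a s'" V] w(2)
      by simp
    \<comment> \<open>For a trajectory without blocks the average is 0, by the convention for
      division by 0.\<close>
    then have "?S / real ?n \<le> V"
      using V_nonneg by (cases "?n = 0") (simp_all add: pos_divide_le_eq mult.commute)
    then show "raw_rows D \<theta> \<zeta> s a $ s' \<le> V" by (simp add: raw_rows_def)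
  qed
  have "(raw_rows D \<theta> \<zeta> s a $ s' - pmf (kern D s a) s')\<^sup>2 \<le> (V + 1)\<^sup>2" for s a s'
  proof -
    have "\<bar>raw_rows D \<theta> \<zeta> s a $ s' - pmf (kern D s a) s'\<bar> \<le> V + 1"
      using raw[of s a s'] pmf_nonneg[of "kern D s a" s'] pmf_le_1[of "kern D s a" s'] by linarith
    then show ?thesis using V_nonneg by (simp add: abs_le_square_iff[symmetric])
  qed
  then have "raw_sq_err D \<theta> \<zeta> \<le> (\<Sum>i::'s \<times> 'a\<in>UNIV. \<Sum>s'::'s\<in>UNIV. (V + 1)\<^sup>2)"
    unfolding raw_sq_err_def by (intro sum_mono)
  then show ?thesis by (simp add: V_def)
qed

lemma expectation_raw_sq_err:
  fixes D :: "('s::finite, 'a::finite, 'p) occ_problem"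
  assumes disc: "0 < disc D" "disc D < 1"
    and \<rho>: "0 < \<rho>min" "\<And>s. \<rho>min \<le> pmf (init D) s"
    and \<pi>: "0 < \<pi>min" "\<And>s a. \<pi>min \<le> pmf (policy D \<theta> s) a" and n: "2 \<le> n"
  shows "measure_pmf.expectation (traj_pmf D \<theta> n r) (raw_sq_err D \<theta>)
    \<le> real CARD('s \<times> 'a) * real CARD('s) * 3 / (disc D * (1 - disc D) * \<rho>min * \<pi>min) * (1 / real n)"
proof -
  let ?V = "1 / (disc D * (1 - disc D) * \<rho>min * \<pi>min)"
  note [simp] = integrable_measure_pmf_finite
  have "measure_pmf.expectation (traj_pmf D \<theta> n r) (raw_sq_err D \<theta>)
     = (\<Sum>i\<in>UNIV. \<Sum>s'\<in>UNIV. measure_pmf.expectation (traj_pmf D \<theta> n r)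
         (\<lambda>\<zeta>. (raw_rows D \<theta> \<zeta> (fst i) (snd i) $ s' - pmf (kern D (fst i) (snd i)) s')\<^sup>2))"
    unfolding raw_sq_err_def by (simp add: Bochner_Integration.integral_sum)
  also have "\<dots> \<le> (\<Sum>i::'s \<times> 'a\<in>UNIV. \<Sum>s'::'s\<in>UNIV. ?V / real (n div 2))"
    by (intro sum_mono raw_rows_second_moment disc \<rho> \<pi> n)
  also have "\<dots> = real CARD('s \<times> 'a) * real CARD('s) * ?V * (1 / real (n div 2))"
    by simp
  also have "\<dots> \<le> real CARD('s \<times> 'a) * real CARD('s) * ?V * (3 * (1 / real n))"
  proof (intro mult_left_mono mult_nonneg_nonneg)
    \<comment> \<open>The factor 3 accounts for rounding to whole blocks; equality holds for
      \<open>n = 3\<close>.\<close>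
    have "n \<le> 3 * (n div 2)" using n by linarith
    then have "real n \<le> 3 * real (n div 2)" by linarith
    then show "1 / real (n div 2) \<le> 3 * (1 / real n)" using n by (simp add: field_simps)
  qed (use disc \<rho> \<pi> in auto)
  finally show ?thesis by (simp add: mult_ac)
qed

text \<open>The policy map is regular on \<open>U\<close> only, so measurability is obtained through
  the subspace \<open>U\<close>, in which the parameter takes its values.\<close>

lemma borel_measurable_policy:
  assumes th: "th \<in> borel_measurable F" "\<And>\<omega>. \<omega> \<in> space F \<Longrightarrow> th \<omega> \<in> U"
    and smooth: "cont_diff_on U (\<lambda>\<theta>. pmf (policy D \<theta> s) a)"
  shows "(\<lambda>\<omega>. pmf (policy D (th \<omega>) s) a) \<in> borel_measurable F"
proof -
  have "continuous_on U (\<lambda>\<theta>. pmf (policy D \<theta> s) a)"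
    using smooth unfolding cont_diff_on_def gderiv_def
    by (meson continuous_at_imp_continuous_on has_derivative_continuous)
  then have "(\<lambda>\<theta>. pmf (policy D \<theta> s) a) \<in> borel_measurable (restrict_space borel U)"
    by (rule borel_measurable_continuous_on_restrict)
  moreover have "th \<in> measurable F (restrict_space borel U)"
    using th by (intro measurable_restrict_space2) auto
  ultimately show ?thesis using measurable_compose by blast
qed

lemma borel_measurable_raw_sq_err:
  fixes D :: "('s::finite, 'a::finite, 'p::euclidean_space) occ_problem"
  assumes th: "th \<in> borel_measurable F" "\<And>\<omega>. \<omega> \<in> space F \<Longrightarrow> th \<omega> \<in> U"
    and smooth: "\<And>s a. cont_diff_on U (\<lambda>\<theta>. pmf (policy D \<theta> s) a)"
  shows "(\<lambda>\<omega>. raw_sq_err D (th \<omega>) \<zeta>) \<in> borel_measurable F"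
proof -
  have [measurable]: "(\<lambda>\<omega>. pmf (policy D (th \<omega>) s) a) \<in> borel_measurable F" for s a
    by (rule borel_measurable_policy[OF th smooth])
  have [measurable]: "(\<lambda>\<omega>. anchor_weight D (th \<omega>) u v s a s') \<in> borel_measurable F" for u v s a s'
    unfolding anchor_weight_def by (cases "is_rst u \<and> v = Env s a s'") simp_all
  show ?thesis
    unfolding raw_sq_err_def raw_rows_def by simp
qed

lemma norm_vec_square: "(norm v)\<^sup>2 = (\<Sum>i\<in>UNIV. (v $ i)\<^sup>2)" for v :: "real ^ 'n::finite"
  unfolding power2_norm_eq_inner inner_vec_def by (simp add: power2_eq_square)

context occ_admm_run
begin

text \<open>Projection onto the simplex is nonexpansive and fixes the true row, so it does not
  increase the error. The number of rows enters through Cauchy-Schwarz for the sum of the row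
  errors.\<close>

lemma kern_err_square_le: "(kern_err D th z k)\<^sup>2 \<le> real CARD('s \<times> 'a) * raw_sq_err D (th k) (z k)"
proof -
  let ?\<delta> = "\<lambda>i. P\<^sub>h k (fst i) (snd i) - true_rows D (fst i) (snd i)"
  have row: "(norm (?\<delta> i))\<^sup>2
      \<le> (\<Sum>s'\<in>UNIV. (raw_rows D (th k) (z k) (fst i) (snd i) $ s' - pmf (kern D (fst i) (snd i)) s')\<^sup>2)" for i
  proof -
    have "norm (?\<delta> i) \<le> norm (raw_rows D (th k) (z k) (fst i) (snd i) - true_rows D (fst i) (snd i))"
      using closest_point_lipschitz[OF convex_prob_simplex closed_prob_simplex prob_simplex_nonempty,
          of "raw_rows D (th k) (z k) (fst i) (snd i)" "true_rows D (fst i) (snd i)"]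
      by (simp add: P_hat_def est_rows_def closest_point_self[OF true_rows_in_simplex] dist_norm)
    then have "(norm (?\<delta> i))\<^sup>2 \<le> (norm (raw_rows D (th k) (z k) (fst i) (snd i) - true_rows D (fst i) (snd i)))\<^sup>2"
      by (intro power_mono) auto
    then show ?thesis by (simp add: norm_vec_square true_rows_def)
  qed
  have "(kern_err D th z k)\<^sup>2 \<le> (\<Sum>i\<in>UNIV. norm (?\<delta> i))\<^sup>2"
    unfolding kern_err_eq err_def using disc by (intro power_mono norm_Kop_diff_le) auto
  also have "\<dots> \<le> (\<Sum>i\<in>UNIV. (norm (?\<delta> i))\<^sup>2) * real CARD('s \<times> 'a)"
    using sum_squared_le_sum_of_squares[of "\<lambda>i. norm (?\<delta> i)" UNIV] by simp
  also have "\<dots> \<le> raw_sq_err D (th k) (z k) * real CARD('s \<times> 'a)"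
    unfolding raw_sq_err_def by (intro mult_right_mono sum_mono row) auto
  finally show ?thesis by (simp add: mult.commute)
qed

end

theorem theoremH11:
  fixes D :: "('s::finite, 'a::finite, 'p::euclidean_space) occ_problem"
    and M :: "'w measure" and \<F> :: "nat \<Rightarrow> 'w measure"
    and U :: "'p set"
    and th :: "'w \<Rightarrow> nat \<Rightarrow> 'p"
    and x :: "'w \<Rightarrow> nat \<Rightarrow> ('s, 'a) primal"
    and y :: "'w \<Rightarrow> nat \<Rightarrow> ('s, 'a) dual"
    and z :: "'w \<Rightarrow> nat \<Rightarrow> ('s, 'a) step list"
    and s0 :: "'w \<Rightarrow> nat \<Rightarrow> 's"
    and m :: "nat \<Rightarrow> nat"
    and \<eta>\<theta> :: "'w \<Rightarrow> nat \<Rightarrow> real"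
    and \<theta>0 :: 'p and x0 :: "('s, 'a) primal" and y0 :: "('s, 'a) dual"
    and \<beta> \<eta>x \<tau> \<eta>min Lbar LK \<kappa> A\<^sub>C a\<^sub>\<theta> \<rho>min \<pi>min Binf :: real
  (* problem *)
  assumes "0 < disc D" "disc D < 1"
    and "closed (feasible D)" "convex (feasible D)"
    and "open U" "feasible D \<subseteq> U"
    and "\<And>s a. cont_diff_on U (\<lambda>\<theta>. pmf (policy D \<theta> s) a)"
    and "proper_fun (psi D)" "lsc_fun (psi D)" "\<exists>c. \<forall>\<theta>. ereal c \<le> psi D \<theta>"
    and "ereal Binf = (INF \<theta>\<in>feasible D. reduced_obj D \<theta>)"
  (* sampling *)
    and "prob_space M" "filtration (space M) \<F>" "\<And>k. subalgebra M (\<F> k)"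
    and "\<And>k. (\<lambda>\<omega>. th \<omega> k) \<in> borel_measurable (\<F> k)"
    and "\<And>k. (\<lambda>\<omega>. s0 \<omega> k) \<in> measurable (\<F> k) (count_space UNIV)"
    and "\<And>k. (\<lambda>\<omega>. z \<omega> k) \<in> measurable (\<F> (Suc k)) (count_space UNIV)"
    and "\<And>k \<omega>. \<omega> \<in> space M \<Longrightarrow> length (z \<omega> k) = m k"
    and "\<And>k zs. AE \<omega> in M. real_cond_exp M (\<F> k) (indicator {\<omega> \<in> space M. z \<omega> k = zs}) \<omega>
                   = pmf (traj_pmf D (th \<omega> k) (m k) (s0 \<omega> k)) zs"
    and "\<And>k. 2 \<le> m k"
    and "0 < \<rho>min" "\<And>s. \<rho>min \<le> pmf (init D) s"
    and "0 < \<pi>min" "\<And>\<omega> k s a. \<omega> \<in> space M \<Longrightarrow> \<pi>min \<le> pmf (policy D (th \<omega> k) s) a"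
  (* algorithm *)
    and "\<theta>0 \<in> {\<theta>. psi D \<theta> < \<infinity>}"
    and "\<And>\<omega>. \<omega> \<in> space M \<Longrightarrow> th \<omega> 0 = \<theta>0 \<and> x \<omega> 0 = x0 \<and> y \<omega> 0 = y0"
    and "\<And>\<omega>. \<omega> \<in> space M \<Longrightarrow> admm_run D \<beta> \<eta>x (\<eta>\<theta> \<omega>) (th \<omega>) (x \<omega>) (y \<omega>) (z \<omega>)"
  (* regularity *)
    and "\<And>\<theta>. \<theta> \<in> feasible D \<Longrightarrow> onorm (inv (blinfun_apply (Kop D (true_rows D) \<theta>))) \<le> \<kappa>"
    and "\<And>\<omega> k \<theta>. \<omega> \<in> space M \<Longrightarrow> \<theta> \<in> feasible D \<Longrightarrow>
           onorm (inv (blinfun_apply (Kop D (P_hat D (th \<omega>) (z \<omega>) k) \<theta>))) \<le> \<kappa>"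
    and "\<And>\<theta> \<theta>'. \<theta> \<in> feasible D \<Longrightarrow> \<theta>' \<in> feasible D \<Longrightarrow>
           norm (Kop D (true_rows D) \<theta> - Kop D (true_rows D) \<theta>') \<le> LK * norm (\<theta> - \<theta>')"
    and "\<exists>B. \<forall>\<theta>\<in>feasible D. onorm (frechet_derivative (Kop D (true_rows D)) (at \<theta>)) \<le> B"
    and "\<And>\<omega> k. \<omega> \<in> space M \<Longrightarrow> Lbar-lipschitz_on (closed_segment (th \<omega> k) (th \<omega> (Suc k)))
           (grad (aug D \<beta> (true_rows D) (x \<omega> k) (y \<omega> k)))"
    and "\<And>\<omega> k. \<omega> \<in> space M \<Longrightarrow> Lbar-lipschitz_on (closed_segment (th \<omega> k) (th \<omega> (Suc k)))
           (grad (aug D \<beta> (P_hat D (th \<omega>) (z \<omega>) k) (x \<omega> k) (y \<omega> k)))"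
  (* parameters *)
    and "0 < \<eta>x" "\<beta> > 36 * \<kappa>\<^sup>2 / \<eta>x" "\<tau> = 1 / (8 * \<eta>x)"
    and "0 < \<eta>min" "\<And>\<omega> k. \<omega> \<in> space M \<Longrightarrow> \<eta>min \<le> \<eta>\<theta> \<omega> k"
    and "A\<^sub>C = 9 * \<kappa> ^ 4 * LK\<^sup>2 * (norm (cvec D))\<^sup>2"
    and "0 < a\<^sub>\<theta>"
    and "\<And>\<omega> k. \<omega> \<in> space M \<Longrightarrow> a\<^sub>\<theta> \<le> 1 / (2 * \<eta>\<theta> \<omega> k) - Lbar / 2 - 3 * A\<^sub>C / (2 * \<beta>)"
    and "summable (\<lambda>k. 1 / real (m k))"
  shows "(\<exists>C0. \<exists>qx>0. \<forall>\<omega>\<in>space M. Phi_lower_bound D \<beta> \<tau> Binf C0 qx (th \<omega>) (x \<omega>) (y \<omega>) (z \<omega>)) \<and>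
    (\<forall>C0. (\<exists>qx>0. \<forall>\<omega>\<in>space M. Phi_lower_bound D \<beta> \<tau> Binf C0 qx (th \<omega>) (x \<omega>) (y \<omega>) (z \<omega>)) \<longrightarrow>
      (AE \<omega> in M.
        (\<exists>l::real. (\<lambda>k. Psi D \<beta> \<tau> Binf C0 (th \<omega>) (x \<omega>) (y \<omega>) (z \<omega>) k) \<longlonglongrightarrow> ereal l) \<and>
        summable (\<lambda>k. (norm (incr (th \<omega>) (Suc k)))\<^sup>2 + (norm (incr (x \<omega>) (Suc k)))\<^sup>2
                      + (norm (incr (x \<omega>) k))\<^sup>2) \<and>
        (\<lambda>k. kern_err D (th \<omega>) (z \<omega>) k) \<longlonglongrightarrow> 0 \<and>
        (\<lambda>k. kkt_residual D (th \<omega> k) (x \<omega> k) (y \<omega> k)) \<longlonglongrightarrow> 0))"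
proof -
  note disc = assms(1,2)
  interpret prob_space M by (rule assms(12))
  have run: "occ_admm_run D U (th \<omega>) (x \<omega>) (y \<omega>) (z \<omega>) (\<eta>\<theta> \<omega>) \<beta> \<eta>x \<eta>min Lbar LK \<kappa> A\<^sub>C a\<^sub>\<theta> Binf"
    if "\<omega> \<in> space M" for \<omega>
  proof (rule occ_admm_run.intro)
    show "psi D (th \<omega> 0) < \<infinity>" using assms(25) assms(26)[OF that] by simp
  qed (fact assms(1,2,4,6,7,8,11,28,30,31,34,35,37,39,40) assms(27)[OF that] assms(29)[OF that]
      assms(33)[OF that] assms(38)[OF that] assms(41)[OF that])+
  have \<tau>: "\<tau> = 1 / (8 * \<eta>x)" by (rule assms(36))
  have "\<exists>C0. \<exists>qx>0. \<forall>\<omega>\<in>space M. Phi_lower_bound D \<beta> \<tau> Binf C0 qx (th \<omega>) (x \<omega>) (y \<omega>) (z \<omega>)"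
  proof (intro exI conjI ballI)
    \<comment> \<open>The constants are those of \<open>potential_lower_bound\<close>: the weight of
      the increment in the potential, less the share spent on the residual.\<close>
    show "1 / (8 * \<eta>x) - 1 / (18 * \<eta>x) > 0" using assms(34) by (simp add: field_simps)
    show "Phi_lower_bound D \<beta> \<tau> Binf (2 * \<kappa> ^ 4 * (norm (cvec D))\<^sup>2 / \<beta>) (1 / (8 * \<eta>x) - 1 / (18 * \<eta>x))
        (th \<omega>) (x \<omega>) (y \<omega>) (z \<omega>)" if "\<omega> \<in> space M" for \<omega>
      unfolding \<tau> by (rule occ_admm_run.Phi_lower[OF run[OF that]])
  qed
  moreover have "AE \<omega> in M. summable (\<lambda>k. (kern_err D (th \<omega>) (z \<omega>) k)\<^sup>2)"
  proof -
    let ?e = "\<lambda>k \<omega>. raw_sq_err D (th \<omega> k) (z \<omega> k)"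
    let ?C = "real CARD('s \<times> 'a) * real CARD('s) * 3 / (disc D * (1 - disc D) * \<rho>min * \<pi>min)"
    let ?S = "\<lambda>k. {\<zeta> :: ('s, 'a) step list. length \<zeta> = m k}"
    have feasible: "th \<omega> k \<in> U" if "\<omega> \<in> space M" for \<omega> k
      using occ_admm_run.th_U[OF run[OF that]] .
    have nonneg: "0 \<le> raw_sq_err D \<theta> \<zeta>" for \<theta> \<zeta>
      by (simp add: raw_sq_err_def sum_nonneg)
    have e: "integrable M (?e k) \<and> expectation (?e k) \<le> ?C * (1 / real (m k))" for k
    proof -
      have fin: "finite (?S k)"
        using finite_lists_length_eq[OF finite_UNIV_step, of "m k"] by simp
      have z: "(\<lambda>\<omega>. z \<omega> k) \<in> measurable M (count_space UNIV)"
        by (rule measurable_from_subalg[OF assms(14)[of "Suc k"] assms(17)])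
      have meas: "(\<lambda>\<omega>. raw_sq_err D (th \<omega> k) \<zeta>) \<in> borel_measurable (\<F> k)" for \<zeta>
      proof (rule borel_measurable_raw_sq_err[OF assms(15) _ assms(7)])
        show "th \<omega> k \<in> U" if "\<omega> \<in> space (\<F> k)" for \<omega>
          using assms(14)[of k] that feasible by (simp add: subalgebra_def)
      qed
      have bound: "\<bar>raw_sq_err D (th \<omega> k) \<zeta>\<bar>
          \<le> real CARD('s \<times> 'a) * (real CARD('s) * (1 / (disc D * (1 - disc D) * \<rho>min * \<pi>min) + 1)\<^sup>2)"
        if "\<omega> \<in> space M" for \<omega> \<zeta>
        using raw_sq_err_bounded[OF disc assms(21,22,23) assms(24)[OF that]] nonneg by simp
      have mean: "measure_pmf.expectation (traj_pmf D (th \<omega> k) (m k) (s0 \<omega> k)) (raw_sq_err D (th \<omega> k))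
          \<le> ?C * (1 / real (m k))" if "\<omega> \<in> space M" for \<omega>
        by (rule expectation_raw_sq_err[OF disc assms(21,22,23) assms(24)[OF that] assms(20)])
      \<comment> \<open>Conditioning on \<open>\<F> k\<close> freezes \<open>th \<omega> k\<close>,
        and the trajectory then has the law \<open>traj_pmf\<close>; for each fixed trajectory the
        squared error is \<open>\<F> k\<close>-measurable.\<close>
      note * = expectation_of_conditional_pmf[where g = "\<lambda>\<zeta> \<omega>. raw_sq_err D (th \<omega> k) \<zeta>",
          OF assms(14)[of k] fin z _ assms(19) meas bound set_traj_pmf mean]
      show ?thesis using * assms(18) by simp
    qed
    have "AE \<omega> in M. summable (\<lambda>k. ?e k \<omega>)"
      using e nonneg assms(42) by (intro AE_summable_of_expectation_bound[where C = "\<lambda>k. ?C * (1 / real (m k))"] summable_mult) auto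
    then show ?thesis
    proof (rule AE_mp, intro AE_I2 impI)
      fix \<omega> assume \<omega>: "\<omega> \<in> space M" and e: "summable (\<lambda>k. ?e k \<omega>)"
      show "summable (\<lambda>k. (kern_err D (th \<omega>) (z \<omega>) k)\<^sup>2)"
        using occ_admm_run.kern_err_square_le[OF run[OF \<omega>]]
        by (intro summable_comparison_test'[OF summable_mult[OF e, of "real CARD('s \<times> 'a)"]]) simp
    qed
  qed
  then have "AE \<omega> in M.
        (\<exists>l::real. (\<lambda>k. Psi D \<beta> \<tau> Binf C0 (th \<omega>) (x \<omega>) (y \<omega>) (z \<omega>) k) \<longlonglongrightarrow> ereal l) \<and>
        summable (\<lambda>k. (norm (incr (th \<omega>) (Suc k)))\<^sup>2 + (norm (incr (x \<omega>) (Suc k)))\<^sup>2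
                      + (norm (incr (x \<omega>) k))\<^sup>2) \<and>
        (\<lambda>k. kern_err D (th \<omega>) (z \<omega>) k) \<longlonglongrightarrow> 0 \<and>
        (\<lambda>k. kkt_residual D (th \<omega> k) (x \<omega> k) (y \<omega> k)) \<longlonglongrightarrow> 0" for C0
  proof (rule AE_mp, intro AE_I2 impI)
    fix \<omega> assume \<omega>: "\<omega> \<in> space M" and sum: "summable (\<lambda>k. (kern_err D (th \<omega>) (z \<omega>) k)\<^sup>2)"
    interpret occ_admm_run D U "th \<omega>" "x \<omega>" "y \<omega>" "z \<omega>" "\<eta>\<theta> \<omega>" \<beta> \<eta>x \<eta>min Lbar LK \<kappa> A\<^sub>C a\<^sub>\<theta> Binf
      by (rule run[OF \<omega>])
    show "(\<exists>l::real. (\<lambda>k. Psi D \<beta> \<tau> Binf C0 (th \<omega>) (x \<omega>) (y \<omega>) (z \<omega>) k) \<longlonglongrightarrow> ereal l) \<and>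
        summable (\<lambda>k. (norm (incr (th \<omega>) (Suc k)))\<^sup>2 + (norm (incr (x \<omega>) (Suc k)))\<^sup>2
                      + (norm (incr (x \<omega>) k))\<^sup>2) \<and>
        (\<lambda>k. kern_err D (th \<omega>) (z \<omega>) k) \<longlonglongrightarrow> 0 \<and>
        (\<lambda>k. kkt_residual D (th \<omega> k) (x \<omega> k) (y \<omega> k)) \<longlonglongrightarrow> 0"
      unfolding \<tau>
      using Psi_converges[OF sum] increments_summable[OF sum] tendsto_zero_of_square_summable[OF sum]
        kkt_vanishes[OF sum] by blast
  qed
  ultimately show ?thesis by blast
qed

end
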